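(* Consider the Schrödinger equation $i\partial_tu(t,x)=\left(-\frac{d^2}{dx^2}+|x|\right)u(t,x)$, $(t,x)\in(0,\infty)\times\mathbb{R}$, with $u(0,\cdot)\in L^2(\mathbb{R})$. (i) If a measurable set $E\subset\mathbb{R}$ is an observable set at some time for this equation, then $E$ is weakly thick. (ii) For each $T>0$, neither $(0,\infty)$ nor $(-\infty,0)$ is an observable set at $T$ for this equation.
   Context: $|\cdot|$ denotes one-dimensional Lebesgue measure when applied to sets. For $T>0$, a measurable set $E\subset\mathbb{R}$ is called an observable set at $T$ for the equation if there is a constant $C_{obs}=C_{obs}(T,E)>0$ such that $\int_{\mathbb{R}}|u(0,x)|^2\,dx\le C_{obs}\int_0^T\int_E|u(t,x)|^2\,dx\,dt$ for every solution $u$ of the equation with $u(0,\cdot)\in L^2(\mathbb{R})$. It is called an observable set at some time if it is an observable set at $T$ for some $T>0$. The solution with initial datum $u_0$ is $u(t,\cdot)=e^{-itH}u_0$, where $H$ is the self-adjoint operator $-\frac{d^2}{dx^2}+|x|$ on $L^2(\mathbb{R})$. A measurable set $E\subset\mathbb{R}$ is weakly thick if $\liminf_{x\to+\infty}\frac{|E\cap[-x,x]|}{x}>0$. *)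

theory Defs
  imports "HOL-Analysis.Analysis"
begin

text \<open>Elements of \<open>L\<^sup>2(\<real>)\<close> are represented by square-integrable functions;
  equality in \<open>L\<^sup>2(\<real>)\<close> is equality almost everywhere.\<close>

definition L2 :: "(real \<Rightarrow> complex) set" where
  "L2 = {f. f \<in> borel_measurable lebesgue \<and> integrable lebesgue (\<lambda>x. (cmod (f x))\<^sup>2)}"

definition L2_norm :: "(real \<Rightarrow> complex) \<Rightarrow> real" where
  "L2_norm f = sqrt (LINT x|lebesgue. (cmod (f x))\<^sup>2)"

definition ae_eq :: "(real \<Rightarrow> complex) \<Rightarrow> (real \<Rightarrow> complex) \<Rightarrow> bool" where
  "ae_eq f g \<longleftrightarrow> (AE x in lebesgue. f x = g x)"

text \<open>\<open>loc_ac_deriv F f\<close>: \<open>F\<close> is locally absolutely continuous on the line with a.e. derivative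
  \<open>f\<close>, i.e. \<open>F\<close> is an indefinite integral of the locally Lebesgue integrable function \<open>f\<close>.\<close>

definition loc_ac_deriv :: "(real \<Rightarrow> complex) \<Rightarrow> (real \<Rightarrow> complex) \<Rightarrow> bool" where
  "loc_ac_deriv F f \<longleftrightarrow>
     (\<forall>a b. a \<le> b \<longrightarrow> set_integrable lebesgue {a..b} f \<and>
                       F b - F a = (LINT x:{a..b}|lebesgue. f x))"

text \<open>The graph of the self-adjoint operator \<open>H = -d\<^sup>2/dx\<^sup>2 + \<bar>x\<bar>\<close> on its maximal
  domain: \<open>f \<in> L\<^sup>2\<close> lies in the domain iff (up to a null set) \<open>f\<close> and \<open>f'\<close> are locally absolutely
  continuous and \<open>-f'' + \<bar>x\<bar> f \<in> L\<^sup>2\<close>. As both endpoints are in the limit-point case, this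
  is the only self-adjoint realization.\<close>

definition H_graph :: "(real \<Rightarrow> complex) \<Rightarrow> (real \<Rightarrow> complex) \<Rightarrow> bool" where
  "H_graph f g \<longleftrightarrow> f \<in> L2 \<and> g \<in> L2 \<and>
     (\<exists>f0 f1 f2. ae_eq f f0 \<and> loc_ac_deriv f0 f1 \<and> loc_ac_deriv f1 f2 \<and>
        ae_eq g (\<lambda>x. - f2 x + complex_of_real \<bar>x\<bar> * f0 x))"

text \<open>Strongly continuous one-parameter unitary groups on \<open>L\<^sup>2(\<real>)\<close>. Surjectivity of each
  \<open>U t\<close> follows from the group law.\<close>

definition unitary_group :: "(real \<Rightarrow> (real \<Rightarrow> complex) \<Rightarrow> (real \<Rightarrow> complex)) \<Rightarrow> bool" where
  "unitary_group U \<longleftrightarrow>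
     (\<forall>t. \<forall>f\<in>L2. U t f \<in> L2) \<and>
     (\<forall>t. \<forall>f\<in>L2. \<forall>g\<in>L2. ae_eq f g \<longrightarrow> ae_eq (U t f) (U t g)) \<and>
     (\<forall>t a b. \<forall>f\<in>L2. \<forall>g\<in>L2.
        ae_eq (U t (\<lambda>x. a * f x + b * g x)) (\<lambda>x. a * U t f x + b * U t g x)) \<and>
     (\<forall>t. \<forall>f\<in>L2. L2_norm (U t f) = L2_norm f) \<and>
     (\<forall>f\<in>L2. ae_eq (U 0 f) f) \<and>
     (\<forall>s t. \<forall>f\<in>L2. ae_eq (U (s + t) f) (U s (U t f))) \<and>
     (\<forall>f\<in>L2. ((\<lambda>t. L2_norm (\<lambda>x. U t f x - f x)) \<longlongrightarrow> 0) (at 0))"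

text \<open>\<open>U t = e\<^sup>-\<^sup>i\<^sup>t\<^sup>A\<close> in the sense of Stone's theorem: \<open>U\<close> is the strongly continuous unitary
  group whose infinitesimal generator, including its domain, is \<open>-iA\<close>, for \<open>A\<close> given by its
  graph.\<close>

definition exp_minus_i ::
    "((real \<Rightarrow> complex) \<Rightarrow> (real \<Rightarrow> complex) \<Rightarrow> bool)
      \<Rightarrow> (real \<Rightarrow> (real \<Rightarrow> complex) \<Rightarrow> (real \<Rightarrow> complex)) \<Rightarrow> bool" where
  "exp_minus_i A U \<longleftrightarrow> unitary_group U \<and>
     (\<forall>f\<in>L2. \<forall>g\<in>L2. A f g \<longleftrightarrow>
        ((\<lambda>h. L2_norm (\<lambda>x. (U h f x - f x) / complex_of_real h - (- \<i> * g x))) \<longlongrightarrow> 0) (at 0))"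

text \<open>\<open>u t x\<close> is the value at time \<open>t \<ge> 0\<close> and position \<open>x\<close>; values at negative times are
  irrelevant.\<close>

definition schroedinger_solution :: "(real \<Rightarrow> real \<Rightarrow> complex) \<Rightarrow> bool" where
  "schroedinger_solution u \<longleftrightarrow> u 0 \<in> L2 \<and>
     (\<exists>U. exp_minus_i H_graph U \<and> (\<forall>t\<ge>0. ae_eq (u t) (U t (u 0))))"

definition observable_set_at :: "real \<Rightarrow> real set \<Rightarrow> bool" where
  "observable_set_at T E \<longleftrightarrow>
     (\<exists>C>0. \<forall>u. schroedinger_solution u \<longrightarrow>
        (LINT x|lebesgue. (cmod (u 0 x))\<^sup>2)
          \<le> C * (LINT t:{0..T}|lebesgue. (LINT x:E|lebesgue. (cmod (u t x))\<^sup>2)))"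

definition observable_set_at_some_time :: "real set \<Rightarrow> bool" where
  "observable_set_at_some_time E \<longleftrightarrow> (\<exists>T>0. observable_set_at T E)"

definition weakly_thick :: "real set \<Rightarrow> bool" where
  "weakly_thick E \<longleftrightarrow>
     Liminf at_top (\<lambda>x::real. ereal (measure lebesgue (E \<inter> {-x..x}) / x)) > 0"

end

theory Submission
  imports Defs
begin

text \<open>Solutions starting from a fixed bump translated to \<open>c\<close> stay near \<open>c\<close> on \<open>[0,T]\<close>, uniformly in
  \<open>c\<close>: since the force \<open>-\<bar>x\<bar>'\<close> has modulus at most 1, conservation of energy bounds the kinetic
  energy \<open>\<parallel>u'\<parallel>\<^sup>2\<close> independently of \<open>c\<close>, and the weighted norm \<open>\<integral> min(\<bar>x - c\<bar>, L) \<bar>u\<bar>\<^sup>2\<close> then grows at a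
  bounded rate.  Hence the mass outside \<open>[c - L, c + L]\<close> is \<open>O(1/L)\<close>, while inside it \<open>\<bar>u\<bar>\<^sup>2\<close> is bounded
  and \<open>E\<close> sees at most a multiple of \<open>\<bar>E \<inter> [c - L, c + L]\<bar>\<close>.  If \<open>E\<close> is not weakly thick, or is a
  half-line, this measure can be made arbitrarily small for every \<open>L\<close>.

  The statement also needs that \<open>e\<^sup>-\<^sup>i\<^sup>t\<^sup>H\<close> exists: \<open>H\<close> is symmetric (its domain consists of functions
  with \<open>u'\<close> in \<open>L\<^sup>2\<close>, so no boundary terms appear at infinity) and equals the adjoint of its restriction to
  compactly supported functions, and a self-adjoint operator generates a unitary group by Yosida
  approximation.\<close>

subsection \<open>Bounded operators as a Banach algebra\<close>

text \<open>The difficulty is uniformity in \<open>c\<close>. A bump near \<open>c\<close> has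
  potential energy of order |c|, so conservation of energy alone bounds the kinetic energy only by a
  multiple of |c|. What matters is the loss of potential energy, and it obeys the same flux
  inequality as the spreading: the weight min(|x|, M) agrees with |x| on the support of the datum
  and lies below |x| everywhere, so the loss is at most the change of a weighted norm, whose rate is
  bounded through the kinetic energy itself. The circle is closed by taking the supremum over [0,T],
  finite by conservation, and absorbing half of it. Weights are truncated because multiplication by
  a bounded function is a bounded operator, so that the weighted norm is differentiable along the
  flow. The potential enters the integrated equation only through a real term and drops out of the
  imaginary part, which is the flux. Existence of the group is not a side issue: observability
  quantifies over solutions, a solution refers to a group generated exactly by -iH, and without such
  a group every set would be observable.\<close>

typedef (overloaded) 'a blop = "UNIV :: ('a::{real_normed_vector} \<Rightarrow>\<^sub>L 'a) set"
  morphisms blinfun_of Blop ..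

setup_lifting type_definition_blop

text \<open>The exponential series \<open>exp\<close> is available in every unital Banach algebra.
  With composition as product the endomorphisms of a Banach space form one, except on the zero
  space, where 0 = 1; the sort \<open>perfect_space\<close> excludes that space.\<close>

instantiation blop :: ("{banach, perfect_space}") real_normed_algebra_1
begin

lift_definition zero_blop :: "'a blop" is 0 .
lift_definition one_blop :: "'a blop" is id_blinfun .
lift_definition plus_blop :: "'a blop \<Rightarrow> 'a blop \<Rightarrow> 'a blop" is "(+)" .
lift_definition minus_blop :: "'a blop \<Rightarrow> 'a blop \<Rightarrow> 'a blop" is "(-)" .
lift_definition uminus_blop :: "'a blop \<Rightarrow> 'a blop" is "uminus" .
lift_definition times_blop :: "'a blop \<Rightarrow> 'a blop \<Rightarrow> 'a blop" is "(o\<^sub>L)" .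
lift_definition scaleR_blop :: "real \<Rightarrow> 'a blop \<Rightarrow> 'a blop" is "scaleR" .
lift_definition norm_blop :: "'a blop \<Rightarrow> real" is "norm" .
lift_definition dist_blop :: "'a blop \<Rightarrow> 'a blop \<Rightarrow> real" is "dist" .
definition sgn_blop :: "'a blop \<Rightarrow> 'a blop" where "sgn_blop x = inverse (norm x) *\<^sub>R x"
definition uniformity_blop :: "('a blop \<times> 'a blop) filter" where
  "uniformity_blop = (INF e\<in>{0<..}. principal {(x, y). dist x y < e})"
definition open_blop :: "'a blop set \<Rightarrow> bool" where
  "open_blop U = (\<forall>x\<in>U. \<forall>\<^sub>F (x', y) in uniformity. x' = x \<longrightarrow> y \<in> U)"

instance
proof
  fix a b c :: "'a blop" and r s :: real
  show "a + b + c = a + (b + c)" "a + b = b + a" "0 + a = a" "- a + a = 0" "a - b = a + - b"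
    "r *\<^sub>R (a + b) = r *\<^sub>R a + r *\<^sub>R b" "(r + s) *\<^sub>R a = r *\<^sub>R a + s *\<^sub>R a"
    "r *\<^sub>R s *\<^sub>R a = (r * s) *\<^sub>R a" "1 *\<^sub>R a = a"
    by (transfer, simp add: algebra_simps)+
  show "a * b * c = a * (b * c)" "1 * a = a" "a * 1 = a"
    "(a + b) * c = a * c + b * c" "a * (b + c) = a * b + a * c"
    "r *\<^sub>R a * b = r *\<^sub>R (a * b)" "a * r *\<^sub>R b = r *\<^sub>R (a * b)"
    by (transfer, rule blinfun_eqI, simp add: blinfun.bilinear_simps)+
  show "(0::'a blop) \<noteq> 1"
    by transfer (metis norm_blinfun_id norm_zero zero_neq_one)
  show "dist a b = norm (a - b)" "norm (a + b) \<le> norm a + norm b"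
    "norm (r *\<^sub>R a) = \<bar>r\<bar> * norm a" "(norm a = 0) = (a = 0)"
    by (transfer, simp add: dist_norm norm_triangle_ineq)+
  show "norm (a * b) \<le> norm a * norm b"
    by transfer (rule norm_blinfun_compose)
  show "norm (1::'a blop) = 1"
    by transfer simp
  show "sgn a = inverse (norm a) *\<^sub>R a" by (rule sgn_blop_def)
  show "(uniformity :: ('a blop \<times> 'a blop) filter) = (INF e\<in>{0<..}. principal {(x, y). dist x y < e})"
    by (rule uniformity_blop_def)
  fix U :: "'a blop set"
  show "open U = (\<forall>x\<in>U. \<forall>\<^sub>F (x', y) in uniformity. x' = x \<longrightarrow> y \<in> U)"
    by (rule open_blop_def)
qed

end

instance blop :: ("{banach, perfect_space}") banach
proof
  fix X :: "nat \<Rightarrow> 'a blop" assume "Cauchy X"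
  then have "Cauchy (\<lambda>n. blinfun_of (X n))"
    unfolding Cauchy_def dist_blop.rep_eq .
  then obtain l where "(\<lambda>n. blinfun_of (X n)) \<longlonglongrightarrow> l"
    using Cauchy_convergent_iff convergent_def by blast
  then have "X \<longlonglongrightarrow> Blop l"
    unfolding lim_sequentially dist_blop.rep_eq by (simp add: Blop_inverse)
  then show "convergent X" by (auto simp: convergent_def)
qed

definition blop_apply :: "'a::{banach, perfect_space} blop \<Rightarrow> 'a \<Rightarrow> 'a" (infixl "\<bullet>\<^sub>o" 200) where
  "blop_apply S x = blinfun_apply (blinfun_of S) x"

lemma norm_blop_apply: "norm (S \<bullet>\<^sub>o x) \<le> norm S * norm x"
  unfolding blop_apply_def norm_blop.rep_eq by (rule norm_blinfun)

interpretation blop: bounded_bilinear "blop_apply"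
proof
  fix a a' :: "'a blop" and b b' :: 'a and r :: real
  show "(a + a') \<bullet>\<^sub>o b = a \<bullet>\<^sub>o b + a' \<bullet>\<^sub>o b" "a \<bullet>\<^sub>o (b + b') = a \<bullet>\<^sub>o b + a \<bullet>\<^sub>o b'"
    "(r *\<^sub>R a) \<bullet>\<^sub>o b = r *\<^sub>R (a \<bullet>\<^sub>o b)" "a \<bullet>\<^sub>o (r *\<^sub>R b) = r *\<^sub>R (a \<bullet>\<^sub>o b)"
    by (simp_all add: blop_apply_def plus_blop.rep_eq scaleR_blop.rep_eq blinfun.bilinear_simps)
  show "\<exists>K. \<forall>a b. norm (a \<bullet>\<^sub>o (b::'a)) \<le> norm a * norm b * K"
    by (rule exI[of _ 1]) (simp add: norm_blop_apply)
qed

lemma blop_apply_mult [simp]: "(S * T) \<bullet>\<^sub>o x = S \<bullet>\<^sub>o (T \<bullet>\<^sub>o x)"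
  by (simp add: blop_apply_def times_blop.rep_eq)

lemma blop_apply_one [simp]: "1 \<bullet>\<^sub>o x = x"
  by (simp add: blop_apply_def one_blop.rep_eq)

lemma blop_eqI: "(\<And>x. S \<bullet>\<^sub>o x = T \<bullet>\<^sub>o x) \<Longrightarrow> S = T"
  unfolding blop_apply_def using blinfun_eqI blinfun_of_inject by blast

lemma ex_blop:
  assumes "bounded_linear f"
  shows "\<exists>S. \<forall>x. S \<bullet>\<^sub>o x = f x"
  by (rule exI[of _ "Blop (Blinfun f)"])
    (simp add: blop_apply_def Blop_inverse bounded_linear_Blinfun_apply[OF assms])

subsection \<open>Real Hilbert spaces\<close>

lemma norm_diff_sq: "(norm (x - y))\<^sup>2 = (norm x)\<^sup>2 - 2 * inner x y + (norm (y::'a::real_inner))\<^sup>2"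
  by (simp add: power2_norm_eq_inner inner_diff inner_commute)

text \<open>A minimising sequence for the distance to the subspace is Cauchy by the parallelogram law.\<close>

lemma subspace_nearest_point:
  fixes S :: "'a::{real_inner, complete_space} set"
  assumes S: "closed S" "subspace S"
  shows "\<exists>y\<in>S. \<forall>s\<in>S. norm (x - y) \<le> norm (x - s)"
proof -
  define d where "d = (INF s\<in>S. norm (x - s))"
  have ne: "S \<noteq> {}" using S(2) subspace_0 by blast
  have bdd: "bdd_below ((\<lambda>s. norm (x - s)) ` S)" by (rule bdd_belowI[of _ 0]) auto
  have d_le: "d \<le> norm (x - s)" if "s \<in> S" for s
    unfolding d_def using bdd that by (rule cINF_lower)
  have d0: "0 \<le> d" unfolding d_def by (rule cINF_greatest[OF ne]) auto
  have "\<exists>s\<in>S. norm (x - s) < d + inverse (Suc n)" for n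
    using cInf_lessD[of "(\<lambda>s. norm (x - s)) ` S" "d + inverse (Suc n)"] ne
    by (auto simp: d_def)
  then obtain s where s: "\<And>n. s n \<in> S" "\<And>n. norm (x - s n) < d + inverse (Suc n)" by metis
  have par: "(norm (a - b))\<^sup>2 \<le> 2 * (norm (x - a))\<^sup>2 + 2 * (norm (x - b))\<^sup>2 - 4 * d\<^sup>2"
    if "a \<in> S" "b \<in> S" for a b
  proof -
    have "(1/2) *\<^sub>R (a + b) \<in> S" using that S(2) by (simp add: subspace_add subspace_scale)
    then have "d \<le> norm (x - (1/2) *\<^sub>R (a + b))" by (rule d_le)
    then have "d\<^sup>2 \<le> (norm (x - (1/2) *\<^sub>R (a + b)))\<^sup>2" using d0 by (simp add: power_mono)
    also have "\<dots> = ((norm (x - a))\<^sup>2 + (norm (x - b))\<^sup>2) / 2 - (norm (a - b))\<^sup>2 / 4"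
      by (simp add: power2_norm_eq_inner inner_diff inner_add inner_commute field_simps)
    finally show ?thesis by (simp add: field_simps)
  qed
  have lim: "(\<lambda>n. norm (x - s n)) \<longlonglongrightarrow> d"
  proof (rule tendsto_sandwich[of "\<lambda>_. d" _ _ "\<lambda>n. d + inverse (Suc n)"])
    show "(\<lambda>n. d + inverse (real (Suc n))) \<longlonglongrightarrow> d"
      using tendsto_add[OF tendsto_const LIMSEQ_inverse_real_of_nat, of d] by simp
  qed (auto intro!: always_eventually d_le s intro: less_imp_le[OF s(2), simplified])
  have "Cauchy s"
  proof (rule metric_CauchyI)
    fix e :: real assume e: "e > 0"
    have "(\<lambda>n. (norm (x - s n))\<^sup>2) \<longlonglongrightarrow> d\<^sup>2" by (intro tendsto_intros lim)
    then have "\<forall>\<^sub>F n in sequentially. (norm (x - s n))\<^sup>2 < d\<^sup>2 + e\<^sup>2/4"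
      by (rule order_tendstoD) (use e in simp)
    then obtain N where N: "\<And>n. n \<ge> N \<Longrightarrow> (norm (x - s n))\<^sup>2 < d\<^sup>2 + e\<^sup>2/4"
      by (auto simp: eventually_sequentially)
    have "dist (s m) (s n) < e" if "m \<ge> N" "n \<ge> N" for m n
    proof -
      have "(norm (s m - s n))\<^sup>2 < e\<^sup>2"
        using par[of "s m" "s n"] s(1) N[OF that(1)] N[OF that(2)] by fastforce
      then show ?thesis using e by (simp add: dist_norm power_less_imp_less_base)
    qed
    then show "\<exists>N. \<forall>m\<ge>N. \<forall>n\<ge>N. dist (s m) (s n) < e" by blast
  qed
  then obtain y where y: "s \<longlonglongrightarrow> y" using Cauchy_convergent_iff convergent_def by blast
  then have "y \<in> S" using S(1) s(1) closed_sequentially by blast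
  moreover have "norm (x - y) = d"
    using lim tendsto_norm[OF tendsto_diff[OF tendsto_const y, of x]] LIMSEQ_unique by blast
  ultimately show ?thesis using d_le by auto
qed

text \<open>The nearest point \<open>y\<close> of the subspace leaves a remainder
  \<open>x - y\<close> orthogonal to it, so a trivial orthogonal complement forces x = y. It yields
  the density of the domain and the surjectivity of c - B for skew-adjoint operators.\<close>

lemma subspace_orthogonal_eq_UNIV:
  fixes S :: "'a::{real_inner, complete_space} set"
  assumes S: "closed S" "subspace S"
    and orth: "\<And>y. (\<And>s. s \<in> S \<Longrightarrow> inner y s = 0) \<Longrightarrow> y = 0"
  shows "S = UNIV"
proof -
  have "x \<in> S" for x
  proof -
    obtain y where y: "y \<in> S" "\<And>s. s \<in> S \<Longrightarrow> norm (x - y) \<le> norm (x - s)"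
      using subspace_nearest_point[OF S] by blast
    have "inner (x - y) s = 0" if s: "s \<in> S" for s
    proof (cases "s = 0")
      case False
      \<comment> \<open>The minimiser of |x - y - t s| over real t; moving from y to y + t s would
        reduce the squared distance by (x - y, s)^2 / |s|^2.\<close>
      define t where "t = inner (x - y) s / inner s s"
      have "y + t *\<^sub>R s \<in> S" using S(2) y(1) s by (simp add: subspace_add subspace_scale)
      then have "(norm (x - y))\<^sup>2 \<le> (norm ((x - y) - t *\<^sub>R s))\<^sup>2"
        using y(2)[of "y + t *\<^sub>R s"] by (simp add: diff_diff_eq power_mono)
      also have "\<dots> = (norm (x - y))\<^sup>2 - 2 * t * inner (x - y) s + t * t * inner s s"
        unfolding norm_diff_sq[of "x - y"] by (simp add: power_mult_distrib power2_norm_eq_inner flip: power2_eq_square)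
      also have "\<dots> = (norm (x - y))\<^sup>2 - (inner (x - y) s)\<^sup>2 / inner s s"
        using False by (simp add: t_def field_simps power2_eq_square)
      finally have "(inner (x - y) s)\<^sup>2 / inner s s \<le> 0" by simp
      then show ?thesis using False
        by (metis divide_le_0_iff inner_gt_zero_iff not_less power2_less_0 zero_eq_power2 order.antisym zero_le_power2)
    qed simp
    then have "x - y = 0" by (rule orth)
    then show ?thesis using y(1) by simp
  qed
  then show ?thesis by auto
qed

subsection \<open>Exponentials of bounded skew operators\<close>

lemma exp_blop_has_derivative:
  "((\<lambda>t. exp (t *\<^sub>R S) \<bullet>\<^sub>o x) has_vector_derivative exp (t *\<^sub>R S) \<bullet>\<^sub>o (S \<bullet>\<^sub>o x)) (at t)"
  for S :: "'a::{banach, perfect_space} blop"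
  using bounded_linear.has_vector_derivative[OF blop.bounded_linear_left exp_scaleR_has_vector_derivative_right[of S t UNIV]]
  by simp

lemma exp_blop_commute:
  fixes S T :: "'a::{banach, perfect_space} blop"
  assumes "S * T = T * S"
  shows "exp (t *\<^sub>R S) * T = T * exp (t *\<^sub>R S)"
proof -
  have "T * exp X = exp X * T" if "T * X = X * T" for X :: "'a blop"
    using power_commuting_commutes[OF that[symmetric]]
    by (simp add: exp_def suminf_mult[symmetric] summable_exp_generic suminf_mult2)
  then show ?thesis by (simp add: assms)
qed

text \<open>The derivative of the squared norm is 2 (u, u') = 0. Applied to exponentials it gives
  isometry; applied to a difference of two solutions with the same initial value it gives
  uniqueness.\<close>

lemma isometry_of_skew_derivative:
  fixes u :: "real \<Rightarrow> 'a::real_inner"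
  assumes u: "\<And>t. (u has_vector_derivative u' t) (at t)" and skew: "\<And>t. inner (u t) (u' t) = 0"
  shows "norm (u t) = norm (u 0)"
proof -
  have "((\<lambda>t. inner (u t) (u t)) has_vector_derivative 0) (at s)" for s
    using bounded_bilinear.has_vector_derivative[OF bounded_bilinear_inner u u] skew
    by (simp add: inner_commute)
  then have "((\<lambda>t. inner (u t) (u t)) has_real_derivative 0) (at s)" for s
    by (simp add: has_real_derivative_iff_has_vector_derivative)
  then have "inner (u t) (u t) = inner (u 0) (u 0)" by (intro DERIV_isconst_all allI)
  then show ?thesis by (simp add: norm_eq_sqrt_inner)
qed

lemma norm_exp_skew:
  fixes S :: "'a::{real_inner, banach, perfect_space} blop"
  assumes skew: "\<And>x. inner x (S \<bullet>\<^sub>o x) = 0"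
  shows "norm (exp (t *\<^sub>R S) \<bullet>\<^sub>o x) = norm x"
proof -
  have "exp (s *\<^sub>R S) \<bullet>\<^sub>o (S \<bullet>\<^sub>o x) = S \<bullet>\<^sub>o (exp (s *\<^sub>R S) \<bullet>\<^sub>o x)" for s
    using exp_blop_commute[of S S s] by (metis blop_apply_mult)
  then show ?thesis
    using isometry_of_skew_derivative[OF exp_blop_has_derivative[of S x], of t] skew by simp
qed

text \<open>Mean value inequality for the curve s -> exp(s S) x - s y. With y = 0 it bounds the
  displacement by |t| |S x|; with y the image of x under the unbounded operator it controls the
  difference quotient in \<open>group_derivative_0\<close>.\<close>

lemma norm_exp_skew_diff:
  fixes S :: "'a::{real_inner, banach, perfect_space} blop"
  assumes skew: "\<And>x. inner x (S \<bullet>\<^sub>o x) = 0"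
    and bd: "\<And>s. \<bar>s\<bar> \<le> \<bar>t\<bar> \<Longrightarrow> norm (exp (s *\<^sub>R S) \<bullet>\<^sub>o (S \<bullet>\<^sub>o x) - y) \<le> M"
  shows "norm (exp (t *\<^sub>R S) \<bullet>\<^sub>o x - x - t *\<^sub>R y) \<le> \<bar>t\<bar> * M"
proof -
  let ?f = "\<lambda>s. exp (s *\<^sub>R S) \<bullet>\<^sub>o x - s *\<^sub>R y"
  have "norm (?f t - ?f 0) \<le> M * norm (t - 0)"
  proof (rule differentiable_bound[where S = "{-\<bar>t\<bar>..\<bar>t\<bar>}" and f' = "\<lambda>s h. h *\<^sub>R (exp (s *\<^sub>R S) \<bullet>\<^sub>o (S \<bullet>\<^sub>o x) - y)"])
    fix s assume s: "s \<in> {-\<bar>t\<bar>..\<bar>t\<bar>}"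
    have "(?f has_vector_derivative exp (s *\<^sub>R S) \<bullet>\<^sub>o (S \<bullet>\<^sub>o x) - 1 *\<^sub>R y) (at s)"
      by (intro has_vector_derivative_diff exp_blop_has_derivative)
        (auto intro!: derivative_eq_intros simp: has_vector_derivative_def)
    then show "(?f has_derivative (\<lambda>h. h *\<^sub>R (exp (s *\<^sub>R S) \<bullet>\<^sub>o (S \<bullet>\<^sub>o x) - y))) (at s within {-\<bar>t\<bar>..\<bar>t\<bar>})"
      by (simp add: has_vector_derivative_def has_derivative_at_withinI)
    have "\<bar>s\<bar> \<le> \<bar>t\<bar>" using s by auto
    then have "norm (exp (s *\<^sub>R S) \<bullet>\<^sub>o (S \<bullet>\<^sub>o x) - y) \<le> M" by (rule bd)
    then show "onorm (\<lambda>h. h *\<^sub>R (exp (s *\<^sub>R S) \<bullet>\<^sub>o (S \<bullet>\<^sub>o x) - y)) \<le> M"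
      by (intro onorm_le) (simp add: mult.commute[of M] mult_left_mono)
  qed (auto simp: abs_le_iff)
  then show ?thesis by (simp add: algebra_simps)
qed

lemma norm_exp_skew_diff_le:
  fixes S :: "'a::{real_inner, banach, perfect_space} blop"
  assumes skew: "\<And>x. inner x (S \<bullet>\<^sub>o x) = 0"
  shows "norm (exp (t *\<^sub>R S) \<bullet>\<^sub>o x - x) \<le> \<bar>t\<bar> * norm (S \<bullet>\<^sub>o x)"
  using norm_exp_skew_diff[OF skew, of t x 0 "norm (S \<bullet>\<^sub>o x)"] norm_exp_skew[OF skew] by simp

text \<open>An e/2 argument with a Lipschitz constant independent of \<open>i\<close>. It reduces
  the convergence of \<open>Pos\<close>, of the approximating groups and of \<open>group\<close> at
  time 0 to the dense domain; the filter is arbitrary because these limits run over indices, pairs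
  of indices and times.\<close>

lemma closed_tendsto_zero:
  fixes F :: "'i \<Rightarrow> 'a::real_normed_vector \<Rightarrow> 'b::real_normed_vector"
  assumes lip: "\<And>i x y. norm (F i x - F i y) \<le> K * norm (x - y)"
  shows "closed {x. ((\<lambda>i. F i x) \<longlongrightarrow> 0) G}"
  unfolding closed_sequential_limits
proof safe
  fix X l assume X: "\<forall>n. X n \<in> {x. ((\<lambda>i. F i x) \<longlongrightarrow> 0) G}" and l: "X \<longlonglongrightarrow> l"
  show "((\<lambda>i. F i l) \<longlongrightarrow> 0) G"
  proof (rule tendstoI)
    fix e :: real assume e: "e > 0"
    have "(\<lambda>n. \<bar>K\<bar> * norm (l - X n)) \<longlonglongrightarrow> \<bar>K\<bar> * norm (l - l)" by (intro tendsto_intros l)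
    then have "\<forall>\<^sub>F n in sequentially. \<bar>K\<bar> * norm (l - X n) < e/2"
      by (rule order_tendstoD) (use e in simp)
    then obtain n where n: "\<bar>K\<bar> * norm (l - X n) < e/2"
      using eventually_happens'[OF sequentially_bot] by blast
    have "\<forall>\<^sub>F i in G. dist (F i (X n)) 0 < e/2" using X e by (intro tendstoD) auto
    then show "\<forall>\<^sub>F i in G. dist (F i l) 0 < e"
    proof eventually_elim
      case (elim i)
      have "norm (F i l - F i (X n)) \<le> \<bar>K\<bar> * norm (l - X n)"
        by (rule order_trans[OF lip mult_right_mono]) auto
      then show ?case using elim n norm_triangle_sub[of "F i l" "F i (X n)"] by simp
    qed
  qed
qed

lemma closure_of_subspace:
  fixes S :: "'a::real_normed_vector set"
  assumes S: "subspace S"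
  shows "subspace (closure S)"
  unfolding subspace_def
proof (intro conjI ballI allI)
  show "0 \<in> closure S" using subspace_0[OF S] closure_subset by blast
next
  fix x y assume "x \<in> closure S" "y \<in> closure S"
  then obtain f g where "\<And>n. f n \<in> S" "f \<longlonglongrightarrow> x" "\<And>n. g n \<in> S" "g \<longlonglongrightarrow> y"
    unfolding closure_sequential by blast
  then show "x + y \<in> closure S" unfolding closure_sequential
    by (intro exI[of _ "\<lambda>n. f n + g n"]) (auto intro: tendsto_add subspace_add[OF S])
next
  fix c :: real and x assume "x \<in> closure S"
  then obtain f where "\<And>n. f n \<in> S" "f \<longlonglongrightarrow> x"
    unfolding closure_sequential by blast
  then show "c *\<^sub>R x \<in> closure S" unfolding closure_sequential
    by (intro exI[of _ "\<lambda>n. c *\<^sub>R f n"]) (auto intro: tendsto_scaleR subspace_scale[OF S])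
qed

subsection \<open>The unitary group of a skew-adjoint operator\<close>

text \<open>Operators are given by their graphs \<open>B\<close>.  Skew symmetry together with the surjectivity of all
  \<open>c - B\<close> for real \<open>c \<noteq> 0\<close> expresses skew-adjointness.\<close>

locale skew_adjoint =
  fixes B :: "'a::{real_inner, banach, perfect_space} \<Rightarrow> 'a \<Rightarrow> bool"
  assumes add: "B x x' \<Longrightarrow> B y y' \<Longrightarrow> B (x + y) (x' + y')"
    and scale: "B x x' \<Longrightarrow> B (r *\<^sub>R x) (r *\<^sub>R x')"
    and single: "B 0 y \<Longrightarrow> y = 0"
    and skew: "B x x' \<Longrightarrow> inner x x' = 0"
    and onto: "c \<noteq> 0 \<Longrightarrow> \<exists>x x'. B x x' \<and> c *\<^sub>R x - x' = y"
begin

lemma diff: "B x x' \<Longrightarrow> B y y' \<Longrightarrow> B (x - y) (x' - y')"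
  using add[of x x' "- y" "- y'"] scale[of y y' "- 1"] by simp

lemma skew2: "B x x' \<Longrightarrow> B y y' \<Longrightarrow> inner x y' = - inner x' y"
  using skew[OF add[of x x' y y']] skew[of x x'] skew[of y y'] by (simp add: inner_add inner_commute)

text \<open>Density is a consequence of surjectivity: if y is orthogonal to the domain and z - z' =
  y with B z z', then (y, z) = 0 and skewness give z = 0, and single-valuedness gives z' =
  0.\<close>

lemma dense_domain: "closure {x. \<exists>x'. B x x'} = UNIV"
proof (rule subspace_orthogonal_eq_UNIV)
  have "0 \<in> {x. \<exists>x'. B x x'}"
    using onto[of 1 0] scale[of _ _ 0] by auto
  then show "subspace (closure {x. \<exists>x'. B x x'})"
    by (intro closure_of_subspace) (auto simp: subspace_def intro: add scale)
  fix y assume y: "\<And>s. s \<in> closure {x. \<exists>x'. B x x'} \<Longrightarrow> inner y s = 0"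
  obtain z z' where z: "B z z'" "1 *\<^sub>R z - z' = y" using onto[of 1 y] by auto
  have "inner y z = 0" using z(1) closure_subset[of "{x. \<exists>x'. B x x'}"] by (intro y) blast
  then have "inner z z = 0" using skew[OF z(1)] z(2) by (auto simp: inner_diff inner_commute)
  then show "y = 0" using z single by force
qed auto

lemma closed_dense: "closed S \<Longrightarrow> (\<And>x x'. B x x' \<Longrightarrow> x \<in> S) \<Longrightarrow> x \<in> S"
  using dense_domain closure_minimal[of "{x. \<exists>x'. B x x'}" S] by auto

text \<open>The hypothesis says (c - B) x = y. Pairing with x removes B x and leaves c |x|^2 = (x,
  y), to which Cauchy-Schwarz applies. For y = 0 it is the injectivity of c - B.\<close>

lemma resolvent_bound: "B x (c *\<^sub>R x - y) \<Longrightarrow> c \<noteq> 0 \<Longrightarrow> norm x \<le> norm y / \<bar>c\<bar>"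
proof -
  assume *: "B x (c *\<^sub>R x - y)" "c \<noteq> 0"
  have "c * (norm x)\<^sup>2 = inner x y" using skew[OF *(1)] by (simp add: inner_diff power2_norm_eq_inner)
  then have "\<bar>c\<bar> * (norm x)\<^sup>2 \<le> norm x * norm y"
    by (metis Cauchy_Schwarz_ineq2 abs_mult abs_power2)
  then have "norm x * (\<bar>c\<bar> * norm x) \<le> norm x * norm y" by (simp add: power2_eq_square mult_ac)
  then have "\<bar>c\<bar> * norm x \<le> norm y" by (cases "x = 0") auto
  then show ?thesis using *(2) by (simp add: field_simps)
qed

lemma ex_resolvent: "c \<noteq> 0 \<Longrightarrow> \<exists>S. \<forall>y. B (S \<bullet>\<^sub>o y) (c *\<^sub>R (S \<bullet>\<^sub>o y) - y)"
proof -
  assume c: "c \<noteq> 0"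
  have "\<exists>x. B x (c *\<^sub>R x - y)" for y
    using onto[OF c, of y] by (metis add_diff_cancel_left' diff_add_cancel)
  then obtain r where r: "\<And>y. B (r y) (c *\<^sub>R r y - y)" by metis
  have uniq: "x = r y" if "B x (c *\<^sub>R x - y)" for x y
    using resolvent_bound[of "x - r y" c 0] diff[OF that r[of y]] c by (simp add: algebra_simps)
  have "bounded_linear r"
  proof (rule bounded_linear_intro)
    show "r (x + y) = r x + r y" for x y
      using add[OF r[of x] r[of y]] by (intro uniq[symmetric]) (simp add: algebra_simps)
    show "r (k *\<^sub>R x) = k *\<^sub>R r x" for k x
      using scale[OF r[of x], of k] by (intro uniq[symmetric]) (simp add: algebra_simps)
    show "norm (r x) \<le> norm x * (1 / \<bar>c\<bar>)" for x
      using resolvent_bound[OF r c] by simp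
  qed
  from ex_blop[OF this] obtain S where "\<forall>x. S \<bullet>\<^sub>o x = r x" ..
  then show ?thesis using r by (intro exI[of _ S]) simp
qed

section \<open>Resolvents of B and a Yosida approximation by bounded skew operators\<close>

definition Res :: "real \<Rightarrow> 'a blop" where
  "Res c = (SOME S. \<forall>y. B (S \<bullet>\<^sub>o y) (c *\<^sub>R (S \<bullet>\<^sub>o y) - y))"

lemma Res: "c \<noteq> 0 \<Longrightarrow> B (Res c \<bullet>\<^sub>o y) (c *\<^sub>R (Res c \<bullet>\<^sub>o y) - y)"
  using someI_ex[OF ex_resolvent[of c]] unfolding Res_def by blast

lemma norm_Res: "c \<noteq> 0 \<Longrightarrow> norm (Res c \<bullet>\<^sub>o y) \<le> norm y / \<bar>c\<bar>"
  using resolvent_bound[OF Res] .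

lemma Res_unique: "B x x' \<Longrightarrow> c \<noteq> 0 \<Longrightarrow> c *\<^sub>R x - x' = y \<Longrightarrow> Res c \<bullet>\<^sub>o y = x"
  using resolvent_bound[of "Res c \<bullet>\<^sub>o y - x" c 0] diff[OF Res[of c y], of x x']
  by (auto simp: algebra_simps)

lemma resolvent_identity:
  assumes "c \<noteq> 0" "d \<noteq> 0"
  shows "Res c - Res d = (d - c) *\<^sub>R (Res c * Res d)"
proof (rule blop_eqI)
  fix y
  have "Res c \<bullet>\<^sub>o y = Res d \<bullet>\<^sub>o y + (d - c) *\<^sub>R (Res c \<bullet>\<^sub>o (Res d \<bullet>\<^sub>o y))"
    by (rule Res_unique[OF add[OF Res[OF assms(2), of y] scale[OF Res[OF assms(1), of "Res d \<bullet>\<^sub>o y"]]] assms(1)])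
      (simp add: algebra_simps)
  then show "(Res c - Res d) \<bullet>\<^sub>o y = ((d - c) *\<^sub>R (Res c * Res d)) \<bullet>\<^sub>o y"
    by (simp add: blop.diff_left blop.scaleR_left)
qed

lemma Res_commute: "c \<noteq> 0 \<Longrightarrow> d \<noteq> 0 \<Longrightarrow> Res c * Res d = Res d * Res c"
proof (cases "c = d")
  case False
  assume "c \<noteq> 0" "d \<noteq> 0"
  then have "(d - c) *\<^sub>R (Res c * Res d) = - ((c - d) *\<^sub>R (Res d * Res c))"
    by (simp flip: resolvent_identity)
  also have "\<dots> = (d - c) *\<^sub>R (Res d * Res c)" by (simp add: algebra_simps)
  finally show ?thesis using False by simp
qed simp

text \<open>Equal to \<open>B n\<^sup>2 / (n\<^sup>2 - B\<^sup>2)\<close>, a skew variant of the Yosida approximation.\<close>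

definition Yos :: "nat \<Rightarrow> 'a blop" where
  "Yos n = ((real (Suc n))\<^sup>2 / 2) *\<^sub>R (Res (real (Suc n)) + Res (- real (Suc n)))"

lemma Yos_commute: "Yos n * Yos m = Yos m * Yos n"
proof -
  have "(a + b) * (c + d) = (c + d) * (a + b)"
    if "a * c = c * a" "a * d = d * a" "b * c = c * b" "b * d = d * b" for a b c d :: "'a blop"
    using that by (simp add: distrib_left distrib_right)
  from this[OF Res_commute Res_commute Res_commute Res_commute]
  show ?thesis by (simp add: Yos_def mult.commute)
qed

text \<open>Skew symmetry of B makes the adjoint of \<open>Res c\<close> equal to -
  \<open>Res (- c)\<close>, so the sum of the two resolvents is skew. This is why both signs enter
  \<open>Yos\<close>: its exponentials are isometries for positive and negative times.\<close>

lemma Yos_skew: "inner x (Yos n \<bullet>\<^sub>o x) = 0"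
proof -
  let ?n = "real (Suc n)"
  have "inner (Res ?n \<bullet>\<^sub>o x) (- ?n *\<^sub>R (Res (- ?n) \<bullet>\<^sub>o x) - x)
      = - inner (?n *\<^sub>R (Res ?n \<bullet>\<^sub>o x) - x) (Res (- ?n) \<bullet>\<^sub>o x)"
    by (rule skew2[OF Res Res]) auto
  then have "inner x (Res ?n \<bullet>\<^sub>o x) + inner x (Res (- ?n) \<bullet>\<^sub>o x) = 0"
    by (simp add: inner_diff inner_commute del: of_nat_Suc)
  then show ?thesis by (simp add: Yos_def blop.scaleR_left blop.add_left inner_add del: of_nat_Suc)
qed

text \<open>This is n^2 / (n^2 - B^2), with \<open>Suc n\<close> in the role of n: a contraction
  tending strongly to the identity, through which \<open>Yos n\<close> is B followed by
  \<open>Pos n\<close> on the domain.\<close>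

definition Pos :: "nat \<Rightarrow> 'a blop" where
  "Pos n = (real (Suc n) / 2) *\<^sub>R (Res (real (Suc n)) - Res (- real (Suc n)))"

lemma Res_domain:
  assumes "B x x'" "c \<noteq> 0"
  shows "Res c \<bullet>\<^sub>o x = (1/c) *\<^sub>R (x + Res c \<bullet>\<^sub>o x')"
proof -
  have "Res c \<bullet>\<^sub>o (c *\<^sub>R x - x') = x" by (rule Res_unique[OF assms refl])
  then have "c *\<^sub>R (Res c \<bullet>\<^sub>o x) = x + Res c \<bullet>\<^sub>o x'"
    by (simp add: blop.diff_right blop.scaleR_right algebra_simps)
  then have "(1/c) *\<^sub>R (c *\<^sub>R (Res c \<bullet>\<^sub>o x)) = (1/c) *\<^sub>R (x + Res c \<bullet>\<^sub>o x')" by simp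
  then show ?thesis using assms(2) by simp
qed

text \<open>By \<open>Res_domain\<close> the identity parts x/n and -x/n of the two resolvents
  cancel in their sum; what remains is the difference of the resolvents of x' with a factor
  1/n.\<close>

lemma Yos_domain: "B x x' \<Longrightarrow> Yos n \<bullet>\<^sub>o x = Pos n \<bullet>\<^sub>o x'"
  by (simp add: Yos_def Pos_def blop.scaleR_left blop.add_left blop.diff_left
      Res_domain[of x x' "real (Suc n)"] Res_domain[of x x' "- real (Suc n)"] power2_eq_square
      del: of_nat_Suc flip: scaleR_scaleR)
    (simp add: algebra_simps del: of_nat_Suc)

lemma norm_Pos: "norm (Pos n \<bullet>\<^sub>o y) \<le> norm y"
proof -
  let ?n = "real (Suc n)"
  have "norm (Res ?n \<bullet>\<^sub>o y - Res (- ?n) \<bullet>\<^sub>o y) \<le> norm y / ?n + norm y / ?n"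
    using norm_Res[of ?n y] norm_Res[of "- ?n" y]
    by (intro norm_triangle_le_diff add_mono) (auto simp del: of_nat_Suc)
  then have "?n / 2 * norm (Res ?n \<bullet>\<^sub>o y - Res (- ?n) \<bullet>\<^sub>o y) \<le> norm y" by (simp add: field_simps del: of_nat_Suc)
  then show ?thesis by (simp add: Pos_def blop.scaleR_left blop.diff_left del: of_nat_Suc)
qed

lemma Pos_tendsto: "(\<lambda>n. Pos n \<bullet>\<^sub>o y) \<longlonglongrightarrow> y"
proof -
  have "y \<in> {y. (\<lambda>n. Pos n \<bullet>\<^sub>o y - y) \<longlonglongrightarrow> 0}"
  proof (rule closed_dense[OF closed_tendsto_zero[where K = 2]])
    fix i x y
    show "norm (Pos i \<bullet>\<^sub>o x - x - (Pos i \<bullet>\<^sub>o y - y)) \<le> 2 * norm (x - y)"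
      using norm_Pos[of i "x - y"] norm_triangle_ineq4[of "Pos i \<bullet>\<^sub>o (x - y)" "x - y"]
      by (simp add: blop.diff_right algebra_simps)
  next
    fix x x' assume x: "B x x'"
    \<comment> \<open>On the domain, Pos - 1 is the mean of the two resolvents applied to x', hence
      O(1/n).\<close>
    have "norm (Pos n \<bullet>\<^sub>o x - x) \<le> norm x' * (1 / real (Suc n))" for n
    proof -
      let ?n = "real (Suc n)"
      have "Pos n \<bullet>\<^sub>o x - x = (1/2) *\<^sub>R (Res ?n \<bullet>\<^sub>o x' + Res (- ?n) \<bullet>\<^sub>o x')"
        by (simp add: Pos_def blop.scaleR_left blop.diff_left Res_domain[OF x, of ?n]
          Res_domain[OF x, of "- ?n"] algebra_simps del: of_nat_Suc)
         (metis (no_types, lifting) field_sum_of_halves scaleR_left_distrib scaleR_one)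
      moreover have "norm (Res ?n \<bullet>\<^sub>o x' + Res (- ?n) \<bullet>\<^sub>o x') \<le> norm x' / ?n + norm x' / ?n"
        using norm_Res[of ?n x'] norm_Res[of "- ?n" x']
        by (intro norm_triangle_le add_mono) (auto simp del: of_nat_Suc)
      ultimately show ?thesis by (simp add: mult.commute del: of_nat_Suc)
    qed
    then have "(\<lambda>n. Pos n \<bullet>\<^sub>o x - x) \<longlonglongrightarrow> 0"
      by (intro Lim_null_comparison[OF always_eventually[OF allI] tendsto_mult_right_zero[OF LIMSEQ_inverse_real_of_nat]])
        (simp add: inverse_eq_divide)
    then show "x \<in> {y. (\<lambda>n. Pos n \<bullet>\<^sub>o y - y) \<longlonglongrightarrow> 0}" by simp
  qed
  then show ?thesis by (simp add: LIM_zero_iff)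
qed

lemma Yos_tendsto: "B x x' \<Longrightarrow> (\<lambda>n. Yos n \<bullet>\<^sub>o x) \<longlonglongrightarrow> x'"
  using Pos_tendsto[of x'] Yos_domain[of x x'] by simp

section \<open>The limit of the approximating groups and its generator\<close>

abbreviation E :: "nat \<Rightarrow> real \<Rightarrow> 'a \<Rightarrow> 'a" where
  "E n t x \<equiv> exp (t *\<^sub>R Yos n) \<bullet>\<^sub>o x"

lemma E_isometry: "norm (E n t x) = norm x"
  by (rule norm_exp_skew[OF Yos_skew])

text \<open>The approximants commute, so the difference of the two exponentials is the isometry
  exp(t Yos m) applied to exp(t D) x - x, where D = Yos n - Yos m is skew again.\<close>

lemma E_dist: "norm (E n t x - E m t x) \<le> \<bar>t\<bar> * norm (Yos n \<bullet>\<^sub>o x - Yos m \<bullet>\<^sub>o x)"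
proof -
  let ?D = "Yos n - Yos m"
  have "exp (t *\<^sub>R Yos n) = exp (t *\<^sub>R Yos m + t *\<^sub>R ?D)" by (simp add: algebra_simps)
  also have "\<dots> = exp (t *\<^sub>R Yos m) * exp (t *\<^sub>R ?D)"
    by (rule exp_add_commuting) (simp add: algebra_simps Yos_commute)
  finally have "E n t x - E m t x = exp (t *\<^sub>R Yos m) \<bullet>\<^sub>o (exp (t *\<^sub>R ?D) \<bullet>\<^sub>o x - x)"
    by (simp add: blop.diff_right)
  then have "norm (E n t x - E m t x) = norm (exp (t *\<^sub>R ?D) \<bullet>\<^sub>o x - x)" by (simp add: E_isometry)
  also have "\<dots> \<le> \<bar>t\<bar> * norm (?D \<bullet>\<^sub>o x)"
    by (rule norm_exp_skew_diff_le) (simp add: blop.diff_left inner_diff Yos_skew)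
  finally show ?thesis by (simp add: blop.diff_left)
qed

definition group :: "real \<Rightarrow> 'a \<Rightarrow> 'a" where
  "group t x = lim (\<lambda>n. E n t x)"

lemma E_tendsto: "(\<lambda>n. E n t x) \<longlonglongrightarrow> group t x"
proof -
  \<comment> \<open>The Cauchy property is expressed as convergence to 0 along the product filter,
    so that \<open>closed_tendsto_zero\<close> applies; 2 is a Lipschitz constant for a difference
    of two linear isometries.\<close>
  have "x \<in> {x. ((\<lambda>(n, m). E n t x - E m t x) \<longlongrightarrow> 0) (sequentially \<times>\<^sub>F sequentially)}"
    unfolding case_prod_beta
  proof (rule closed_dense[OF closed_tendsto_zero[where K = 2]])
    fix i :: "nat \<times> nat" and x y
    show "norm (E (fst i) t x - E (snd i) t x - (E (fst i) t y - E (snd i) t y)) \<le> 2 * norm (x - y)"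
      using norm_triangle_ineq4[of "E (fst i) t (x - y)" "E (snd i) t (x - y)"]
      unfolding E_isometry by (simp add: blop.diff_right algebra_simps)
  next
    fix x x' assume x: "B x x'"
    have "filterlim fst sequentially (sequentially \<times>\<^sub>F (sequentially::nat filter))"
      "filterlim snd sequentially ((sequentially::nat filter) \<times>\<^sub>F sequentially)"
      by (rule filterlim_fst filterlim_snd)+
    note this[THEN filterlim_compose[OF Yos_tendsto[OF x]]]
    then have "((\<lambda>i. \<bar>t\<bar> * norm (Yos (fst i) \<bullet>\<^sub>o x - Yos (snd i) \<bullet>\<^sub>o x)) \<longlongrightarrow> \<bar>t\<bar> * norm (x' - x'))
        (sequentially \<times>\<^sub>F sequentially)"
      by (intro tendsto_intros)
    then have "((\<lambda>i. E (fst i) t x - E (snd i) t x) \<longlongrightarrow> 0) (sequentially \<times>\<^sub>F sequentially)"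
      by (intro Lim_null_comparison[OF always_eventually[OF allI[OF E_dist]]]) simp
    then show "x \<in> {x. ((\<lambda>i. E (fst i) t x - E (snd i) t x) \<longlongrightarrow> 0) (sequentially \<times>\<^sub>F sequentially)}"
      by simp
  qed
  then have *: "((\<lambda>(n, m). E n t x - E m t x) \<longlongrightarrow> 0) (sequentially \<times>\<^sub>F sequentially)" by simp
  have "Cauchy (\<lambda>n. E n t x)"
  proof (rule metric_CauchyI)
    fix e :: real assume "e > 0"
    with * have "\<forall>\<^sub>F (n, m) in sequentially \<times>\<^sub>F sequentially. norm (E n t x - E m t x) < e"
      by (auto dest!: tendstoD simp: case_prod_unfold)
    then show "\<exists>N. \<forall>m\<ge>N. \<forall>n\<ge>N. dist (E m t x) (E n t x) < e"
      by (auto simp: eventually_prod_sequentially dist_norm)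
  qed
  then show ?thesis
    unfolding group_def by (simp add: Cauchy_convergent convergent_LIMSEQ_iff[symmetric])
qed

lemma group_linear: "linear (group t)"
proof
  fix x y and r :: real
  have "(\<lambda>n. E n t (x + y)) \<longlonglongrightarrow> group t x + group t y"
    unfolding blop.add_right by (intro tendsto_intros E_tendsto)
  then show "group t (x + y) = group t x + group t y" using E_tendsto LIMSEQ_unique by blast
  have "(\<lambda>n. E n t (r *\<^sub>R x)) \<longlonglongrightarrow> r *\<^sub>R group t x"
    unfolding blop.scaleR_right by (intro tendsto_intros E_tendsto)
  then show "group t (r *\<^sub>R x) = r *\<^sub>R group t x" using E_tendsto LIMSEQ_unique by blast
qed

lemma norm_group [simp]: "norm (group t x) = norm x"
  using tendsto_norm[OF E_tendsto[of t x]] LIMSEQ_unique[OF tendsto_const] by (force simp: E_isometry)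

lemma group_0 [simp]: "group 0 x = x"
  using E_tendsto[of 0 x] LIMSEQ_unique[OF tendsto_const] by force

lemma group_add: "group (s + t) x = group s (group t x)"
proof -
  \<comment> \<open>Both factors of E n s (E n t x) depend on n. The splitting freezes the inner one
    at its limit; the error has norm |E n t x - group t x| because E n s is an isometry.\<close>
  have eq: "E n (s + t) x = E n s (group t x) + E n s (E n t x - group t x)" for n
  proof -
    have "exp ((s + t) *\<^sub>R Yos n) = exp (s *\<^sub>R Yos n) * exp (t *\<^sub>R Yos n)"
      unfolding scaleR_left_distrib by (rule exp_add_commuting) simp
    then show ?thesis by (simp add: blop.diff_right)
  qed
  have "(\<lambda>n. norm (E n t x - group t x)) \<longlonglongrightarrow> norm (group t x - group t x)"
    by (intro tendsto_intros E_tendsto)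
  then have "(\<lambda>n. E n s (E n t x - group t x)) \<longlonglongrightarrow> 0"
    by (intro tendsto_norm_zero_cancel[of "\<lambda>n. E n s (E n t x - group t x)"]) (simp add: E_isometry)
  then have "(\<lambda>n. E n (s + t) x) \<longlonglongrightarrow> group s (group t x) + 0"
    unfolding eq by (intro tendsto_intros E_tendsto)
  then show ?thesis using E_tendsto[of "s + t" x] LIMSEQ_unique by fastforce
qed

lemma group_diff_le: "B x x' \<Longrightarrow> norm (group t x - x) \<le> \<bar>t\<bar> * norm x'"
proof -
  assume x: "B x x'"
  show ?thesis
  proof (rule Lim_norm_ubound[OF _ tendsto_diff[OF E_tendsto tendsto_const]])
    have "norm (E n t x - x) \<le> \<bar>t\<bar> * norm x'" for n
      using norm_exp_skew_diff_le[OF Yos_skew, of t n x] norm_Pos[of n x'] Yos_domain[OF x, of n]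
      by (smt (verit) abs_ge_zero mult_left_mono)
    then show "\<forall>\<^sub>F n in sequentially. norm (E n t x - x) \<le> \<bar>t\<bar> * norm x'" by simp
  qed simp
qed

lemma group_continuous: "((\<lambda>t. group t x) \<longlongrightarrow> x) (at 0)"
proof -
  have "x \<in> {x. ((\<lambda>t. group t x - x) \<longlongrightarrow> 0) (at 0)}"
  proof (rule closed_dense[OF closed_tendsto_zero[where K = 2]])
    fix t x y
    show "norm (group t x - x - (group t y - y)) \<le> 2 * norm (x - y)"
      using norm_triangle_ineq4[of "group t (x - y)" "x - y"]
      by (simp add: linear_diff[OF group_linear] algebra_simps del: norm_group)
        (simp flip: linear_diff[OF group_linear])
  next
    fix x x' assume x: "B x x'"
    have "((\<lambda>t. \<bar>t\<bar> * norm x') \<longlongrightarrow> \<bar>0\<bar> * norm x') (at 0)" by (intro tendsto_intros)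
    then show "x \<in> {x. ((\<lambda>t. group t x - x) \<longlongrightarrow> 0) (at 0)}"
      using Lim_null_comparison[OF always_eventually[OF allI[OF group_diff_le[OF x]]]] by simp
  qed
  then show ?thesis by (simp add: LIM_zero_iff)
qed

text \<open>Since x' need not lie in the domain, E n s x' - x' comes with no rate. A domain element
  y near x' has one, and replacing x' by y costs 2 |x' - y|; in the limit over n the error of the
  difference quotient is at most 2 |x' - y| + |h| |y'|.\<close>

lemma group_derivative_0:
  assumes x: "B x x'"
  shows "((\<lambda>h. (1/h) *\<^sub>R (group h x - x)) \<longlongrightarrow> x') (at 0)"
proof -
  have bound: "norm (group h x - x - h *\<^sub>R x') \<le> \<bar>h\<bar> * (2 * norm (x' - y) + \<bar>h\<bar> * norm y')"
    if y: "B y y'" for h y y'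
  proof (rule tendsto_le[OF _ _ tendsto_norm[OF tendsto_diff[OF tendsto_diff[OF E_tendsto tendsto_const] tendsto_const]]])
    have "(\<lambda>n. \<bar>h\<bar> * (norm (Yos n \<bullet>\<^sub>o x - x') + (2 * norm (x' - y) + \<bar>h\<bar> * norm y')))
        \<longlonglongrightarrow> \<bar>h\<bar> * (norm (x' - x') + (2 * norm (x' - y) + \<bar>h\<bar> * norm y'))"
      by (intro tendsto_intros Yos_tendsto x)
    then show "(\<lambda>n. \<bar>h\<bar> * (norm (Yos n \<bullet>\<^sub>o x - x') + (2 * norm (x' - y) + \<bar>h\<bar> * norm y')))
        \<longlonglongrightarrow> \<bar>h\<bar> * (2 * norm (x' - y) + \<bar>h\<bar> * norm y')" by simp
    have "norm (E n h x - x - h *\<^sub>R x') \<le> \<bar>h\<bar> * (norm (Yos n \<bullet>\<^sub>o x - x') + (2 * norm (x' - y) + \<bar>h\<bar> * norm y'))" for n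
    proof (rule norm_exp_skew_diff[OF Yos_skew])
      fix s assume s: "\<bar>s\<bar> \<le> \<bar>h\<bar>"
      have "norm (E n s y - y) \<le> \<bar>s\<bar> * norm (Yos n \<bullet>\<^sub>o y)"
        by (rule norm_exp_skew_diff_le[OF Yos_skew])
      also have "\<dots> \<le> \<bar>h\<bar> * norm y'"
        using s norm_Pos[of n y'] Yos_domain[OF y, of n] by (intro mult_mono) auto
      finally have 1: "norm (E n s y - y) \<le> \<bar>h\<bar> * norm y'" .
      have "E n s (Yos n \<bullet>\<^sub>o x) - x'
          = E n s (Yos n \<bullet>\<^sub>o x - x') + E n s (x' - y) + (E n s y - y) - (x' - y)"
        by (simp add: blop.diff_right)
      also have "norm \<dots> \<le> norm (Yos n \<bullet>\<^sub>o x - x') + norm (x' - y) + \<bar>h\<bar> * norm y' + norm (x' - y)"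
        using 1 norm_triangle_ineq4[of "E n s (Yos n \<bullet>\<^sub>o x - x') + E n s (x' - y) + (E n s y - y)" "x' - y"]
          norm_triangle_ineq[of "E n s (Yos n \<bullet>\<^sub>o x - x') + E n s (x' - y)" "E n s y - y"]
          norm_triangle_ineq[of "E n s (Yos n \<bullet>\<^sub>o x - x')" "E n s (x' - y)"]
        unfolding E_isometry by linarith
      finally show "norm (E n s (Yos n \<bullet>\<^sub>o x) - x') \<le> norm (Yos n \<bullet>\<^sub>o x - x') + (2 * norm (x' - y) + \<bar>h\<bar> * norm y')"
        by simp
    qed
    then show "\<forall>\<^sub>F n in sequentially. norm (E n h x - x - h *\<^sub>R x')
        \<le> \<bar>h\<bar> * (norm (Yos n \<bullet>\<^sub>o x - x') + (2 * norm (x' - y) + \<bar>h\<bar> * norm y'))" by simp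
  qed simp
  have "((\<lambda>h. (1/h) *\<^sub>R (group h x - x) - x') \<longlongrightarrow> 0) (at 0)"
  proof (rule tendstoI)
    fix e :: real assume e: "e > 0"
    have "x' \<in> closure {x. \<exists>x'. B x x'}" by (simp add: dense_domain)
    then obtain y y' where y: "B y y'" "norm (x' - y) < e/4"
      using e by (auto simp: closure_approachable dist_norm norm_minus_commute dest!: spec[of _ "e/4"])
    have "((\<lambda>h. \<bar>h\<bar> * norm y') \<longlongrightarrow> \<bar>0\<bar> * norm y') (at 0)" by (intro tendsto_intros)
    then have "\<forall>\<^sub>F h in at 0. \<bar>h\<bar> * norm y' < e/2"
      by (rule order_tendstoD) (use e in simp)
    moreover have "\<forall>\<^sub>F h in at 0. h \<noteq> (0::real)" by (simp add: eventually_at_filter)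
    ultimately show "\<forall>\<^sub>F h in at 0. dist ((1/h) *\<^sub>R (group h x - x) - x') 0 < e"
    proof eventually_elim
      case (elim h)
      have "(1/h) *\<^sub>R (group h x - x) - x' = (1/h) *\<^sub>R (group h x - x - h *\<^sub>R x')"
        using elim(2) by (simp add: algebra_simps)
      then have "norm ((1/h) *\<^sub>R (group h x - x) - x') = norm (group h x - x - h *\<^sub>R x') / \<bar>h\<bar>"
        by simp
      also have "\<dots> \<le> 2 * norm (x' - y) + \<bar>h\<bar> * norm y'"
        using bound[OF y(1), of h] elim(2) by (simp add: field_simps)
      also have "\<dots> < e" using elim y(2) by simp
      finally show ?case by simp
    qed
  qed
  then show ?thesis by (simp add: LIM_zero_iff)
qed

lemma group_bounded_linear: "bounded_linear (group t)"
  using group_linear by (intro bounded_linear_intro[where K = 1]) (auto simp: linear_add linear_scale)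

lemma group_derivative_shift:
  assumes "((\<lambda>h. (1/h) *\<^sub>R (group h x - x)) \<longlongrightarrow> x') (at 0)"
  shows "((\<lambda>h. (1/h) *\<^sub>R (group h (group t x) - group t x)) \<longlongrightarrow> group t x') (at 0)"
proof -
  from bounded_linear.tendsto[OF group_bounded_linear assms]
  have "((\<lambda>h. (1/h) *\<^sub>R (group t (group h x) - group t x)) \<longlongrightarrow> group t x') (at 0)"
    by (simp add: linear_scale[OF group_linear] linear_diff[OF group_linear])
  then show ?thesis by (simp add: group_add[symmetric] add.commute)
qed

lemma has_vector_derivative_group:
  assumes "((\<lambda>h. (1/h) *\<^sub>R (group h x - x)) \<longlongrightarrow> x') (at 0)"
  shows "((\<lambda>s. group s x) has_vector_derivative group t x') (at t)"
proof -
  have "((\<lambda>h. norm ((1/h) *\<^sub>R (group (t + h) x - group t x) - group t x')) \<longlongrightarrow> 0) (at 0)"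
    using tendsto_norm_zero[OF LIM_zero[OF group_derivative_shift[OF assms, of t]]]
    by (simp add: group_add[symmetric] add.commute)
  then have "((\<lambda>h. norm (group (t + h) x - group t x - h *\<^sub>R group t x') / norm h) \<longlongrightarrow> 0) (at 0)"
  proof (rule Lim_transform_eventually)
    have "\<forall>\<^sub>F h in at 0. h \<noteq> (0::real)" by (simp add: eventually_at_filter)
    then show "\<forall>\<^sub>F h in at 0. norm ((1/h) *\<^sub>R (group (t + h) x - group t x) - group t x')
        = norm (group (t + h) x - group t x - h *\<^sub>R group t x') / norm h"
    proof eventually_elim
      case (elim h)
      then have "(1/h) *\<^sub>R (group (t + h) x - group t x) - group t x'
          = (1/h) *\<^sub>R (group (t + h) x - group t x - h *\<^sub>R group t x')"
        by (simp add: algebra_simps)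
      then show ?case by simp
    qed
  qed
  then show ?thesis
    unfolding has_vector_derivative_def has_derivative_at by (simp add: bounded_linear_scaleR_left)
qed

text \<open>The generator extends B by \<open>group_derivative_0\<close>. It is no larger, because 1
  - B is already onto, so an additional domain element would produce a nonzero vector fixed by the
  generator. The equivalence in \<open>exp_minus_i\<close> asks for both directions.\<close>

theorem generator_iff: "((\<lambda>h. (1/h) *\<^sub>R (group h x - x)) \<longlongrightarrow> x') (at 0) \<longleftrightarrow> B x x'"
proof
  assume x: "((\<lambda>h. (1/h) *\<^sub>R (group h x - x)) \<longlongrightarrow> x') (at 0)"
  obtain z z' where z: "B z z'" "1 *\<^sub>R z - z' = x - x'" using onto[of 1 "x - x'"] by auto
  define w where "w = x - z"
  have w: "((\<lambda>h. (1/h) *\<^sub>R (group h w - w)) \<longlongrightarrow> w) (at 0)"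
  proof -
    have "x' - z' = w" using z(2) by (simp add: w_def algebra_simps)
    moreover have "(1/h) *\<^sub>R (group h x - x) - (1/h) *\<^sub>R (group h z - z) = (1/h) *\<^sub>R (group h w - w)" for h
      by (simp add: w_def linear_diff[OF group_linear] flip: scaleR_diff_right)
    ultimately show ?thesis using tendsto_diff[OF x group_derivative_0[OF z(1)]] by simp
  qed
  text \<open>An eigenvector of the generator with eigenvalue 1 contradicts norm conservation.\<close>
  have "((\<lambda>t. inner (group t w) (group t w)) has_vector_derivative
      inner (group 0 w) (group 0 w) + inner (group 0 w) (group 0 w)) (at 0)"
    by (rule bounded_bilinear.has_vector_derivative[OF bounded_bilinear_inner
          has_vector_derivative_group[OF w] has_vector_derivative_group[OF w]])
  then have "((\<lambda>t. inner w w) has_vector_derivative 2 * inner w w) (at (0::real))"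
    by (simp flip: power2_norm_eq_inner)
  then have "2 * inner w w = 0"
    using vector_derivative_unique_at[OF _ has_vector_derivative_const] by blast
  then have "w = 0" by simp
  then show "B x x'" using z by (auto simp: w_def)
qed (rule group_derivative_0)

lemma group_invariant: "B x x' \<Longrightarrow> B (group t x) (group t x')"
  using group_derivative_shift generator_iff by blast

lemma group_has_vector_derivative: "B x x' \<Longrightarrow> ((\<lambda>s. group s x) has_vector_derivative group t x') (at t)"
  using has_vector_derivative_group generator_iff by blast

text \<open>For x in the domain the commutator V s x solves the same evolution equation with V 0 x =
  0, so it vanishes by conservation of the norm; density extends this to all x. With J the
  multiplication by i it makes the group complex linear.\<close>

lemma group_commute:
  assumes J: "bounded_linear J" and BJ: "\<And>x x'. B x x' \<Longrightarrow> B (J x) (J x')"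
  shows "group t (J x) = J (group t x)"
proof -
  define V where "V s x = group s (J x) - J (group s x)" for s x
  have dom: "V t x = 0" if x: "B x x'" for x x'
  proof -
    have d: "((\<lambda>s. V s x) has_vector_derivative V s x') (at s)" for s
    proof -
      have 1: "((\<lambda>s. group s (J x)) has_vector_derivative group s (J x')) (at s)"
        using group_has_vector_derivative[OF BJ[OF x]] .
      have 2: "((\<lambda>s. J (group s x)) has_vector_derivative J (group s x')) (at s)"
        using bounded_linear.has_vector_derivative[OF J group_has_vector_derivative[OF x]] .
      show ?thesis unfolding V_def by (rule has_vector_derivative_diff[OF 1 2])
    qed
    have "B (V s x) (V s x')" for s
      unfolding V_def by (rule diff[OF group_invariant[OF BJ[OF x]] BJ[OF group_invariant[OF x]]])
    then have "inner (V s x) (V s x') = 0" for s by (rule skew)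
    from isometry_of_skew_derivative[of "\<lambda>s. V s x" "\<lambda>s. V s x'", OF d this, of t]
    show "V t x = 0" by (simp add: V_def)
  qed
  have "bounded_linear (V t)"
    unfolding V_def
    by (rule bounded_linear_sub[OF bounded_linear_compose[OF group_bounded_linear J]
          bounded_linear_compose[OF J group_bounded_linear]])
  then have "continuous_on UNIV (V t)" by (rule linear_continuous_on)
  then have "closed {x. V t x = 0}" by (rule closed_Collect_eq[OF _ continuous_on_const])
  then have "x \<in> {x. V t x = 0}" by (rule closed_dense) (simp add: dom)
  then show ?thesis by (simp add: V_def)
qed

end

text \<open>With \<open>J\<close> in the role of multiplication by \<open>\<i>\<close>, the operator below is \<open>-JA\<close>.\<close>

lemma skew_adjoint_of_adjoint:
  fixes J :: "'a::{real_inner, banach, perfect_space} \<Rightarrow> 'a"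
  assumes J: "linear J" "\<And>x. J (J x) = - x" "\<And>x y. inner (J x) (J y) = inner x y"
    and A: "\<And>f g. A f g \<longleftrightarrow> (\<forall>h k. T h k \<longrightarrow> inner f k = inner g h)"
    and TA: "\<And>h k. T h k \<Longrightarrow> A h k" and TJ: "\<And>h k. T h k \<Longrightarrow> T (J h) (J k)"
    and sym: "\<And>f g f' g'. A f g \<Longrightarrow> A f' g' \<Longrightarrow> inner f g' = inner g f'"
    and single: "\<And>y. A 0 y \<Longrightarrow> y = 0"
  shows "skew_adjoint (\<lambda>x y. A x (J y))"
proof -
  have J': "J (x + y) = J x + J y" "J (x - y) = J x - J y" "J (- x) = - J x" "J (r *\<^sub>R x) = r *\<^sub>R J x" for x y r
    using J(1) by (simp_all add: linear_add linear_diff linear_neg linear_scale)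
  have J_adj: "inner (J x) y = - inner x (J y)" for x y
    using J(3)[of x "J y"] J(2)[of y] by (simp add: J')
  have norm_J: "norm (J x) = norm x" for x by (simp add: norm_eq_sqrt_inner J(3))
  have bl: "bounded_linear J"
    by (rule bounded_linear_intro[where K = 1]) (auto simp: J' norm_J)
  have add: "A (x + y) (x' + y')" if "A x x'" "A y y'" for x y x' y'
    using that unfolding A by (auto simp: inner_add)
  have scale: "A (r *\<^sub>R x) (r *\<^sub>R x')" if "A x x'" for r x x'
    using that unfolding A by auto
  have AJ: "A (J x) (J x')" if "A x x'" for x x'
    using that TJ unfolding A by (auto simp: J_adj)
  have skew: "inner x x' = 0" if "A x (J x')" for x x'
    using sym[OF that AJ[OF that]] by (simp add: J(2,3) inner_commute)
  \<comment> \<open>Pythagoras for the orthogonal vectors c x and x'. The estimate makes the range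
    of c - B closed.\<close>
  have bound: "\<bar>c\<bar> * norm x \<le> norm (c *\<^sub>R x - x')" if "A x (J x')" for c x x'
  proof -
    have "(norm (c *\<^sub>R x - x'))\<^sup>2 = \<bar>c\<bar>\<^sup>2 * (norm x)\<^sup>2 + (norm x')\<^sup>2"
      using skew[OF that] by (simp add: norm_diff_sq power_mult_distrib)
    then have "(\<bar>c\<bar> * norm x)\<^sup>2 \<le> (norm (c *\<^sub>R x - x'))\<^sup>2" by (simp add: power_mult_distrib)
    then show ?thesis by (rule power2_le_imp_le) simp
  qed
  show ?thesis
  proof
    fix x x' y y' :: 'a and r c :: real
    show "A (x + y) (J (x' + y'))" if "A x (J x')" "A y (J y')"
      using add[OF that] by (simp add: J')
    show "A (r *\<^sub>R x) (J (r *\<^sub>R x'))" if "A x (J x')" using scale[OF that] by (simp add: J')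
    show "y = 0" if "A 0 (J y)" using single[OF that] J(2)[of y] linear_0[OF J(1)] by simp
    show "inner x x' = 0" if "A x (J x')" using that by (rule skew)
    assume c: "c \<noteq> 0"
    define S where "S = {c *\<^sub>R x - x' | x x'. A x (J x')}"
    have "S = UNIV"
    proof (rule subspace_orthogonal_eq_UNIV)
      show "subspace S"
      proof (rule subspaceI)
        have "A 0 (J 0)" unfolding A using J'(4)[of 0 0] by auto
        then show "0 \<in> S" unfolding S_def by (force intro!: exI[of _ 0])
      next
        fix u v assume "u \<in> S" "v \<in> S"
        then obtain x x' y y' where "u = c *\<^sub>R x - x'" "A x (J x')" "v = c *\<^sub>R y - y'" "A y (J y')"
          by (auto simp: S_def)
        then have "u + v = c *\<^sub>R (x + y) - (x' + y')" "A (x + y) (J (x' + y'))"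
          using add[of x "J x'" y "J y'"] by (auto simp: J' algebra_simps)
        then show "u + v \<in> S" unfolding S_def by blast
      next
        fix r u assume "u \<in> S"
        then obtain x x' where "u = c *\<^sub>R x - x'" "A x (J x')" by (auto simp: S_def)
        then have "r *\<^sub>R u = c *\<^sub>R (r *\<^sub>R x) - r *\<^sub>R x'" "A (r *\<^sub>R x) (J (r *\<^sub>R x'))"
          using scale[of x "J x'" r] by (auto simp: J' scaleR_diff_right)
        then show "r *\<^sub>R u \<in> S" unfolding S_def by blast
      qed
      show "closed S"
        unfolding closed_sequential_limits
      proof safe
        fix w l assume "\<forall>n. w n \<in> S" and l: "w \<longlonglongrightarrow> l"
        then have "\<forall>n. \<exists>x x'. w n = c *\<^sub>R x - x' \<and> A x (J x')" by (auto simp: S_def)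
        then obtain x x' where x: "\<And>n. w n = c *\<^sub>R x n - x' n" "\<And>n. A (x n) (J (x' n))" by metis
        have Ad: "A (x m - x n) (J (x' m - x' n))" for m n
          using add[OF x(2)[of m] scale[OF x(2)[of n], of "- 1"]] by (simp add: J')
        have est: "\<bar>c\<bar> * norm (x m - x n) \<le> norm (w m - w n)" for m n
          using bound[OF Ad, of c m n] by (simp add: x(1) algebra_simps)
        have "Cauchy x"
        proof (rule metric_CauchyI)
          fix e :: real assume "e > 0"
          then have "\<bar>c\<bar> * e > 0" using c by simp
          moreover have "Cauchy w" using l LIMSEQ_imp_Cauchy by blast
          ultimately obtain N where N: "\<And>m n. m \<ge> N \<Longrightarrow> n \<ge> N \<Longrightarrow> dist (w m) (w n) < \<bar>c\<bar> * e"
            by (metis metric_CauchyD)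
          have "dist (x m) (x n) < e" if "m \<ge> N" "n \<ge> N" for m n
          proof -
            have "\<bar>c\<bar> * norm (x m - x n) < \<bar>c\<bar> * e"
              using est[of m n] N[OF that] by (simp add: dist_norm)
            then show ?thesis using c by (simp add: dist_norm)
          qed
          then show "\<exists>N. \<forall>m\<ge>N. \<forall>n\<ge>N. dist (x m) (x n) < e" by blast
        qed
        then obtain xl where xl: "x \<longlonglongrightarrow> xl" using Cauchy_convergent_iff convergent_def by blast
        have "(\<lambda>n. c *\<^sub>R x n - w n) \<longlonglongrightarrow> c *\<^sub>R xl - l" by (intro tendsto_intros xl l)
        then have x'l: "x' \<longlonglongrightarrow> c *\<^sub>R xl - l" by (simp add: x(1))
        \<comment> \<open>An adjoint is defined by equations that survive limits, so its graph is
          closed.\<close>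
        have "A xl (J (c *\<^sub>R xl - l))"
          unfolding A
        proof (intro allI impI)
          fix h k assume hk: "T h k"
          have "(\<lambda>n. inner (x n) k) \<longlonglongrightarrow> inner xl k" by (intro tendsto_intros xl)
          moreover have "(\<lambda>n. inner (J (x' n)) h) \<longlonglongrightarrow> inner (J (c *\<^sub>R xl - l)) h"
            by (intro tendsto_intros bounded_linear.tendsto[OF bl] x'l)
          moreover have "inner (x n) k = inner (J (x' n)) h" for n using x(2)[of n] hk unfolding A by blast
          ultimately show "inner xl k = inner (J (c *\<^sub>R xl - l)) h" using LIMSEQ_unique by auto
        qed
        then show "l \<in> S" unfolding S_def
          by (intro CollectI exI[of _ xl] exI[of _ "c *\<^sub>R xl - l"]) simp
      qed
      fix y assume y: "\<And>s. s \<in> S \<Longrightarrow> inner y s = 0"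
      \<comment> \<open>Orthogonality tested against the core alone already places J y in the domain
        of the adjoint, as an eigenvector of the skew operator for the real eigenvalue -c; skewness
        leaves only y = 0.\<close>
      have "A (J y) (J (- c *\<^sub>R J y))"
        unfolding A
      proof (intro allI impI)
        fix h k assume hk: "T h k"
        have "A h (J (- J k))" using TA[OF hk] by (simp add: J' J(2))
        then have "c *\<^sub>R h - (- J k) \<in> S" unfolding S_def by blast
        then have "inner y (c *\<^sub>R h - (- J k)) = 0" by (rule y)
        then show "inner (J y) k = inner (J (- c *\<^sub>R J y)) h"
          by (simp add: J' J(2) J_adj inner_add)
      qed
      from skew[OF this] have "inner (J y) (J y) = 0" using c by simp
      then show "y = 0" by (simp add: J(3))
    qed
    then have "y \<in> S" by simp
    then show "\<exists>x x'. A x (J x') \<and> c *\<^sub>R x - x' = y" unfolding S_def by blast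
  qed
qed

subsection \<open>The Hilbert space of square-integrable functions\<close>

lemma L2_measurable [measurable_dest]: "f \<in> L2 \<Longrightarrow> f \<in> borel_measurable lebesgue"
  and L2_sq_integrable: "f \<in> L2 \<Longrightarrow> integrable lebesgue (\<lambda>x. (cmod (f x))\<^sup>2)"
  by (auto simp: L2_def)

lemma L2_bound:
  assumes "f \<in> borel_measurable lebesgue" "integrable lebesgue g" "\<And>x. (cmod (f x))\<^sup>2 \<le> g x"
  shows "f \<in> L2"
  unfolding L2_def
proof safe
  show "integrable lebesgue (\<lambda>x. (cmod (f x))\<^sup>2)"
    using assms(1,3) by (intro Bochner_Integration.integrable_bound[OF assms(2)])
      (auto intro: order_trans[OF _ abs_ge_self])
qed fact

lemma L2_mult_integrable:
  assumes [measurable_dest]: "f \<in> L2" "g \<in> L2"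
  shows "integrable lebesgue (\<lambda>x. f x * g x)"
proof (rule Bochner_Integration.integrable_bound)
  show "integrable lebesgue (\<lambda>x. (cmod (f x))\<^sup>2 + (cmod (g x))\<^sup>2)"
    using assms by (simp add: L2_sq_integrable)
  have "cmod (f x * g x) \<le> (cmod (f x))\<^sup>2 + (cmod (g x))\<^sup>2" for x
  proof -
    have "0 \<le> cmod (f x) * cmod (g x)" by (intro mult_nonneg_nonneg norm_ge_zero)
    then show ?thesis
      using sum_squares_bound[of "cmod (f x)" "cmod (g x)"] unfolding norm_mult by linarith
  qed
  then show "AE x in lebesgue. norm (f x * g x) \<le> norm ((cmod (f x))\<^sup>2 + (cmod (g x))\<^sup>2)" by simp
  show "(\<lambda>x. f x * g x) \<in> borel_measurable lebesgue"
    using assms[THEN L2_measurable] by measurable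
qed

lemma cnj_measurable [measurable]: "f \<in> borel_measurable M \<Longrightarrow> (\<lambda>x. cnj (f x)) \<in> borel_measurable M"
  by (rule borel_measurable_continuous_on[where f = cnj]) (auto intro: continuous_intros)

lemma L2_cnj: "f \<in> L2 \<Longrightarrow> (\<lambda>x. cnj (f x)) \<in> L2"
  unfolding L2_def by (simp add: cnj_measurable)

lemma L2_add: "f \<in> L2 \<Longrightarrow> g \<in> L2 \<Longrightarrow> (\<lambda>x. f x + g x) \<in> L2"
proof (rule L2_bound[where g = "\<lambda>x. 2 * (cmod (f x))\<^sup>2 + 2 * (cmod (g x))\<^sup>2"])
  assume fg: "f \<in> L2" "g \<in> L2"
  show "(\<lambda>x. f x + g x) \<in> borel_measurable lebesgue"
    using fg[THEN L2_measurable] by measurable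
  show "integrable lebesgue (\<lambda>x. 2 * (cmod (f x))\<^sup>2 + 2 * (cmod (g x))\<^sup>2)"
    by (intro Bochner_Integration.integrable_add integrable_mult_right L2_sq_integrable fg)
  fix x
  have "(cmod (f x + g x))\<^sup>2 \<le> (cmod (f x) + cmod (g x))\<^sup>2" by (intro power_mono norm_triangle_ineq) simp
  also have "\<dots> \<le> 2 * (cmod (f x))\<^sup>2 + 2 * (cmod (g x))\<^sup>2"
    using sum_squares_bound[of "cmod (f x)" "cmod (g x)"] by (simp add: power2_sum)
  finally show "(cmod (f x + g x))\<^sup>2 \<le> 2 * (cmod (f x))\<^sup>2 + 2 * (cmod (g x))\<^sup>2" .
qed

lemma L2_bounded_mult:
  assumes f: "f \<in> L2" and w: "w \<in> borel_measurable lebesgue" "\<And>x. cmod (w x) \<le> M"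
  shows "(\<lambda>x. w x * f x) \<in> L2"
proof (rule L2_bound[where g = "\<lambda>x. M\<^sup>2 * (cmod (f x))\<^sup>2"])
  show "(\<lambda>x. w x * f x) \<in> borel_measurable lebesgue"
    using L2_measurable[OF f] w(1) by measurable
  show "(cmod (w x * f x))\<^sup>2 \<le> M\<^sup>2 * (cmod (f x))\<^sup>2" for x
    by (simp add: norm_mult power_mult_distrib mult_right_mono power_mono w)
qed (use f in \<open>simp add: L2_sq_integrable\<close>)

lemma L2_cmult: "f \<in> L2 \<Longrightarrow> (\<lambda>x. c * f x) \<in> L2"
  by (rule L2_bounded_mult[where w = "\<lambda>x. c" and M = "cmod c"]) auto

lemma L2_scaleR: "f \<in> L2 \<Longrightarrow> (\<lambda>x. r *\<^sub>R f x) \<in> L2"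
  using L2_cmult[of f "of_real r"] by (simp add: scaleR_conv_of_real)

lemma L2_minus: "f \<in> L2 \<Longrightarrow> (\<lambda>x. - f x) \<in> L2"
  using L2_cmult[of f "- 1"] by simp

lemma L2_diff: "f \<in> L2 \<Longrightarrow> g \<in> L2 \<Longrightarrow> (\<lambda>x. f x - g x) \<in> L2"
  using L2_add[OF _ L2_minus, of f g] by simp

lemma L2_zero: "(\<lambda>x. 0) \<in> L2"
  by (simp add: L2_def)

section \<open>Classes of square-integrable functions modulo null sets\<close>

lemma ae_eq_refl [simp]: "ae_eq f f" by (simp add: ae_eq_def)

lemma ae_eq_sym: "ae_eq f g \<Longrightarrow> ae_eq g f" by (auto simp: ae_eq_def elim: eventually_mono)

lemma ae_eq_trans: "ae_eq f g \<Longrightarrow> ae_eq g h \<Longrightarrow> ae_eq f h"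
  unfolding ae_eq_def by (auto elim: eventually_elim2)

quotient_type l2 = "real \<Rightarrow> complex" / partial: "\<lambda>f g. f \<in> L2 \<and> g \<in> L2 \<and> ae_eq f g"
  morphisms rep_l2 l2_class
proof (rule part_equivpI)
  show "\<exists>f. f \<in> L2 \<and> f \<in> L2 \<and> ae_eq f f" using L2_zero by auto
  show "symp (\<lambda>f g. f \<in> L2 \<and> g \<in> L2 \<and> ae_eq f g)" by (auto intro!: sympI ae_eq_sym)
  show "transp (\<lambda>f g. f \<in> L2 \<and> g \<in> L2 \<and> ae_eq f g)" by (auto intro!: transpI intro: ae_eq_trans)
qed

definition l2_rep :: "l2 \<Rightarrow> real \<Rightarrow> complex" where "l2_rep = rep_l2"

lemma l2_rep_L2 [simp]: "l2_rep u \<in> L2"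
  and l2_class_rep [simp]: "l2_class (l2_rep u) = u"
  using Quotient3_rep_reflp[OF Quotient3_l2, of u] Quotient3_abs_rep[OF Quotient3_l2, of u]
  by (auto simp: l2_rep_def)

lemma l2_class_eq_iff: "f \<in> L2 \<Longrightarrow> g \<in> L2 \<Longrightarrow> l2_class f = l2_class g \<longleftrightarrow> ae_eq f g"
  using Quotient3_rel[OF Quotient3_l2, of f g] by simp

lemma l2_rep_class: "f \<in> L2 \<Longrightarrow> ae_eq (l2_rep (l2_class f)) f"
  using l2_class_eq_iff[of "l2_rep (l2_class f)" f] by simp

lemma l2_cases: obtains f where "f \<in> L2" "u = l2_class f"
  using l2_class_rep[of u] l2_rep_L2[of u] by metis

text \<open>Taking the real part turns the complex Hilbert space into a real one, as the class
  \<open>real_inner\<close> asks. The complex structure is restored later by the isometry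
  \<open>l2_i\<close>.\<close>

definition l2_ip :: "l2 \<Rightarrow> l2 \<Rightarrow> real" where
  "l2_ip u v = Re (LINT x|lebesgue. l2_rep u x * cnj (l2_rep v x))"

instantiation l2 :: real_inner
begin

definition zero_l2 :: l2 where "0 = l2_class (\<lambda>x. 0)"
definition plus_l2 :: "l2 \<Rightarrow> l2 \<Rightarrow> l2" where "u + v = l2_class (\<lambda>x. l2_rep u x + l2_rep v x)"
definition uminus_l2 :: "l2 \<Rightarrow> l2" where "- u = l2_class (\<lambda>x. - l2_rep u x)"
definition minus_l2 :: "l2 \<Rightarrow> l2 \<Rightarrow> l2" where "u - v = l2_class (\<lambda>x. l2_rep u x - l2_rep v x)"
definition scaleR_l2 :: "real \<Rightarrow> l2 \<Rightarrow> l2" where "r *\<^sub>R u = l2_class (\<lambda>x. r *\<^sub>R l2_rep u x)"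
definition inner_l2 :: "l2 \<Rightarrow> l2 \<Rightarrow> real" where "inner = l2_ip"
definition norm_l2 :: "l2 \<Rightarrow> real" where "norm u = sqrt (l2_ip u u)"
definition dist_l2 :: "l2 \<Rightarrow> l2 \<Rightarrow> real" where "dist u v = sqrt (l2_ip (u - v) (u - v))"
definition sgn_l2 :: "l2 \<Rightarrow> l2" where "sgn u = inverse (sqrt (l2_ip u u)) *\<^sub>R u"
definition uniformity_l2 :: "(l2 \<times> l2) filter" where
  "uniformity_l2 = (INF e\<in>{0<..}. principal {(x, y). sqrt (l2_ip (x - y) (x - y)) < e})"
definition open_l2 :: "l2 set \<Rightarrow> bool" where
  "open_l2 U = (\<forall>x\<in>U. \<forall>\<^sub>F (x', y) in uniformity. x' = x \<longrightarrow> y \<in> U)"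

lemma l2_class_add: "f \<in> L2 \<Longrightarrow> g \<in> L2 \<Longrightarrow> l2_class f + l2_class g = l2_class (\<lambda>x. f x + g x)"
  unfolding plus_l2_def using l2_rep_class[of f] l2_rep_class[of g]
  by (subst l2_class_eq_iff) (auto simp: L2_add ae_eq_def elim: eventually_elim2)

lemma l2_class_diff: "f \<in> L2 \<Longrightarrow> g \<in> L2 \<Longrightarrow> l2_class f - l2_class g = l2_class (\<lambda>x. f x - g x)"
  unfolding minus_l2_def using l2_rep_class[of f] l2_rep_class[of g]
  by (subst l2_class_eq_iff) (auto simp: L2_diff ae_eq_def elim: eventually_elim2)

lemma l2_class_uminus: "f \<in> L2 \<Longrightarrow> - l2_class f = l2_class (\<lambda>x. - f x)"
  unfolding uminus_l2_def using l2_rep_class[of f]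
  by (subst l2_class_eq_iff) (auto simp: L2_minus ae_eq_def)

lemma l2_class_scaleR: "f \<in> L2 \<Longrightarrow> r *\<^sub>R l2_class f = l2_class (\<lambda>x. r *\<^sub>R f x)"
  unfolding scaleR_l2_def using l2_rep_class[of f]
  by (subst l2_class_eq_iff) (auto simp: L2_scaleR ae_eq_def elim: eventually_mono)

lemma inner_l2_class:
  assumes "f \<in> L2" "g \<in> L2"
  shows "inner (l2_class f) (l2_class g) = Re (LINT x|lebesgue. f x * cnj (g x))"
proof -
  have "(LINT x|lebesgue. l2_rep (l2_class f) x * cnj (l2_rep (l2_class g) x)) = (LINT x|lebesgue. f x * cnj (g x))"
    using l2_rep_class[OF assms(1)] l2_rep_class[OF assms(2)] assms[THEN L2_measurable]
      l2_rep_L2[THEN L2_measurable]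
    by (intro integral_cong_AE) (auto simp: ae_eq_def elim: eventually_elim2)
  then show ?thesis by (simp add: inner_l2_def l2_ip_def)
qed

lemma inner_l2_class_self:
  assumes "f \<in> L2"
  shows "inner (l2_class f) (l2_class f) = (LINT x|lebesgue. (cmod (f x))\<^sup>2)"
proof -
  have "(LINT x|lebesgue. f x * cnj (f x)) = (LINT x|lebesgue. complex_of_real ((cmod (f x))\<^sup>2))"
    by (simp add: complex_norm_square del: of_real_power)
  then show ?thesis using assms by (simp add: inner_l2_class L2_sq_integrable del: of_real_power)
qed

instance
proof
  fix a b c :: l2 and r s :: real
  obtain f where f: "f \<in> L2" "a = l2_class f" by (rule l2_cases)
  obtain g where g: "g \<in> L2" "b = l2_class g" by (rule l2_cases)
  obtain h where h: "h \<in> L2" "c = l2_class h" by (rule l2_cases)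
  note [simp] = f g h L2_add L2_diff L2_minus L2_scaleR L2_zero l2_class_add l2_class_diff l2_class_uminus
    l2_class_scaleR zero_l2_def inner_l2_class
  show "a + b + c = a + (b + c)" "a + b = b + a" "0 + a = a" "- a + a = 0" "a - b = a + - b"
    "r *\<^sub>R (a + b) = r *\<^sub>R a + r *\<^sub>R b" "(r + s) *\<^sub>R a = r *\<^sub>R a + s *\<^sub>R a"
    "r *\<^sub>R s *\<^sub>R a = (r * s) *\<^sub>R a" "1 *\<^sub>R a = a"
    by (simp_all add: algebra_simps)
  have int: "integrable lebesgue (\<lambda>x. p x * cnj (q x))" if "p \<in> L2" "q \<in> L2" for p q
    using that by (intro L2_mult_integrable L2_cnj)
  show "inner a b = inner b a"
  proof -
    have "(LINT x|lebesgue. g x * cnj (f x)) = (LINT x|lebesgue. cnj (f x * cnj (g x)))"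
      by (intro Bochner_Integration.integral_cong) (simp_all add: mult.commute)
    also have "\<dots> = cnj (LINT x|lebesgue. f x * cnj (g x))"
      by (rule Bochner_Integration.integral_cnj)
    finally have "Re (LINT x|lebesgue. g x * cnj (f x)) = Re (LINT x|lebesgue. f x * cnj (g x))"
      by simp
    then show ?thesis by simp
  qed
  show "inner (a + b) c = inner a c + inner b c"
    by (simp add: distrib_right int)
  show "inner (r *\<^sub>R a) b = r * inner a b" by simp
  have self: "inner a a = (LINT x|lebesgue. (cmod (f x))\<^sup>2)"
    using inner_l2_class_self[of f] by simp
  show "0 \<le> inner a a" unfolding self by simp
  have "(inner a a = 0) = ae_eq f (\<lambda>x. 0)"
    unfolding self using integral_nonneg_eq_0_iff_AE[OF L2_sq_integrable[OF f(1)]] by (simp add: ae_eq_def)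
  then show "(inner a a = 0) = (a = 0)"
    by (simp add: l2_class_eq_iff)
  show "norm a = sqrt (inner a a)" "dist a b = norm (a - b)" "sgn a = inverse (norm a) *\<^sub>R a"
    unfolding norm_l2_def dist_l2_def sgn_l2_def inner_l2_def by (rule refl)+
  show "(uniformity :: (l2 \<times> l2) filter) = (INF e\<in>{0<..}. principal {(x, y). dist x y < e})"
    unfolding uniformity_l2_def dist_l2_def by (rule refl)
  fix U :: "l2 set"
  show "open U = (\<forall>x\<in>U. \<forall>\<^sub>F (x', y) in uniformity. x' = x \<longrightarrow> y \<in> U)" by (rule open_l2_def)
qed

end

lemma norm_l2_class: "f \<in> L2 \<Longrightarrow> norm (l2_class f) = L2_norm f"
  by (simp add: norm_eq_sqrt_inner L2_norm_def inner_l2_class_self)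

lemma norm_l2_class_sq: "f \<in> L2 \<Longrightarrow> (norm (l2_class f))\<^sup>2 = (LINT x|lebesgue. (cmod (f x))\<^sup>2)"
  by (simp add: power2_norm_eq_inner inner_l2_class_self)

lemma norm_l2_class_nn:
  assumes "f \<in> L2"
  shows "(\<integral>\<^sup>+x. ennreal ((cmod (f x))\<^sup>2) \<partial>lebesgue) = ennreal ((norm (l2_class f))\<^sup>2)"
  using assms by (simp add: norm_l2_class_sq nn_integral_eq_integral L2_sq_integrable)

text \<open>One unit vector suffices, here the indicator of [0,1]; the class is a requirement of the
  operator algebra \<open>blop\<close>.\<close>

instance l2 :: perfect_space
proof
  fix u :: l2
  define e where "e = l2_class (\<lambda>x. indicator {0..1} x)"
  have L: "(\<lambda>x. indicator {0..1} x :: complex) \<in> L2"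
  proof (rule L2_bound[where g = "indicator {0..1}"])
    show "(\<lambda>x. indicator {0..1::real} x :: complex) \<in> borel_measurable lebesgue"
      by (intro borel_measurable_indicator) simp
  qed (auto simp: indicator_def)
  have "norm (e)^2 = (LINT x|lebesgue. (indicator {0..1::real} x :: real))"
    unfolding e_def norm_l2_class_sq[OF L] by (intro Bochner_Integration.integral_cong) (auto simp: indicator_def)
  then have "(norm e)\<^sup>2 = 1" by simp
  then have e: "norm e = 1" using norm_ge_zero[of e] by (simp add: power2_eq_1_iff)
  show "\<not> open {u}"
  proof
    assume "open {u}"
    then obtain d where d: "d > 0" "ball u d \<subseteq> {u}" by (auto simp: open_contains_ball)
    have "u + (d/2) *\<^sub>R e \<in> ball u d" using d(1) e by (simp add: dist_norm)
    then have "(d/2) *\<^sub>R e = 0" using d(2) by auto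
    then show False using d(1) e by auto
  qed
qed

text \<open>Riesz--Fischer: a sufficiently fast converging subsequence converges almost everywhere, and
  Fatou's lemma identifies its pointwise limit as the limit in the mean.\<close>

instance l2 :: banach
proof
  fix X :: "nat \<Rightarrow> l2" assume X: "Cauchy X"
  have "\<exists>N. \<forall>m\<ge>N. \<forall>n\<ge>N. norm (X m - X n) < (1/4)^k" for k
    using metric_CauchyD[OF X, of "(1/4)^k"] by (simp add: dist_norm)
  then obtain M where M: "\<And>k m n. m \<ge> M k \<Longrightarrow> n \<ge> M k \<Longrightarrow> norm (X m - X n) < (1/4)^k" by metis
  \<comment> \<open>Adding up the thresholds makes \<open>r\<close> monotone while keeping r k above
    both M k and k.\<close>
  define r where "r k = (\<Sum>i\<le>k. M i) + k" for k
  have r_M: "r k \<ge> M k" for k unfolding r_def using member_le_sum[of k "{..k}" M] by simp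
  have r_mono: "r k \<le> r (Suc k)" for k by (simp add: r_def)
  have r_ge: "r k \<ge> k" for k by (simp add: r_def)
  define f where "f n = l2_rep (X n)" for n
  have f_meas [measurable]: "f n \<in> borel_measurable lebesgue" for n
    by (simp add: f_def L2_measurable)
  have fL2: "f n \<in> L2" for n by (simp add: f_def)
  have Xf: "X n = l2_class (f n)" for n by (simp add: f_def)
  have nn: "(\<integral>\<^sup>+x. ennreal ((cmod (f m x - f n x))\<^sup>2) \<partial>lebesgue) = ennreal ((norm (X m - X n))\<^sup>2)" for m n
    unfolding Xf l2_class_diff[OF fL2 fL2] by (rule norm_l2_class_nn[OF L2_diff[OF fL2 fL2]])
  \<comment> \<open>The integral of (d k)^2 is at most 16^(-k), which leaves room for a factor 4^k:
    the sum of 4^k (d k x)^2 is finite almost everywhere, and then d k x = O(2^(-k)).\<close>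
  define d where "d k x = cmod (f (r (Suc k)) x - f (r k) x)" for k x
  have [measurable]: "d k \<in> borel_measurable lebesgue" for k unfolding d_def by measurable
  have "(\<integral>\<^sup>+x. (\<Sum>k. ennreal (4^k * (d k x)\<^sup>2)) \<partial>lebesgue) = (\<Sum>k. \<integral>\<^sup>+x. ennreal (4^k * (d k x)\<^sup>2) \<partial>lebesgue)"
    by (rule nn_integral_suminf) measurable
  also have "\<dots> \<le> (\<Sum>k. ennreal ((1/4)^k))"
  proof (rule suminf_le)
    fix k
    have "(\<integral>\<^sup>+x. ennreal (4^k * (d k x)\<^sup>2) \<partial>lebesgue) = ennreal (4^k) * ennreal ((norm (X (r (Suc k)) - X (r k)))\<^sup>2)"
      unfolding nn[symmetric] d_def by (subst nn_integral_cmult[symmetric]) (auto simp: ennreal_mult')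
    also have "\<dots> \<le> ennreal (4^k) * ennreal (((1/4)^k)\<^sup>2)"
    proof (intro mult_left_mono ennreal_leI power_mono)
      show "norm (X (r (Suc k)) - X (r k)) \<le> (1/4)^k"
        using M[of k "r (Suc k)" "r k"] r_M[of k] r_mono[of k] by simp
    qed auto
    also have "\<dots> = ennreal ((1/4)^k)"
      by (simp add: ennreal_mult'[symmetric] power2_eq_square power_mult_distrib[symmetric] flip: power_mult_distrib)
    finally show "(\<integral>\<^sup>+x. ennreal (4^k * (d k x)\<^sup>2) \<partial>lebesgue) \<le> ennreal ((1/4)^k)" .
  qed auto
  also have "\<dots> = ennreal (\<Sum>k. (1/4)^k)" by (rule suminf_ennreal2) (auto intro: summable_geometric)
  finally have "(\<integral>\<^sup>+x. (\<Sum>k. ennreal (4^k * (d k x)\<^sup>2)) \<partial>lebesgue) \<noteq> \<infinity>"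
    by (metis ennreal_neq_top infinity_ennreal_def top.extremum_uniqueI)
  then have "AE x in lebesgue. (\<Sum>k. ennreal (4^k * (d k x)\<^sup>2)) \<noteq> \<infinity>"
    by (intro nn_integral_noteq_infinite) auto
  then have conv: "AE x in lebesgue. convergent (\<lambda>k. f (r k) x)"
  proof eventually_elim
    case (elim x)
    then have "summable (\<lambda>k. 4^k * (d k x)\<^sup>2)" by (intro summable_suminf_not_top) auto
    then have "bounded (range (\<lambda>k. 4^k * (d k x)\<^sup>2))"
      by (intro convergent_imp_bounded) (use summable_LIMSEQ_zero in blast)
    then obtain C where C: "\<And>k. \<bar>4^k * (d k x)\<^sup>2\<bar> \<le> C" by (auto simp: bounded_iff)
    have "d k x \<le> sqrt C * (1/2)^k" for k
    proof -
      have "(2^k * d k x)\<^sup>2 \<le> C"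
        using C[of k] by (simp add: power_mult_distrib power_mult[symmetric] mult.commute[of k 2] power_mult[of 2 2])
      then have "2^k * d k x \<le> sqrt C" by (rule real_le_rsqrt)
      then show ?thesis by (simp add: field_simps power_divide)
    qed
    moreover have "summable (\<lambda>k. sqrt C * (1/2)^k)" by (intro summable_mult summable_geometric) simp
    ultimately have "summable (\<lambda>k. f (r (Suc k)) x - f (r k) x)"
      unfolding d_def by (rule summable_comparison_test'[where N = 0, rotated])
    then have "convergent (\<lambda>n. \<Sum>k<n. f (r (Suc k)) x - f (r k) x)" by (simp add: summable_iff_convergent)
    then have "convergent (\<lambda>n. (f (r n) x - f (r 0) x) + f (r 0) x)"
      by (intro convergent_add convergent_const) (simp add: sum_lessThan_telescope[of "\<lambda>k. f (r k) x"])
    then show ?case by simp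
  qed
  define F where "F x = lim (\<lambda>k. f (r k) x)" for x
  have [measurable]: "F \<in> borel_measurable lebesgue" unfolding F_def by measurable
  have F: "AE x in lebesgue. (\<lambda>k. f (r k) x) \<longlonglongrightarrow> F x"
    using conv by eventually_elim (simp add: F_def convergent_LIMSEQ_iff)
  have fatou: "(\<integral>\<^sup>+x. ennreal ((cmod (F x - f n x))\<^sup>2) \<partial>lebesgue) \<le> ennreal (e\<^sup>2)"
    if e: "\<And>m. m \<ge> N \<Longrightarrow> norm (X m - X n) \<le> e" for e n N
  proof -
    have "(\<integral>\<^sup>+x. ennreal ((cmod (F x - f n x))\<^sup>2) \<partial>lebesgue)
        = (\<integral>\<^sup>+x. liminf (\<lambda>k. ennreal ((cmod (f (r k) x - f n x))\<^sup>2)) \<partial>lebesgue)"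
    proof (rule nn_integral_cong_AE)
      show "AE x in lebesgue. ennreal ((cmod (F x - f n x))\<^sup>2) = liminf (\<lambda>k. ennreal ((cmod (f (r k) x - f n x))\<^sup>2))"
        using F
      proof eventually_elim
        case (elim x)
        have "(\<lambda>k. ennreal ((cmod (f (r k) x - f n x))\<^sup>2)) \<longlonglongrightarrow> ennreal ((cmod (F x - f n x))\<^sup>2)"
          by (intro tendsto_ennrealI tendsto_intros elim)
        then show ?case by (rule lim_imp_Liminf[OF sequentially_bot, symmetric])
      qed
    qed
    also have "\<dots> \<le> liminf (\<lambda>k. \<integral>\<^sup>+x. ennreal ((cmod (f (r k) x - f n x))\<^sup>2) \<partial>lebesgue)"
      by (rule nn_integral_liminf) measurable
    also have "\<dots> \<le> liminf (\<lambda>k. ennreal (e\<^sup>2))"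
    proof (rule Liminf_mono)
      have "(\<integral>\<^sup>+x. ennreal ((cmod (f (r k) x - f n x))\<^sup>2) \<partial>lebesgue) \<le> ennreal (e\<^sup>2)" if "k \<ge> N" for k
        unfolding nn using e[of "r k"] r_ge[of k] that by (intro ennreal_leI power_mono) auto
      then show "\<forall>\<^sub>F k in sequentially. (\<integral>\<^sup>+x. ennreal ((cmod (f (r k) x - f n x))\<^sup>2) \<partial>lebesgue) \<le> ennreal (e\<^sup>2)"
        unfolding eventually_sequentially by blast
    qed
    finally show ?thesis by (simp add: Liminf_const)
  qed
  have dL2: "(\<lambda>x. F x - f n x) \<in> L2" if "\<And>m. m \<ge> N \<Longrightarrow> norm (X m - X n) \<le> e" for e n N
    unfolding L2_def
  proof safe
    show "(\<lambda>x. F x - f n x) \<in> borel_measurable lebesgue" by measurable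
    show "integrable lebesgue (\<lambda>x. (cmod (F x - f n x))\<^sup>2)"
    proof (intro integrableI_bounded)
      have "(\<integral>\<^sup>+x. ennreal ((cmod (F x - f n x))\<^sup>2) \<partial>lebesgue) \<le> ennreal (e\<^sup>2)"
        by (rule fatou) (rule that)
      then show "(\<integral>\<^sup>+x. ennreal (norm ((cmod (F x - f n x))\<^sup>2)) \<partial>lebesgue) < \<infinity>"
        by (simp add: le_less_trans)
    qed measurable
  qed
  have "(\<lambda>x. F x - f (r 0) x) \<in> L2"
    by (rule dL2[where N = "r 0" and e = 1]) (use M[of 0 _ "r 0"] r_M[of 0] in \<open>auto intro: less_imp_le\<close>)
  from L2_add[OF this fL2[of "r 0"]] have FL2: "F \<in> L2" by simp
  have "X \<longlonglongrightarrow> l2_class F"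
  proof (rule metric_LIMSEQ_I)
    fix e :: real assume e: "e > 0"
    then obtain N where N: "\<And>m n. m \<ge> N \<Longrightarrow> n \<ge> N \<Longrightarrow> norm (X m - X n) < e/2"
      using metric_CauchyD[OF X, of "e/2"] by (auto simp: dist_norm)
    have "dist (X n) (l2_class F) < e" if n: "n \<ge> N" for n
    proof -
      have *: "norm (X m - X n) \<le> e/2" if "m \<ge> N" for m using N[OF that n] by simp
      have "ennreal ((norm (l2_class F - X n))\<^sup>2) \<le> ennreal ((e/2)\<^sup>2)"
        unfolding Xf l2_class_diff[OF FL2 fL2] norm_l2_class_nn[OF L2_diff[OF FL2 fL2], symmetric]
        by (rule fatou[OF *])
      then have "(norm (l2_class F - X n))\<^sup>2 \<le> (e/2)\<^sup>2" by (simp add: ennreal_le_iff)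
      then have "norm (l2_class F - X n) \<le> e/2" by (rule power2_le_imp_le) (use e in simp)
      then show ?thesis using e by (simp add: dist_norm norm_minus_commute)
    qed
    then show "\<exists>N. \<forall>n\<ge>N. dist (X n) (l2_class F) < e" by blast
  qed
  then show "convergent X" by (auto simp: convergent_def)
qed

subsection \<open>Locally absolutely continuous functions\<close>

lemma sigma_finite_lebesgue: "sigma_finite_measure (lebesgue :: real measure)"
proof
  show "\<exists>A::real set set. countable A \<and> A \<subseteq> sets lebesgue \<and> \<Union> A = space lebesgue
      \<and> (\<forall>a\<in>A. emeasure lebesgue a \<noteq> \<infinity>)"
  proof (intro exI[of _ "range (\<lambda>n::nat. {- real n..real n})"] conjI)
    have "\<exists>n::nat. x \<in> {- real n..real n}" for x
      using real_arch_simple[of "\<bar>x\<bar>"] by (force simp: abs_le_iff)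
    then show "(\<Union>n::nat. {- real n..real n}) = space lebesgue" by auto
  qed (auto simp: emeasure_lborel_Icc_eq)
qed

interpretation lebesgue_pair: pair_sigma_finite "lebesgue :: real measure" "lebesgue :: real measure"
  by (rule pair_sigma_finite.intro sigma_finite_lebesgue)+

lemma id_measurable_lebesgue [measurable]: "(\<lambda>x::real. x) \<in> borel_measurable lebesgue"
  by (rule measurable_completion) simp

lemma cont_measurable_lebesgue:
  "continuous_on UNIV f \<Longrightarrow> f \<in> borel_measurable (lebesgue :: real measure)"
  by (intro measurable_completion) (simp add: borel_measurable_continuous_onI)

text \<open>The integral of p(x) q(y) over the plane is split along the diagonal, a null set. Fubini
  is applied on the triangle x <= y, and the inner integral over y >= x is rewritten as the total
  minus the integral over y <= x. This is integration by parts without any differentiation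
  theorem.\<close>

lemma integral_triangle:
  fixes p q :: "real \<Rightarrow> complex"
  assumes p: "integrable lebesgue p" and q: "integrable lebesgue q"
  shows "(LINT y|lebesgue. q y * (LINT x|lebesgue. indicator {..y} x * p x))
      + (LINT x|lebesgue. p x * (LINT y|lebesgue. indicator {..x} y * q y))
      = (LINT x|lebesgue. p x) * (LINT y|lebesgue. q y)"
proof -
  have [measurable]: "p \<in> borel_measurable lebesgue" "q \<in> borel_measurable lebesgue"
    using p q by auto
  have iq: "integrable lebesgue (\<lambda>y. indicator A y * q y)" if "A \<in> sets lebesgue" for A
    using integrable_mult_indicator[OF that q] by (simp add: scaleR_conv_of_real of_real_indicator)
  define f where "f x y = (if x \<le> y then p x * q y else 0)" for x y
  have "integrable (lebesgue \<Otimes>\<^sub>M lebesgue) (\<lambda>(x, y). p x * q y)"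
    by (rule lebesgue_pair.Fubini_integrable) (use p q in \<open>auto simp: norm_mult\<close>)
  then have "integrable (lebesgue \<Otimes>\<^sub>M lebesgue) (case_prod f)"
  proof (rule Bochner_Integration.integrable_bound)
    show "case_prod f \<in> borel_measurable (lebesgue \<Otimes>\<^sub>M lebesgue)"
      unfolding f_def by measurable
  qed (auto simp: f_def)
  from lebesgue_pair.Fubini_integral[OF this]
  have "(LINT y|lebesgue. LINT x|lebesgue. f x y) = (LINT x|lebesgue. LINT y|lebesgue. f x y)" .
  moreover have "(LINT x|lebesgue. f x y) = q y * (LINT x|lebesgue. indicator {..y} x * p x)" for y
    unfolding integral_mult_right_zero[symmetric]
    by (intro Bochner_Integration.integral_cong) (auto simp: f_def indicator_def)
  moreover have "(LINT y|lebesgue. f x y) = p x * ((LINT y|lebesgue. q y) - (LINT y|lebesgue. indicator {..x} y * q y))" for x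
  proof -
    have "(LINT y|lebesgue. f x y) = (LINT y|lebesgue. p x * (q y - indicator {..x} y * q y))"
    proof (rule integral_cong_AE)
      have "AE y in lebesgue. y \<noteq> x" by (simp add: AE_completion AE_lborel_singleton)
      then show "AE y in lebesgue. f x y = p x * (q y - indicator {..x} y * q y)"
        by eventually_elim (auto simp: f_def indicator_def)
      show "(\<lambda>y. f x y) \<in> borel_measurable lebesgue" unfolding f_def by measurable
      show "(\<lambda>y. p x * (q y - indicator {..x} y * q y)) \<in> borel_measurable lebesgue"
        by (intro borel_measurable_times borel_measurable_diff borel_measurable_const borel_measurable_indicator) auto
    qed
    then show ?thesis using q iq[of "{..x}"] by simp
  qed
  ultimately have eq: "(LINT y|lebesgue. q y * (LINT x|lebesgue. indicator {..y} x * p x))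
      = (LINT x|lebesgue. p x * ((LINT y|lebesgue. q y) - (LINT y|lebesgue. indicator {..x} y * q y)))"
    by simp
  have "integrable lebesgue (\<lambda>x. LINT y|lebesgue. f x y)"
    by (rule lebesgue_pair.integrable_fst) fact
  then have "integrable lebesgue (\<lambda>x. p x * ((LINT y|lebesgue. q y) - (LINT y|lebesgue. indicator {..x} y * q y)))"
    by (simp add: \<open>\<And>x. (LINT y|lebesgue. f x y) = _\<close>)
  from Bochner_Integration.integral_diff[OF integrable_mult_left[OF p, of "LINT y|lebesgue. q y"] this]
  show ?thesis unfolding eq by (simp add: algebra_simps)
qed

lemma set_integrable_complex: "set_integrable M A f = integrable M (\<lambda>x. indicator A x * (f x :: complex))"
  by (simp add: set_integrable_def scaleR_conv_of_real of_real_indicator)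

lemma set_integral_complex: "(LINT x:A|M. f x) = (LINT x|M. indicator A x * (f x :: complex))"
  by (simp add: set_lebesgue_integral_def scaleR_conv_of_real of_real_indicator)

lemma set_integrable_of_integrable:
  fixes f :: "real \<Rightarrow> complex"
  shows "integrable lebesgue f \<Longrightarrow> A \<in> sets lebesgue \<Longrightarrow> set_integrable lebesgue A f"
  unfolding set_integrable_def by (rule integrable_mult_indicator)

lemma loc_acD: "loc_ac_deriv F f \<Longrightarrow> a \<le> b \<Longrightarrow> set_integrable lebesgue {a..b} f"
  "loc_ac_deriv F f \<Longrightarrow> a \<le> b \<Longrightarrow> F b - F a = (LINT x:{a..b}|lebesgue. f x)"
  unfolding loc_ac_deriv_def by auto

lemma loc_ac_set_integrable: "loc_ac_deriv F f \<Longrightarrow> set_integrable lebesgue {a..b} f"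
  using loc_acD(1)[of F f a b] by (cases "a \<le> b") (auto simp: set_integrable_def)

lemma loc_ac_continuous:
  assumes F: "loc_ac_deriv F f"
  shows "continuous_on UNIV F"
proof -
  have "continuous (at x) F" for x
  proof -
    have "f integrable_on {x-1..x+1}"
      using set_lebesgue_integral_eq_integral(1)[OF loc_acD(1)[OF F, of "x-1" "x+1"]] by simp
    then have "continuous_on {x-1..x+1} (\<lambda>y. F (x-1) + integral {x-1..y} f)"
      by (intro continuous_intros indefinite_integral_continuous_1)
    moreover have "F (x-1) + integral {x-1..y} f = F y" if "y \<in> {x-1..x+1}" for y
      using set_lebesgue_integral_eq_integral(2)[OF loc_acD(1)[OF F, of "x-1" y]] loc_acD(2)[OF F, of "x-1" y] that
      by (simp add: algebra_simps)
    ultimately have "continuous_on {x-1..x+1} F" by (rule continuous_on_eq)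
    then show ?thesis
      by (rule continuous_on_interior) simp
  qed
  then show ?thesis by (simp add: continuous_at_imp_continuous_on)
qed

lemma loc_ac_measurable: "loc_ac_deriv F f \<Longrightarrow> F \<in> borel_measurable lebesgue"
  by (rule cont_measurable_lebesgue[OF loc_ac_continuous])

lemma loc_ac_deriv_measurable:
  assumes F: "loc_ac_deriv F f"
  shows "f \<in> borel_measurable lebesgue"
proof (rule borel_measurable_LIMSEQ_metric)
  fix n :: nat
  show "(\<lambda>x. indicator {- real n..real n} x * f x) \<in> borel_measurable lebesgue"
    using loc_ac_set_integrable[OF F, of "- real n" "real n"] by (simp add: set_integrable_complex)
next
  fix x :: real
  obtain N :: nat where N: "\<bar>x\<bar> \<le> real N" using real_arch_simple by blast
  have "indicator {- real n..real n} x * f x = f x" if "n \<ge> N" for n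
    using that N by (auto simp: indicator_def abs_le_iff)
  then show "(\<lambda>n. indicator {- real n..real n} x * f x) \<longlonglongrightarrow> f x"
    by (intro tendsto_eventually) (auto simp: eventually_sequentially)
qed

lemma set_integrable_mult_continuous:
  fixes F f :: "real \<Rightarrow> complex"
  assumes F: "continuous_on UNIV F" and f: "set_integrable lebesgue {a..b} f"
  shows "set_integrable lebesgue {a..b} (\<lambda>x. F x * f x)"
proof -
  have "bounded (F ` {a..b})"
    by (intro compact_imp_bounded compact_continuous_image continuous_on_subset[OF F]) auto
  then obtain M where M: "\<And>x. x \<in> {a..b} \<Longrightarrow> cmod (F x) \<le> M"
    unfolding bounded_iff by (auto intro: that)
  have f': "integrable lebesgue (\<lambda>x. indicator {a..b} x * f x)"
    using f by (simp add: set_integrable_complex)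
  have "integrable lebesgue (\<lambda>x. F x * (indicator {a..b} x * f x))"
  proof (rule Bochner_Integration.integrable_bound[OF integrable_mult_right[OF f', of "of_real M"]])
    show "(\<lambda>x. F x * (indicator {a..b} x * f x)) \<in> borel_measurable lebesgue"
      by (intro borel_measurable_times cont_measurable_lebesgue F borel_measurable_integrable f')
    have "cmod (F x * (indicator {a..b} x * f x)) \<le> cmod (of_real M * (indicator {a..b} x * f x))" for x
      using M[of x] by (auto simp: indicator_def norm_mult intro!: mult_right_mono)
    then show "AE x in lebesgue. cmod (F x * (indicator {a..b} x * f x)) \<le> cmod (of_real M * (indicator {a..b} x * f x))"
      by simp
  qed
  then show ?thesis by (simp add: set_integrable_complex mult_ac)
qed

lemma loc_ac_add: "loc_ac_deriv F f \<Longrightarrow> loc_ac_deriv G g \<Longrightarrow> loc_ac_deriv (\<lambda>x. F x + G x) (\<lambda>x. f x + g x)"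
  unfolding loc_ac_deriv_def by (auto simp: set_integral_add) (metis add_diff_add)

lemma loc_ac_cmult: "loc_ac_deriv F f \<Longrightarrow> loc_ac_deriv (\<lambda>x. c * F x) (\<lambda>x. c * f x)"
  unfolding loc_ac_deriv_def by (auto simp flip: right_diff_distrib)

lemma loc_ac_diff: "loc_ac_deriv F f \<Longrightarrow> loc_ac_deriv G g \<Longrightarrow> loc_ac_deriv (\<lambda>x. F x - G x) (\<lambda>x. f x - g x)"
  using loc_ac_add[OF _ loc_ac_cmult[of G g "- 1"], of F f] by simp

lemma loc_ac_cnj: "loc_ac_deriv F f \<Longrightarrow> loc_ac_deriv (\<lambda>x. cnj (F x)) (\<lambda>x. cnj (f x))"
  unfolding loc_ac_deriv_def set_integrable_complex set_integral_complex
proof (intro allI impI)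
  fix a b :: real
  assume *: "\<forall>a b. a \<le> b \<longrightarrow> integrable lebesgue (\<lambda>x. indicator {a..b} x * f x) \<and>
      F b - F a = (LINT x|lebesgue. indicator {a..b} x * f x)" and "a \<le> b"
  have eq: "indicator {a..b} x * cnj (f x) = cnj (indicator {a..b} x * f x)" for x
    by (simp add: indicator_def)
  show "integrable lebesgue (\<lambda>x. indicator {a..b} x * cnj (f x)) \<and>
      cnj (F b) - cnj (F a) = (LINT x|lebesgue. indicator {a..b} x * cnj (f x))"
    using * \<open>a \<le> b\<close> unfolding eq Bochner_Integration.integral_cnj complex_integrable_cnj
    by (simp flip: complex_cnj_diff del: complex_cnj_mult)
qed

text \<open>On [a,b] each factor is its value at a plus the integral of its derivative. Only the
  product of the two integrals is not linear in either derivative alone, and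
  \<open>integral_triangle\<close> resolves it.\<close>

theorem loc_ac_mult:
  assumes F: "loc_ac_deriv F f" and G: "loc_ac_deriv G g"
  shows "loc_ac_deriv (\<lambda>x. F x * G x) (\<lambda>x. f x * G x + F x * g x)"
  unfolding loc_ac_deriv_def
proof (intro allI impI)
  fix a b :: real assume ab: "a \<le> b"
  define p where "p x = indicator {a..b} x * f x" for x
  define q where "q x = indicator {a..b} x * g x" for x
  have p: "integrable lebesgue p" and q: "integrable lebesgue q"
    using loc_acD(1)[OF F ab] loc_acD(1)[OF G ab] by (simp_all add: set_integrable_complex p_def[abs_def] q_def[abs_def])
  have Fx: "F x = F a + (LINT y|lebesgue. indicator {..x} y * p y)"
    and Gx: "G x = G a + (LINT y|lebesgue. indicator {..x} y * q y)" if "x \<in> {a..b}" for x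
  proof -
    have eq: "indicator {..x} y * (indicator {a..b} y * h y) = indicator {a..x} y * h y" for h :: "real \<Rightarrow> complex" and y
      using that by (auto simp: indicator_def)
    show "F x = F a + (LINT y|lebesgue. indicator {..x} y * p y)"
      "G x = G a + (LINT y|lebesgue. indicator {..x} y * q y)"
      using loc_acD(2)[OF F, of a x] loc_acD(2)[OF G, of a x] that
      unfolding set_integral_complex p_def q_def eq by (simp_all add: diff_eq_eq add.commute)
  qed
  have i1: "set_integrable lebesgue {a..b} (\<lambda>x. f x * G x)"
    using set_integrable_mult_continuous[OF loc_ac_continuous[OF G] loc_acD(1)[OF F ab]] by (simp add: mult.commute)
  have i2: "set_integrable lebesgue {a..b} (\<lambda>x. F x * g x)"
    by (rule set_integrable_mult_continuous[OF loc_ac_continuous[OF F] loc_acD(1)[OF G ab]])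
  have e1: "indicator {a..b} x * (f x * G x) = p x * G a + p x * (LINT y|lebesgue. indicator {..x} y * q y)" for x
    using Gx[of x] by (cases "x \<in> {a..b}") (auto simp: p_def algebra_simps)
  have e2: "indicator {a..b} x * (F x * g x) = q x * F a + q x * (LINT y|lebesgue. indicator {..x} y * p y)" for x
    using Fx[of x] by (cases "x \<in> {a..b}") (auto simp: q_def algebra_simps)
  have j1: "integrable lebesgue (\<lambda>x. p x * (LINT y|lebesgue. indicator {..x} y * q y))"
    using Bochner_Integration.integrable_diff[OF i1[unfolded set_integrable_complex e1] integrable_mult_left[OF p, of "G a"]]
    by simp
  have j2: "integrable lebesgue (\<lambda>x. q x * (LINT y|lebesgue. indicator {..x} y * p y))"
    using Bochner_Integration.integrable_diff[OF i2[unfolded set_integrable_complex e2] integrable_mult_left[OF q, of "F a"]]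
    by simp
  have Fb: "F b = F a + integral\<^sup>L lebesgue p" and Gb: "G b = G a + integral\<^sup>L lebesgue q"
    using loc_acD(2)[OF F ab] loc_acD(2)[OF G ab]
    by (simp_all add: set_integral_complex p_def[abs_def] q_def[abs_def] algebra_simps)
  have "(LINT x:{a..b}|lebesgue. f x * G x + F x * g x)
      = (LINT x:{a..b}|lebesgue. f x * G x) + (LINT x:{a..b}|lebesgue. F x * g x)"
    by (rule set_integral_add(2)[OF i1 i2])
  also have "\<dots> = integral\<^sup>L lebesgue p * G a + integral\<^sup>L lebesgue q * F a
      + integral\<^sup>L lebesgue p * integral\<^sup>L lebesgue q"
    unfolding set_integral_complex e1 e2 using integral_triangle[OF p q] p q j1 j2
    by (simp add: algebra_simps)
  also have "\<dots> = F b * G b - F a * G a" unfolding Fb Gb by (simp add: algebra_simps)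
  finally show "set_integrable lebesgue {a..b} (\<lambda>x. f x * G x + F x * g x) \<and>
      F b * G b - F a * G a = (LINT x:{a..b}|lebesgue. f x * G x + F x * g x)"
    using set_integral_add(1)[OF i1 i2] by simp
qed

text \<open>Finitely many exceptional points admit kinks such as those of \<open>weight\<close>;
  local boundedness of f turns the gauge integral of the fundamental theorem into a Lebesgue
  integral.\<close>

lemma loc_ac_of_derivative:
  fixes F f :: "real \<Rightarrow> complex"
  assumes F: "continuous_on UNIV F" and f: "f \<in> borel_measurable borel"
    and S: "finite S" "\<And>x. x \<notin> S \<Longrightarrow> (F has_vector_derivative f x) (at x)"
    and bd: "\<And>a b. \<exists>M. \<forall>x\<in>{a..b}. cmod (f x) \<le> M"
  shows "loc_ac_deriv F f"
  unfolding loc_ac_deriv_def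
proof (intro allI impI)
  fix a b :: real assume ab: "a \<le> b"
  obtain M where M: "\<And>x. x \<in> {a..b} \<Longrightarrow> cmod (f x) \<le> M" using bd by blast
  have *: "set_integrable lebesgue {a..b} f"
    unfolding set_integrable_complex
  proof (rule Bochner_Integration.integrable_bound)
    show "integrable lebesgue (\<lambda>x. M * indicator {a..b} x)"
      by (intro integrable_mult_right integrable_real_indicator) (auto simp: emeasure_lborel_Icc_eq)
    show "(\<lambda>x. indicator {a..b} x * f x) \<in> borel_measurable lebesgue"
      by (intro measurable_completion) (use f in simp)
    have "cmod (indicator {a..b} x * f x) \<le> norm (M * indicator {a..b} x)" for x
      using M[of x] by (auto simp: indicator_def)
    then show "AE x in lebesgue. cmod (indicator {a..b} x * f x) \<le> norm (M * indicator {a..b} x)" by simp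
  qed
  have "(f has_integral (F b - F a)) {a..b}"
    using S by (intro fundamental_theorem_of_calculus_strong[OF S(1) ab] continuous_on_subset[OF F]) auto
  then have "F b - F a = integral {a..b} f" by (simp add: integral_unique)
  then show "set_integrable lebesgue {a..b} f \<and> F b - F a = (LINT x:{a..b}|lebesgue. f x)"
    using * set_lebesgue_integral_eq_integral(2)[OF *] by simp
qed

lemma loc_ac_of_C1:
  fixes F f :: "real \<Rightarrow> complex"
  assumes f: "continuous_on UNIV f" and F: "\<And>x. (F has_vector_derivative f x) (at x)"
  shows "loc_ac_deriv F f"
proof (rule loc_ac_of_derivative[where S = "{}"])
  show "continuous_on UNIV F"
    using F by (intro continuous_at_imp_continuous_on ballI has_vector_derivative_continuous)
  show "f \<in> borel_measurable borel" using f by (rule borel_measurable_continuous_onI)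
  show "\<exists>M. \<forall>x\<in>{a..b}. cmod (f x) \<le> M" for a b
    using compact_imp_bounded[OF compact_continuous_image[OF continuous_on_subset[OF f], of "{a..b}"]]
    by (auto simp: bounded_iff)
qed (use F in auto)

lemma ex_loc_ac_primitive:
  fixes w :: "real \<Rightarrow> complex"
  assumes w: "\<And>a b. set_integrable lebesgue {a..b} w"
  shows "\<exists>W. loc_ac_deriv W w"
proof -
  have w': "w integrable_on {a..b}" and e: "(LINT x:{a..b}|lebesgue. w x) = integral {a..b} w" for a b
    using set_lebesgue_integral_eq_integral[OF w] by blast+
  define W where "W x = (if x \<ge> 0 then integral {0..x} w else - integral {x..0} w)" for x
  have "W b - W a = integral {a..b} w" if "a \<le> b" for a b
    using Henstock_Kurzweil_Integration.integral_combine[OF _ _ w', of a 0 b]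
      Henstock_Kurzweil_Integration.integral_combine[OF _ _ w', of 0 a b]
      Henstock_Kurzweil_Integration.integral_combine[OF _ _ w', of a b 0] that
    by (auto simp: W_def algebra_simps)
  then show ?thesis using w e unfolding loc_ac_deriv_def by metis
qed

text \<open>Integrability of F replaces decay at infinity: the cutoff 1 - (x/c)^2 vanishes at c and
  -c and so removes the boundary terms, while its derivative stays bounded by 2 and tends to 0 as c
  grows. Dominated convergence leaves the integral of f.\<close>

theorem integral_loc_ac_deriv_eq_0:
  assumes F: "loc_ac_deriv F f" and iF: "integrable lebesgue F" and i: "integrable lebesgue f"
  shows "(LINT x|lebesgue. f x) = 0"
proof -
  define c where "c n = real (Suc n)" for n
  have c: "c n \<ge> 1" for n by (simp add: c_def)
  define g where "g n x = f x * of_real (1 - (x / c n)\<^sup>2) + F x * of_real (- 2 * x / (c n)\<^sup>2)" for n x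
  have meas [measurable]: "f \<in> borel_measurable lebesgue" "F \<in> borel_measurable lebesgue" using i iF by auto
  have zero: "(LINT x|lebesgue. indicator {- c n..c n} x * g n x) = 0" for n
  proof -
    have "loc_ac_deriv (\<lambda>x. of_real (1 - (x / c n)\<^sup>2)) (\<lambda>x. of_real (- 2 * x / (c n)\<^sup>2))"
      by (rule loc_ac_of_C1)
        (use c[of n] in \<open>auto intro!: continuous_intros derivative_eq_intros has_vector_derivative_of_real
          simp: has_real_derivative_iff_has_vector_derivative[symmetric] power2_eq_square\<close>)
    from loc_acD(2)[OF loc_ac_mult[OF F this], of "- c n" "c n"] c[of n]
    show ?thesis by (simp add: set_integral_complex g_def)
  qed
  have "(\<lambda>n. LINT x|lebesgue. indicator {- c n..c n} x * g n x) \<longlonglongrightarrow> (LINT x|lebesgue. f x)"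
  proof (rule integral_dominated_convergence[where w = "\<lambda>x. norm (f x) + 2 * norm (F x)"])
    show "(\<lambda>x. indicator {- c n..c n} x * g n x) \<in> borel_measurable lebesgue" for n
    proof -
      have "g n \<in> borel_measurable lebesgue" unfolding g_def by measurable
      then show ?thesis by (intro borel_measurable_times borel_measurable_indicator) auto
    qed
    show "integrable lebesgue (\<lambda>x. norm (f x) + 2 * norm (F x))" using i iF by auto
    have "norm (indicator {- c n..c n} x * g n x) \<le> norm (f x) + 2 * norm (F x)" for n x
    proof (cases "x \<in> {- c n..c n}")
      case True
      then have x: "\<bar>x\<bar> \<le> c n" by auto
      have "(x / c n)\<^sup>2 \<le> 1" using x c[of n] by (simp add: power_divide abs_le_square_iff[symmetric])
      then have 1: "\<bar>1 - (x / c n)\<^sup>2\<bar> \<le> 1" by auto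
      have "\<bar>x\<bar> \<le> (c n)\<^sup>2" using x c[of n] by (simp add: power2_eq_square) (smt (verit) mult_left_le mult_le_cancel_left1)
      then have 2: "\<bar>- 2 * x / (c n)\<^sup>2\<bar> \<le> 2" using c[of n] by (simp add: abs_mult field_simps)
      have "norm (g n x) \<le> norm (f x) * \<bar>1 - (x / c n)\<^sup>2\<bar> + norm (F x) * \<bar>- 2 * x / (c n)\<^sup>2\<bar>"
        unfolding g_def by (rule order_trans[OF norm_triangle_ineq]) (simp only: norm_mult norm_of_real order_refl)
      also have "\<dots> \<le> norm (f x) * 1 + norm (F x) * 2" by (intro add_mono mult_left_mono 1 2) auto
      finally show ?thesis using True by simp
    qed simp
    then show "AE x in lebesgue. norm (indicator {- c n..c n} x * g n x) \<le> norm (f x) + 2 * norm (F x)" for n by simp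
    have "(\<lambda>n. indicator {- c n..c n} x * g n x) \<longlonglongrightarrow> f x" for x
    proof -
      have cinf: "filterlim c at_top sequentially"
        unfolding c_def by (rule filterlim_compose[OF filterlim_real_sequentially filterlim_Suc])
      have l: "(\<lambda>n. x / c n) \<longlonglongrightarrow> 0"
        by (rule real_tendsto_divide_at_top[OF tendsto_const cinf])
      have l': "(\<lambda>n. - 2 * x / (c n)\<^sup>2) \<longlonglongrightarrow> 0"
        by (rule real_tendsto_divide_at_top[OF tendsto_const])
          (rule filterlim_pow_at_top[OF _ cinf], simp)
      have "(\<lambda>n. g n x) \<longlonglongrightarrow> f x * of_real (1 - 0\<^sup>2) + F x * of_real 0"
        unfolding g_def by (intro tendsto_intros l l')
      moreover have "\<forall>\<^sub>F n in sequentially. \<bar>x\<bar> \<le> c n"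
        using cinf by (simp add: filterlim_at_top)
      then have "\<forall>\<^sub>F n in sequentially. g n x = indicator {- c n..c n} x * g n x"
        by eventually_elim (simp add: indicator_def abs_le_iff)
      ultimately show ?thesis using Lim_transform_eventually by force
    qed
    then show "AE x in lebesgue. (\<lambda>n. indicator {- c n..c n} x * g n x) \<longlonglongrightarrow> f x" by simp
  qed simp
  then show ?thesis unfolding zero by (simp add: LIMSEQ_const_iff)
qed

text \<open>A one-dimensional Sobolev bound: the ramp x + 1 - y equals 1 at y = x and 0 at y = x +
  1, so integrating the derivative of F times the ramp over [x, x + 1] returns - F x.\<close>

lemma loc_ac_sup_bound:
  assumes F: "loc_ac_deriv F f" and iF: "integrable lebesgue F" and i: "integrable lebesgue f"
  shows "cmod (F x) \<le> (LINT y|lebesgue. cmod (F y)) + (LINT y|lebesgue. cmod (f y))"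
proof -
  have "loc_ac_deriv (\<lambda>y. of_real (x + 1 - y)) (\<lambda>y. of_real (- 1))"
    by (rule loc_ac_of_C1)
      (auto intro!: continuous_intros derivative_eq_intros has_vector_derivative_of_real
        simp: has_real_derivative_iff_has_vector_derivative[symmetric] simp del: of_real_minus of_real_1)
  from loc_acD[OF loc_ac_mult[OF F this], of x "x + 1"]
  have ii: "integrable lebesgue (\<lambda>y. indicator {x..x+1} y * (f y * of_real (x + 1 - y) + F y * of_real (- 1)))"
    and eq: "- F x = (LINT y|lebesgue. indicator {x..x+1} y * (f y * of_real (x + 1 - y) + F y * of_real (- 1)))"
    by (simp_all add: set_integrable_complex set_integral_complex)
  have "cmod (F x) = norm (- F x)" by simp
  also have "\<dots> \<le> (LINT y|lebesgue. norm (indicator {x..x+1} y * (f y * of_real (x + 1 - y) + F y * of_real (- 1))))"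
    unfolding eq by (rule integral_norm_bound)
  also have "\<dots> \<le> (LINT y|lebesgue. cmod (F y) + cmod (f y))"
  proof (rule integral_mono)
    show "norm (indicator {x..x+1} y * (f y * of_real (x + 1 - y) + F y * of_real (- 1))) \<le> cmod (F y) + cmod (f y)" for y
    proof (cases "y \<in> {x..x+1}")
      case True
      have "norm (f y * of_real (x + 1 - y) + F y * of_real (- 1)) \<le> norm (f y) * \<bar>x + 1 - y\<bar> + norm (F y) * \<bar>- 1\<bar>"
        by (rule order_trans[OF norm_triangle_ineq]) (simp only: norm_mult norm_of_real order_refl)
      also have "\<dots> \<le> norm (f y) * 1 + norm (F y) * 1"
        using True by (intro add_mono mult_left_mono) auto
      finally show ?thesis using True by simp
    qed simp
  qed (use iF i ii in auto)
  finally show ?thesis using iF i by simp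
qed

subsection \<open>Functions in the domain of the operator\<close>

definition H_fun :: "(real \<Rightarrow> complex) \<Rightarrow> (real \<Rightarrow> complex) \<Rightarrow> real \<Rightarrow> complex" where
  "H_fun f0 f2 x = - f2 x + complex_of_real \<bar>x\<bar> * f0 x"

text \<open>In contrast to \<open>H_graph\<close>, f0 is the continuous representative itself, so
  that pointwise values and the derivative f1 are available; f2 is still determined only up to a
  null set.\<close>

definition H_dom :: "(real \<Rightarrow> complex) \<Rightarrow> (real \<Rightarrow> complex) \<Rightarrow> (real \<Rightarrow> complex) \<Rightarrow> bool" where
  "H_dom f0 f1 f2 \<longleftrightarrow> loc_ac_deriv f0 f1 \<and> loc_ac_deriv f1 f2 \<and> f0 \<in> L2 \<and> H_fun f0 f2 \<in> L2"

definition energy_density :: "(real \<Rightarrow> complex) \<Rightarrow> (real \<Rightarrow> complex) \<Rightarrow> real \<Rightarrow> real" where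
  "energy_density f0 f1 x = (cmod (f1 x))\<^sup>2 + \<bar>x\<bar> * (cmod (f0 x))\<^sup>2"

lemma L2_mult_cnj_integrable: "f \<in> L2 \<Longrightarrow> g \<in> L2 \<Longrightarrow> integrable lebesgue (\<lambda>x. f x * cnj (g x))"
  by (intro L2_mult_integrable L2_cnj)

lemma mult_cnj_self: "z * cnj z = complex_of_real ((cmod z)\<^sup>2)"
  by (simp only: complex_norm_square)

lemma integrable_bounded_mult:
  fixes w f :: "real \<Rightarrow> complex"
  assumes f: "integrable lebesgue f" and w: "w \<in> borel_measurable lebesgue" "\<And>x. cmod (w x) \<le> M"
  shows "integrable lebesgue (\<lambda>x. w x * f x)"
proof (rule Bochner_Integration.integrable_bound)
  show "integrable lebesgue (\<lambda>x. M * cmod (f x))" using f by simp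
  show "(\<lambda>x. w x * f x) \<in> borel_measurable lebesgue"
    using f by (intro borel_measurable_times w(1)) auto
  have "cmod (w x * f x) \<le> norm (M * cmod (f x))" for x
    using mult_right_mono[OF w(2)[of x], of "cmod (f x)"] by (auto simp: norm_mult intro: order_trans[OF _ abs_ge_self])
  then show "AE x in lebesgue. cmod (w x * f x) \<le> norm (M * cmod (f x))" by simp
qed

text \<open>Testing the equation for the second derivative of \<open>\<bar>f\<bar>\<^sup>2\<close> against the cutoff
  \<open>(1 - (x/c)\<^sup>2)\<^sup>2\<close>, which vanishes to second order at \<open>\<plusminus>c\<close>.\<close>

lemma H_dom_cutoff:
  assumes H: "H_dom f0 f1 f2" and c: "c \<ge> 1"
  shows "(\<integral>\<^sup>+x. ennreal (indicator {-c..c} x * (energy_density f0 f1 x * (1 - (x/c)\<^sup>2)\<^sup>2)) \<partial>lebesgue)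
      \<le> ennreal (LINT x|lebesgue. 16 * (cmod (f0 x))\<^sup>2 + 2 * cmod (H_fun f0 f2 x * cnj (f0 x)))"
proof -
  define k where "k = 1 / c\<^sup>2"
  have kx: "(x/c)\<^sup>2 = k * x\<^sup>2" for x by (simp add: k_def power_divide)
  have k: "0 \<le> k" "k \<le> 1" using c by (auto simp: k_def one_le_power)
  define \<theta> where "\<theta> x = (1 - k * x\<^sup>2)\<^sup>2" for x
  define \<theta>' where "\<theta>' x = - 4 * k * x * (1 - k * x\<^sup>2)" for x
  define \<theta>'' where "\<theta>'' x = 12 * k * (k * x\<^sup>2) - 4 * k" for x
  have l: "loc_ac_deriv f0 f1" "loc_ac_deriv f1 f2" and L2: "f0 \<in> L2" "H_fun f0 f2 \<in> L2"
    using H by (auto simp: H_dom_def)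
  define \<Phi> where "\<Phi> x = f0 x * cnj (f0 x)" for x
  define \<Phi>' where "\<Phi>' x = f1 x * cnj (f0 x) + f0 x * cnj (f1 x)" for x
  define \<Phi>'' where "\<Phi>'' x = (f2 x * cnj (f0 x) + f1 x * cnj (f1 x)) + (f1 x * cnj (f1 x) + f0 x * cnj (f2 x))" for x
  have lP: "loc_ac_deriv \<Phi> \<Phi>'" "loc_ac_deriv \<Phi>' \<Phi>''"
    unfolding \<Phi>_def \<Phi>'_def \<Phi>''_def by (intro loc_ac_mult loc_ac_add loc_ac_cnj l)+
  have lt: "loc_ac_deriv (\<lambda>x. of_real (\<theta> x)) (\<lambda>x. of_real (\<theta>' x))"
    "loc_ac_deriv (\<lambda>x. of_real (\<theta>' x)) (\<lambda>x. of_real (\<theta>'' x))"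
  proof -
    have "(\<theta> has_real_derivative \<theta>' x) (at x)" for x
      unfolding \<theta>_def \<theta>'_def by (auto intro!: derivative_eq_intros simp: algebra_simps)
    moreover have "(\<theta>' has_real_derivative \<theta>'' x) (at x)" for x
      unfolding \<theta>'_def \<theta>''_def by (auto intro!: derivative_eq_intros simp: algebra_simps power2_eq_square)
    moreover have "continuous_on UNIV \<theta>'" "continuous_on UNIV \<theta>''"
      unfolding \<theta>'_def \<theta>''_def by (intro continuous_intros)+
    ultimately show "loc_ac_deriv (\<lambda>x. of_real (\<theta> x)) (\<lambda>x. of_real (\<theta>' x))"
      "loc_ac_deriv (\<lambda>x. of_real (\<theta>' x)) (\<lambda>x. of_real (\<theta>'' x))"
      by (auto intro!: loc_ac_of_C1 continuous_on_of_real has_vector_derivative_of_real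
          simp: has_real_derivative_iff_has_vector_derivative)
  qed
  have ends: "\<theta> c = 0" "\<theta> (- c) = 0" "\<theta>' c = 0" "\<theta>' (- c) = 0"
    using c by (auto simp: \<theta>_def \<theta>'_def k_def)
  \<comment> \<open>The derivative of \<Phi>' \<theta> - \<Phi> \<theta>', whose boundary values at
    c and -c vanish; the terms \<Phi>' \<theta>' cancel.\<close>
  define D where "D x = (\<Phi>'' x * of_real (\<theta> x) + \<Phi>' x * of_real (\<theta>' x)) - (\<Phi>' x * of_real (\<theta>' x) + \<Phi> x * of_real (\<theta>'' x))" for x
  have "loc_ac_deriv (\<lambda>x. \<Phi>' x * of_real (\<theta> x) - \<Phi> x * of_real (\<theta>' x)) D"
    unfolding D_def by (intro loc_ac_mult loc_ac_diff lP lt)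
  from loc_acD[OF this, of "- c" c] c ends
  have iD: "integrable lebesgue (\<lambda>x. indicator {-c..c} x * D x)" and zD: "(LINT x|lebesgue. indicator {-c..c} x * D x) = 0"
    by (simp_all add: set_integrable_complex set_integral_complex)
  define g where "g x = indicator {-c..c} x * (energy_density f0 f1 x * \<theta> x)" for x :: real
  define R where "R x = \<Phi> x * of_real (\<theta>'' x) + (H_fun f0 f2 x * cnj (f0 x) + cnj (H_fun f0 f2 x * cnj (f0 x))) * of_real (\<theta> x)" for x
  define B where "B x = 16 * (cmod (f0 x))\<^sup>2 + 2 * cmod (H_fun f0 f2 x * cnj (f0 x))" for x
  have iB: "integrable lebesgue B"
    unfolding B_def using L2 by (intro Bochner_Integration.integrable_add integrable_mult_right integrable_norm
      L2_sq_integrable L2_mult_cnj_integrable)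
  have D_eq: "indicator {-c..c} x * D x = of_real (2 * g x) - indicator {-c..c} x * R x" for x
  proof -
    \<comment> \<open>As f'' = |x| f - H f, the second derivative of |f|^2 is twice the nonnegative
      energy density minus 2 Re ((H f) cnj f), and the latter is integrable.\<close>
    have *: "\<Phi>'' x = of_real (2 * energy_density f0 f1 x) - (H_fun f0 f2 x * cnj (f0 x) + cnj (H_fun f0 f2 x * cnj (f0 x)))"
      unfolding \<Phi>''_def energy_density_def H_fun_def mult_cnj_self
      using mult_cnj_self[of "f0 x"] by (simp add: algebra_simps)
    show ?thesis unfolding D_def R_def g_def * by (cases "x \<in> {-c..c}") (simp_all add: algebra_simps)
  qed
  \<comment> \<open>On [-c,c] one has 0 <= k x^2 <= 1, and c >= 1 gives k <= 1. The value 16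
    generously bounds |12 k x^2 - 4| and is the factor in the statement.\<close>
  have \<theta>_le: "\<bar>\<theta> x\<bar> \<le> 1" and \<theta>''_le: "\<bar>\<theta>'' x\<bar> \<le> 16" if "x \<in> {-c..c}" for x
  proof -
    have "x\<^sup>2 \<le> c\<^sup>2" using that c by (intro abs_le_square_iff[THEN iffD1]) auto
    then have q: "k * x\<^sup>2 \<le> 1" "0 \<le> k * x\<^sup>2" using c by (auto simp: k_def)
    then have "\<bar>1 - k * x\<^sup>2\<bar> \<le> 1" by linarith
    then have "\<bar>1 - k * x\<^sup>2\<bar>\<^sup>2 \<le> 1\<^sup>2" by (intro power_mono) auto
    then show "\<bar>\<theta> x\<bar> \<le> 1" by (simp add: \<theta>_def)
    have b: "\<bar>12 * (k * x\<^sup>2) - 4\<bar> \<le> 16" using q by linarith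
    have "\<theta>'' x = k * (12 * (k * x\<^sup>2) - 4)" by (simp add: \<theta>''_def algebra_simps)
    also have "\<bar>\<dots>\<bar> \<le> 1 * 16" unfolding abs_mult using k b by (intro mult_mono) auto
    finally show "\<bar>\<theta>'' x\<bar> \<le> 16" by simp
  qed
  have R_le: "cmod (indicator {-c..c} x * R x) \<le> B x" for x
  proof (cases "x \<in> {-c..c}")
    case True
    have "cmod (R x) \<le> cmod (\<Phi> x) * \<bar>\<theta>'' x\<bar> + (cmod (H_fun f0 f2 x * cnj (f0 x)) + cmod (H_fun f0 f2 x * cnj (f0 x))) * \<bar>\<theta> x\<bar>"
      unfolding R_def
      by (intro order_trans[OF norm_triangle_ineq] add_mono)
        (simp_all only: norm_mult norm_of_real order_refl, intro mult_right_mono order_trans[OF norm_triangle_ineq], simp_all add: norm_mult)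
    also have "\<dots> \<le> cmod (\<Phi> x) * 16 + (cmod (H_fun f0 f2 x * cnj (f0 x)) + cmod (H_fun f0 f2 x * cnj (f0 x))) * 1"
      by (intro add_mono mult_left_mono \<theta>_le \<theta>''_le True) auto
    also have "\<dots> = B x" by (simp add: B_def \<Phi>_def norm_mult power2_eq_square)
    finally show ?thesis using True by simp
  next
    case False then show ?thesis by (simp add: B_def)
  qed
  have f2m: "f2 \<in> borel_measurable lebesgue" using loc_ac_deriv_measurable[OF l(2)] .
  have iR: "integrable lebesgue (\<lambda>x. indicator {-c..c} x * R x)"
  proof (rule Bochner_Integration.integrable_bound[OF iB])
    have "R \<in> borel_measurable lebesgue"
      unfolding R_def \<Phi>_def
      using cont_measurable_lebesgue[OF loc_ac_continuous[OF lt(1)]] L2_measurable[OF L2(1)] L2_measurable[OF L2(2)]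
        loc_ac_deriv_measurable[OF lt(2)]
      by (intro borel_measurable_times borel_measurable_add cnj_measurable)
    then show "(\<lambda>x. indicator {-c..c} x * R x) \<in> borel_measurable lebesgue"
      by (intro borel_measurable_times borel_measurable_indicator) auto
    have "B x \<ge> 0" for x by (simp add: B_def)
    then show "AE x in lebesgue. cmod (indicator {-c..c} x * R x) \<le> norm (B x)" using R_le by simp
  qed
  have "integrable lebesgue (\<lambda>x. complex_of_real (2 * g x))"
    using Bochner_Integration.integrable_add[OF iD iR] unfolding D_eq by simp
  then have ig: "integrable lebesgue g"
    using integrable_Re[of lebesgue "\<lambda>x. complex_of_real (2 * g x)"] by simp
  have g0: "g x \<ge> 0" for x
    by (auto simp: g_def energy_density_def \<theta>_def indicator_def)
  have "complex_of_real (2 * (LINT x|lebesgue. g x)) = (LINT x|lebesgue. complex_of_real (2 * g x))"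
    using ig by simp
  also have "\<dots> = (LINT x|lebesgue. indicator {-c..c} x * D x) + (LINT x|lebesgue. indicator {-c..c} x * R x)"
    unfolding Bochner_Integration.integral_add[OF iD iR, symmetric] by (simp add: D_eq)
  finally have "cmod (complex_of_real (2 * (LINT x|lebesgue. g x))) = cmod (LINT x|lebesgue. indicator {-c..c} x * R x)"
    unfolding zD by simp
  then have "2 * (LINT x|lebesgue. g x) = cmod (LINT x|lebesgue. indicator {-c..c} x * R x)"
    unfolding norm_of_real using Bochner_Integration.integral_nonneg[of lebesgue g] g0 by simp
  also have "\<dots> \<le> (LINT x|lebesgue. cmod (indicator {-c..c} x * R x))" by (rule integral_norm_bound)
  also have "\<dots> \<le> (LINT x|lebesgue. B x)" by (intro integral_mono integrable_norm iR iB R_le)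
  finally have "(LINT x|lebesgue. g x) \<le> (LINT x|lebesgue. B x)"
    using Bochner_Integration.integral_nonneg[of lebesgue g, OF g0] by linarith
  then show ?thesis
    unfolding kx \<theta>_def[symmetric] g_def[symmetric] B_def[symmetric]
    by (subst nn_integral_eq_integral[OF ig]) (auto simp: g0 ennreal_leI)
qed

text \<open>The bound of \<open>H_dom_cutoff\<close> does not depend on c, so Fatou's lemma removes
  the cutoff. Nothing is known beforehand about the decay of f1; afterwards it is square-integrable,
  on which the later integrations by parts over the whole line rely.\<close>

theorem H_dom_energy_integrable:
  assumes H: "H_dom f0 f1 f2"
  shows "integrable lebesgue (energy_density f0 f1)"
proof -
  have l: "loc_ac_deriv f0 f1" "loc_ac_deriv f1 f2" and L2: "f0 \<in> L2" "H_fun f0 f2 \<in> L2"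
    using H by (auto simp: H_dom_def)
  have m: "energy_density f0 f1 \<in> borel_measurable lebesgue"
  proof -
    have [measurable]: "f0 \<in> borel_measurable lebesgue" "f1 \<in> borel_measurable lebesgue"
      using l by (auto intro: loc_ac_measurable)
    show ?thesis unfolding energy_density_def by measurable
  qed
  have e0: "energy_density f0 f1 x \<ge> 0" for x by (simp add: energy_density_def)
  define c where "c n = real (Suc n)" for n
  have c: "c n \<ge> 1" for n by (simp add: c_def)
  have cinf: "filterlim c at_top sequentially"
    unfolding c_def by (rule filterlim_compose[OF filterlim_real_sequentially filterlim_Suc])
  define g where "g n x = indicator {- c n..c n} x * (energy_density f0 f1 x * (1 - (x / c n)\<^sup>2)\<^sup>2)" for n x
  define K where "K = (LINT x|lebesgue. 16 * (cmod (f0 x))\<^sup>2 + 2 * cmod (H_fun f0 f2 x * cnj (f0 x)))"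
  have "(\<integral>\<^sup>+x. ennreal (energy_density f0 f1 x) \<partial>lebesgue) = (\<integral>\<^sup>+x. liminf (\<lambda>n. ennreal (g n x)) \<partial>lebesgue)"
  proof (rule nn_integral_cong)
    fix x
    have "(\<lambda>n. energy_density f0 f1 x * (1 - (x / c n)\<^sup>2)\<^sup>2) \<longlonglongrightarrow> energy_density f0 f1 x * (1 - 0\<^sup>2)\<^sup>2"
      by (intro tendsto_intros real_tendsto_divide_at_top[OF tendsto_const cinf])
    moreover have "\<forall>\<^sub>F n in sequentially. \<bar>x\<bar> \<le> c n" using cinf by (simp add: filterlim_at_top)
    then have "\<forall>\<^sub>F n in sequentially. energy_density f0 f1 x * (1 - (x / c n)\<^sup>2)\<^sup>2 = g n x"
      by eventually_elim (simp add: g_def indicator_def abs_le_iff)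
    ultimately have "(\<lambda>n. g n x) \<longlonglongrightarrow> energy_density f0 f1 x" using Lim_transform_eventually by force
    then have "(\<lambda>n. ennreal (g n x)) \<longlonglongrightarrow> ennreal (energy_density f0 f1 x)" by (rule tendsto_ennrealI)
    then show "ennreal (energy_density f0 f1 x) = liminf (\<lambda>n. ennreal (g n x))"
      by (rule lim_imp_Liminf[OF sequentially_bot, symmetric])
  qed
  also have "\<dots> \<le> liminf (\<lambda>n. \<integral>\<^sup>+x. ennreal (g n x) \<partial>lebesgue)"
  proof (rule nn_integral_liminf)
    fix n
    have "g n \<in> borel_measurable lebesgue"
      unfolding g_def by (intro borel_measurable_times borel_measurable_indicator m cont_measurable_lebesgue continuous_intros)
        (auto simp: c_def)
    then show "(\<lambda>x. ennreal (g n x)) \<in> borel_measurable lebesgue" by simp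
  qed
  also have "\<dots> \<le> liminf (\<lambda>n. ennreal K)"
    by (intro Liminf_mono always_eventually allI) (use H_dom_cutoff[OF H c] in \<open>simp add: g_def K_def\<close>)
  also have "\<dots> = ennreal K" by (simp add: Liminf_const)
  finally have "(\<integral>\<^sup>+x. ennreal (energy_density f0 f1 x) \<partial>lebesgue) \<le> ennreal K" .
  then show ?thesis
    using m e0 by (intro integrableI_bounded) (auto simp: le_less_trans)
qed

lemma H_dom_deriv_L2: "H_dom f0 f1 f2 \<Longrightarrow> f1 \<in> L2"
proof (rule L2_bound[OF _ H_dom_energy_integrable])
  assume "H_dom f0 f1 f2"
  then show "f1 \<in> borel_measurable lebesgue" by (auto simp: H_dom_def loc_ac_measurable)
qed (auto simp: energy_density_def)

text \<open>The Wronskian f1 cnj g0 - f0 cnj g1 is integrable because f1 and g1 are in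
  \<open>L2\<close>. So is its derivative f cnj(H g) - (H f) cnj g, from which the potential and the
  products of first derivatives have cancelled; hence that derivative has integral 0.\<close>

theorem H_dom_symmetric:
  assumes f: "H_dom f0 f1 f2" and g: "H_dom g0 g1 g2"
  shows "(LINT x|lebesgue. f0 x * cnj (H_fun g0 g2 x)) = (LINT x|lebesgue. H_fun f0 f2 x * cnj (g0 x))"
proof -
  have L2: "f0 \<in> L2" "f1 \<in> L2" "g0 \<in> L2" "g1 \<in> L2" "H_fun f0 f2 \<in> L2" "H_fun g0 g2 \<in> L2"
    and l: "loc_ac_deriv f0 f1" "loc_ac_deriv f1 f2" "loc_ac_deriv g0 g1" "loc_ac_deriv g1 g2"
    using f g H_dom_deriv_L2[OF f] H_dom_deriv_L2[OF g] by (auto simp: H_dom_def)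
  have e: "(f2 x * cnj (g0 x) + f1 x * cnj (g1 x)) - (f1 x * cnj (g1 x) + f0 x * cnj (g2 x))
      = f0 x * cnj (H_fun g0 g2 x) - H_fun f0 f2 x * cnj (g0 x)" for x
    by (simp add: H_fun_def algebra_simps)
  have "loc_ac_deriv (\<lambda>x. f1 x * cnj (g0 x) - f0 x * cnj (g1 x))
      (\<lambda>x. (f2 x * cnj (g0 x) + f1 x * cnj (g1 x)) - (f1 x * cnj (g1 x) + f0 x * cnj (g2 x)))"
    by (intro loc_ac_mult loc_ac_diff loc_ac_cnj l)
  from integral_loc_ac_deriv_eq_0[OF this[unfolded e]]
  show ?thesis using L2 by (simp add: L2_mult_cnj_integrable)
qed

text \<open>The derivative of w f1 cnj f0 is integrated over the line, with f'' replaced by |x| f -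
  H f. Boundedness of w and w' keeps each term integrable.\<close>

theorem H_dom_weighted:
  assumes H: "H_dom f0 f1 f2"
    and w: "loc_ac_deriv (\<lambda>x. of_real (w x)) (\<lambda>x. of_real (w' x))"
    and bd: "\<And>x. \<bar>w x\<bar> \<le> M" "\<And>x. \<bar>w' x\<bar> \<le> M'"
  shows "integrable lebesgue (\<lambda>x. of_real (w' x) * (f1 x * cnj (f0 x)))"
    and "(LINT x|lebesgue. of_real (w x) * (H_fun f0 f2 x * cnj (f0 x)))
      = (LINT x|lebesgue. of_real (w' x) * (f1 x * cnj (f0 x)))
        + of_real (LINT x|lebesgue. w x * energy_density f0 f1 x)"
proof -
  have L2: "f0 \<in> L2" "f1 \<in> L2" "H_fun f0 f2 \<in> L2"
    and l: "loc_ac_deriv f0 f1" "loc_ac_deriv f1 f2"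
    using H H_dom_deriv_L2[OF H] by (auto simp: H_dom_def)
  have m: "(\<lambda>x. complex_of_real (w x)) \<in> borel_measurable lebesgue" "(\<lambda>x. complex_of_real (w' x)) \<in> borel_measurable lebesgue"
    using loc_ac_measurable[OF w] loc_ac_deriv_measurable[OF w] .
  have i1: "integrable lebesgue (\<lambda>x. of_real (w' x) * (f1 x * cnj (f0 x)))"
    by (rule integrable_bounded_mult[where M = M']) (use L2 m bd in \<open>auto simp: L2_mult_cnj_integrable\<close>)
  show "integrable lebesgue (\<lambda>x. of_real (w' x) * (f1 x * cnj (f0 x)))" by (rule i1)
  have i2: "integrable lebesgue (\<lambda>x. of_real (w x) * (H_fun f0 f2 x * cnj (f0 x)))"
    by (rule integrable_bounded_mult[where M = M]) (use L2 m bd in \<open>auto simp: L2_mult_cnj_integrable\<close>)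
  have i3: "integrable lebesgue (\<lambda>x. of_real (w x) * complex_of_real (energy_density f0 f1 x))"
    by (rule integrable_bounded_mult[where M = M]) (use m bd H_dom_energy_integrable[OF H] in auto)
  have i4: "integrable lebesgue (\<lambda>x. of_real (w x) * (f1 x * cnj (f0 x)))"
    by (rule integrable_bounded_mult[where M = M]) (use L2 m bd in \<open>auto simp: L2_mult_cnj_integrable\<close>)
  have e: "of_real (w' x) * (f1 x * cnj (f0 x)) + of_real (w x) * (f2 x * cnj (f0 x) + f1 x * cnj (f1 x))
      = of_real (w' x) * (f1 x * cnj (f0 x)) + of_real (w x) * complex_of_real (energy_density f0 f1 x)
        - of_real (w x) * (H_fun f0 f2 x * cnj (f0 x))" for x
    unfolding H_fun_def energy_density_def mult_cnj_self
    using mult_cnj_self[of "f0 x"] by (simp add: algebra_simps)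
  have "loc_ac_deriv (\<lambda>x. of_real (w x) * (f1 x * cnj (f0 x)))
     (\<lambda>x. of_real (w' x) * (f1 x * cnj (f0 x)) + of_real (w x) * (f2 x * cnj (f0 x) + f1 x * cnj (f1 x)))"
    by (intro loc_ac_mult loc_ac_cnj l w)
  from integral_loc_ac_deriv_eq_0[OF this[unfolded e] i4] i1 i2 i3
  have "(LINT x|lebesgue. of_real (w x) * (H_fun f0 f2 x * cnj (f0 x)))
      = (LINT x|lebesgue. of_real (w' x) * (f1 x * cnj (f0 x)))
        + (LINT x|lebesgue. of_real (w x) * complex_of_real (energy_density f0 f1 x))"
    by simp
  then show "(LINT x|lebesgue. of_real (w x) * (H_fun f0 f2 x * cnj (f0 x)))
      = (LINT x|lebesgue. of_real (w' x) * (f1 x * cnj (f0 x)))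
        + of_real (LINT x|lebesgue. w x * energy_density f0 f1 x)"
    by (simp flip: of_real_mult)
qed

section \<open>Flux, energy and sup bounds for elements of the domain\<close>

lemma mult_le_AM_GM:
  fixes a b s :: real
  assumes "s > 0"
  shows "2 * (a * b) \<le> a\<^sup>2 / s + s * b\<^sup>2"
proof -
  have "0 \<le> (a - s * b)\<^sup>2 / s" using assms by simp
  also have "\<dots> = a\<^sup>2 / s + s * b\<^sup>2 - 2 * (a * b)"
    using assms by (simp add: power2_eq_square field_simps)
  finally show ?thesis by simp
qed

lemma integral_mult_le_AM_GM:
  assumes f: "f \<in> L2" and g: "g \<in> L2" and s: "s > 0"
  shows "2 * (LINT x|lebesgue. cmod (f x * cnj (g x)))
    \<le> (LINT x|lebesgue. (cmod (f x))\<^sup>2) / s + s * (LINT x|lebesgue. (cmod (g x))\<^sup>2)"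
proof -
  have "2 * (LINT x|lebesgue. cmod (f x * cnj (g x))) = (LINT x|lebesgue. 2 * cmod (f x * cnj (g x)))" by simp
  also have "\<dots> \<le> (LINT x|lebesgue. (cmod (f x))\<^sup>2 / s + s * (cmod (g x))\<^sup>2)"
    using mult_le_AM_GM[OF s] f g
    by (intro integral_mono Bochner_Integration.integrable_add integrable_mult_right integrable_norm
      L2_mult_cnj_integrable integrable_divide L2_sq_integrable) (auto simp: norm_mult)
  also have "\<dots> = (LINT x|lebesgue. (cmod (f x))\<^sup>2) / s + s * (LINT x|lebesgue. (cmod (g x))\<^sup>2)"
    using f g by (simp add: L2_sq_integrable)
  finally show ?thesis .
qed

text \<open>The energy term in \<open>H_dom_weighted\<close> is real, so only the term with w'
  survives in the imaginary part: neither the size of the weight nor the potential enters the bound.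
  The parameter s distributes the product of f1 and f0 between kinetic energy and mass.\<close>

lemma H_dom_weight_flux:
  assumes H: "H_dom f0 f1 f2"
    and w: "loc_ac_deriv (\<lambda>x. of_real (w x)) (\<lambda>x. of_real (w' x))"
    and bd: "\<And>x. \<bar>w x\<bar> \<le> M" "\<And>x. \<bar>w' x\<bar> \<le> 1" and s: "s > 0"
  shows "2 * \<bar>Im (LINT x|lebesgue. of_real (w x) * (H_fun f0 f2 x * cnj (f0 x)))\<bar>
    \<le> (LINT x|lebesgue. (cmod (f1 x))\<^sup>2) / s + s * (LINT x|lebesgue. (cmod (f0 x))\<^sup>2)"
proof -
  have L2: "f0 \<in> L2" "f1 \<in> L2" using H H_dom_deriv_L2[OF H] by (auto simp: H_dom_def)
  have "\<bar>Im (LINT x|lebesgue. of_real (w x) * (H_fun f0 f2 x * cnj (f0 x)))\<bar>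
      = \<bar>Im (LINT x|lebesgue. of_real (w' x) * (f1 x * cnj (f0 x)))\<bar>"
    unfolding H_dom_weighted(2)[OF H w bd] by simp
  also have "\<dots> \<le> cmod (LINT x|lebesgue. of_real (w' x) * (f1 x * cnj (f0 x)))" by (rule abs_Im_le_cmod)
  also have "\<dots> \<le> (LINT x|lebesgue. cmod (of_real (w' x) * (f1 x * cnj (f0 x))))" by (rule integral_norm_bound)
  also have "\<dots> \<le> (LINT x|lebesgue. cmod (f1 x * cnj (f0 x)))"
  proof (intro integral_mono integrable_norm H_dom_weighted(1)[OF H w bd] L2_mult_cnj_integrable L2)
    show "cmod (of_real (w' x) * (f1 x * cnj (f0 x))) \<le> cmod (f1 x * cnj (f0 x))" for x
      using mult_right_mono[OF bd(2)[of x], of "cmod (f1 x * cnj (f0 x))"] by (simp add: norm_mult)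
  qed
  finally show ?thesis using integral_mult_le_AM_GM[OF L2(2,1) s] by simp
qed

lemma H_dom_energy:
  assumes H: "H_dom f0 f1 f2"
  shows "Re (LINT x|lebesgue. H_fun f0 f2 x * cnj (f0 x)) = (LINT x|lebesgue. energy_density f0 f1 x)"
proof -
  have "loc_ac_deriv (\<lambda>x. of_real 1) (\<lambda>x. of_real 0)"
    by (rule loc_ac_of_C1) auto
  from H_dom_weighted(2)[OF H this, of 1 0] show ?thesis by simp
qed

text \<open>This is \<open>loc_ac_sup_bound\<close> for |f0|^2, whose derivative is at most 2 |f1|
  |f0|.\<close>

lemma H_dom_sup_bound:
  assumes H: "H_dom f0 f1 f2"
  shows "(cmod (f0 x))\<^sup>2 \<le> 2 * (LINT x|lebesgue. (cmod (f0 x))\<^sup>2) + (LINT x|lebesgue. (cmod (f1 x))\<^sup>2)"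
proof -
  have L2: "f0 \<in> L2" "f1 \<in> L2" and l: "loc_ac_deriv f0 f1" using H H_dom_deriv_L2[OF H] by (auto simp: H_dom_def)
  have "loc_ac_deriv (\<lambda>x. f0 x * cnj (f0 x)) (\<lambda>x. f1 x * cnj (f0 x) + f0 x * cnj (f1 x))"
    by (intro loc_ac_mult loc_ac_cnj l)
  from loc_ac_sup_bound[OF this, of x] L2
  have "(cmod (f0 x))\<^sup>2 \<le> (LINT x|lebesgue. (cmod (f0 x))\<^sup>2)
      + (LINT x|lebesgue. cmod (f1 x * cnj (f0 x) + f0 x * cnj (f1 x)))"
    by (simp add: L2_mult_cnj_integrable norm_mult power2_eq_square)
  also have "(LINT x|lebesgue. cmod (f1 x * cnj (f0 x) + f0 x * cnj (f1 x))) \<le> (LINT x|lebesgue. 2 * cmod (f1 x * cnj (f0 x)))"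
  proof (intro integral_mono integrable_norm Bochner_Integration.integrable_add L2_mult_cnj_integrable L2 integrable_mult_right)
    show "cmod (f1 x * cnj (f0 x) + f0 x * cnj (f1 x)) \<le> 2 * cmod (f1 x * cnj (f0 x))" for x
      using norm_triangle_ineq[of "f1 x * cnj (f0 x)" "f0 x * cnj (f1 x)"] by (simp add: norm_mult mult.commute)
  qed
  also have "\<dots> = 2 * (LINT x|lebesgue. cmod (f1 x * cnj (f0 x)))" by simp
  also have "\<dots> \<le> (LINT x|lebesgue. (cmod (f1 x))\<^sup>2) / 1 + 1 * (LINT x|lebesgue. (cmod (f0 x))\<^sup>2)"
    by (rule integral_mult_le_AM_GM[OF L2(2,1)]) simp
  finally show ?thesis by simp
qed

subsection \<open>Weak solutions are strong\<close>

text \<open>Intervals [a,b] are stable under intersection and generate the Borel sets, so the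
  integral vanishes over every Borel set; passing to complements uses the total integral. A Lebesgue
  set differs from a Borel set by a null set.\<close>

lemma AE_zero_of_interval_integrals:
  fixes p :: "real \<Rightarrow> complex"
  assumes p: "integrable lebesgue p" and int: "\<And>a b. (LINT x:{a..b}|lebesgue. p x) = 0"
    and tot: "(LINT x|lebesgue. p x) = 0"
  shows "AE x in lebesgue. p x = 0"
proof (rule sigma_finite_measure.density_zero[OF sigma_finite_lebesgue p])
  have borel: "(LINT x:A|lebesgue. p x) = 0" if "A \<in> sets borel" for A
  proof -
    define G where "G = range (\<lambda>(a::real, b). {a..b})"
    have G: "sigma_sets UNIV G = sets borel" unfolding G_def by (subst borel_eq_atLeastAtMost) simp
    have stable: "Int_stable G" unfolding Int_stable_def G_def by (auto simp: image_iff)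
    have "A \<in> sigma_sets UNIV G" using that G by simp
    with stable have "Int_stable G" "G \<subseteq> Pow UNIV" "A \<in> sigma_sets UNIV G" by auto
    then show ?thesis
    proof (induction rule: sigma_sets_induct_disjoint)
      case (basic A) then show ?case using int by (auto simp: G_def)
    next
      case empty then show ?case by (simp add: set_lebesgue_integral_def)
    next
      case (compl A)
      then have A: "A \<in> sets lebesgue" by (simp add: G)
      have "(LINT x:UNIV - A|lebesgue. p x) = (LINT x|lebesgue. p x - indicator A x * p x)"
        unfolding set_integral_complex by (intro Bochner_Integration.integral_cong) (auto simp: indicator_def)
      also have "\<dots> = 0"
        using compl p tot integrable_mult_indicator[OF A p]
        by (simp add: set_integral_complex scaleR_conv_of_real of_real_indicator)
      finally show ?case .
    next
      case (union A)
      then have "A i \<in> sets lebesgue" for i by (auto simp: G)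
      then have "(LINT x:(\<Union>i. A i)|lebesgue. p x) = (\<Sum>i. LINT x:A i|lebesgue. p x)"
        using union p by (intro lebesgue_integral_countable_add set_integrable_of_integrable) (auto simp: disjoint_family_on_def)
      then show ?case using union by simp
    qed
  qed
  fix A :: "real set" assume A: "A \<in> sets lebesgue"
  then obtain S N N' where S: "A = S \<union> N" "N \<subseteq> N'" "N' \<in> null_sets lborel" "S \<in> sets lborel"
    by (rule sets_completionE)
  have "A - S \<union> (S - A) \<in> null_sets lebesgue"
  proof (rule null_sets_subset)
    show "N' \<in> null_sets lebesgue" using S(3) by (rule null_sets_completionI)
    show "A - S \<union> (S - A) \<in> sets lebesgue" using A S(4) by (intro sets.Un sets.Diff) auto
  qed (use S in auto)
  then have "(LINT x:A|lebesgue. p x) = (LINT x:S|lebesgue. p x)"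
    using S(4) by (intro set_integral_null_delta p A) auto
  then show "(LINT x:A|lebesgue. p x) = 0" using borel S(4) by simp
qed

text \<open>The uniqueness up to null sets of the derivative in \<open>loc_ac_deriv\<close>, in the
  one case that matters: it makes the graph of H single-valued.\<close>

lemma loc_ac_zero_deriv:
  assumes F: "loc_ac_deriv (\<lambda>x. 0) f"
  shows "AE x in lebesgue. f x = 0"
proof -
  have "AE x in lebesgue. indicator {- real n..real n} x * f x = 0" for n :: nat
  proof (rule AE_zero_of_interval_integrals)
    let ?I = "{- real n..real n}"
    show "integrable lebesgue (\<lambda>x. indicator ?I x * f x)"
      using loc_ac_set_integrable[OF F, of "- real n" "real n"] by (simp add: set_integrable_complex)
    show "(LINT x|lebesgue. indicator ?I x * f x) = 0"
      using loc_acD(2)[OF F, of "- real n" "real n"] by (simp add: set_integral_complex)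
    fix a b :: real
    have "(LINT x:{a..b}|lebesgue. indicator ?I x * f x) = (LINT x:{max a (- real n)..min b (real n)}|lebesgue. f x)"
      unfolding set_integral_complex by (intro Bochner_Integration.integral_cong) (auto simp: indicator_def)
    also have "\<dots> = 0"
      using loc_acD(2)[OF F, of "max a (- real n)" "min b (real n)"]
      by (cases "max a (- real n) \<le> min b (real n)") (simp_all add: set_lebesgue_integral_def)
    finally show "(LINT x:{a..b}|lebesgue. indicator ?I x * f x) = 0" .
  qed
  then have "AE x in lebesgue. \<forall>n::nat. indicator {- real n..real n} x * f x = 0"
    unfolding AE_all_countable by blast
  then show ?thesis
  proof eventually_elim
    case (elim x)
    obtain n :: nat where "\<bar>x\<bar> \<le> real n" using real_arch_simple by blast
    then show ?case using elim[rule_format, of n] by (simp add: indicator_def abs_le_iff)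
  qed
qed

lemma continuous_AE_zero:
  fixes F :: "real \<Rightarrow> complex"
  assumes F: "continuous_on UNIV F" and ae: "AE x in lebesgue. F x = 0"
  shows "F x = 0"
proof (rule ccontr)
  assume *: "F x \<noteq> 0"
  have "open {x. F x \<noteq> 0}"
    using F by (intro open_Collect_neq continuous_on_const)
  moreover from this have "negligible {x. F x \<noteq> 0}"
    using ae \<open>open {x. F x \<noteq> 0}\<close> by (simp add: negligible_iff_null_sets AE_iff_null_sets)
  ultimately show False using * open_not_negligible by blast
qed

lemma set_integrable_continuous:
  fixes F :: "real \<Rightarrow> complex"
  assumes "continuous_on UNIV F"
  shows "set_integrable lebesgue {a..b} F"
proof -
  have "integrable lebesgue (\<lambda>x. complex_of_real (indicator {a..b} x))"
    by (intro integrable_of_real integrable_real_indicator) (auto simp: emeasure_lborel_Icc_eq)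
  then have "set_integrable lebesgue {a..b} (\<lambda>x. 1 :: complex)"
    by (simp add: set_integrable_complex of_real_indicator)
  from set_integrable_mult_continuous[OF assms this] show ?thesis by simp
qed

lemma L2_indicator_continuous:
  fixes F :: "real \<Rightarrow> complex"
  assumes F: "continuous_on UNIV F"
  shows "(\<lambda>x. indicator {a..b} x * F x) \<in> L2"
  unfolding L2_def
proof safe
  have "integrable lebesgue (\<lambda>x. indicator {a..b} x * (F x * cnj (F x)))"
    unfolding set_integrable_complex[symmetric] by (intro set_integrable_continuous continuous_intros F)
  then have "integrable lebesgue (\<lambda>x. cmod (indicator {a..b} x * (F x * cnj (F x))))" by (rule integrable_norm)
  moreover have "cmod (indicator {a..b} x * (F x * cnj (F x))) = (cmod (indicator {a..b} x * F x))\<^sup>2" for x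
    by (simp add: indicator_def norm_mult power2_eq_square)
  ultimately show "integrable lebesgue (\<lambda>x. (cmod (indicator {a..b} x * F x))\<^sup>2)" by simp
  show "(\<lambda>x. indicator {a..b} x * F x) \<in> borel_measurable lebesgue"
    by (intro borel_measurable_times borel_measurable_indicator cont_measurable_lebesgue F) auto
qed

lemma L2_indicator_mult: "f \<in> L2 \<Longrightarrow> A \<in> sets lebesgue \<Longrightarrow> (\<lambda>x. indicator A x * f x) \<in> L2"
  by (rule L2_bounded_mult[where M = 1]) (auto simp: indicator_def[abs_def] intro!: borel_measurable_indicator[unfolded indicator_def[abs_def]])

lemma L2_set_integrable: "f \<in> L2 \<Longrightarrow> set_integrable lebesgue {a..b} f"
  using L2_mult_integrable[OF L2_indicator_continuous[of "\<lambda>x. 1" a b], of f]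
  by (simp add: set_integrable_complex)

lemma H_fun_L2:
  assumes h0: "continuous_on UNIV h0" "\<And>x. N \<le> \<bar>x\<bar> \<Longrightarrow> h0 x = 0" and k: "k \<in> L2"
  shows "h0 \<in> L2" "H_fun h0 k \<in> L2"
proof -
  have "(\<lambda>x. indicator {-N..N} x * h0 x) = h0" using h0(2) by (force simp: indicator_def)
  then show "h0 \<in> L2" using L2_indicator_continuous[OF h0(1), of "- N" N] by simp
  have "(\<lambda>x. indicator {-N..N} x * (of_real \<bar>x\<bar> * h0 x)) = (\<lambda>x. of_real \<bar>x\<bar> * h0 x)"
    using h0(2) by (force simp: indicator_def)
  then have "(\<lambda>x. of_real \<bar>x\<bar> * h0 x) \<in> L2"
    using L2_indicator_continuous[of "\<lambda>x. of_real \<bar>x\<bar> * h0 x" "- N" N] h0(1) by (simp add: continuous_intros)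
  then show "H_fun h0 k \<in> L2"
    using L2_add[OF L2_minus[OF k]] by (simp add: H_fun_def[abs_def])
qed

text \<open>Integrate k twice from -N. The moment of order 0 makes h1 vanish at N; the moment of
  order 1, through (x h1)' = h1 + x k, makes the integral of h1 vanish and with it h0 at N. Outside
  [-N,N] both stay 0 because k does.\<close>

lemma ex_test_function:
  assumes k: "k \<in> L2" "\<And>x. N < \<bar>x\<bar> \<Longrightarrow> k x = 0" and N: "N > 0"
    and m0: "(LINT x:{-N..N}|lebesgue. k x) = 0" and m1: "(LINT x:{-N..N}|lebesgue. of_real x * k x) = 0"
  shows "\<exists>h0 h1. H_dom h0 h1 k \<and> (\<forall>x. N \<le> \<bar>x\<bar> \<longrightarrow> h0 x = 0 \<and> h1 x = 0)"
proof -
  have shift: "loc_ac_deriv (\<lambda>x. F x - F (- N)) f" if "loc_ac_deriv F f" for F f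
    using that by (simp add: loc_ac_deriv_def)
  obtain K where "loc_ac_deriv K k" using ex_loc_ac_primitive[OF L2_set_integrable[OF k(1)]] by blast
  from shift[OF this] obtain h1 where h1: "loc_ac_deriv h1 k" "h1 (- N) = 0" by auto
  have "set_integrable lebesgue {a..b} h1" for a b
    by (rule set_integrable_continuous[OF loc_ac_continuous[OF h1(1)]])
  then obtain K where "loc_ac_deriv K h1" using ex_loc_ac_primitive by blast
  from shift[OF this] obtain h0 where h0: "loc_ac_deriv h0 h1" "h0 (- N) = 0" by auto
  have zero: "h x = 0" if l: "loc_ac_deriv h h'" and e: "h (- N) = 0" "h N = 0" and h': "\<And>x. N < \<bar>x\<bar> \<Longrightarrow> h' x = 0"
      and x: "N \<le> \<bar>x\<bar>" for h h' x
  proof -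
    have z: "(LINT y:{a..b}|lebesgue. h' y) = 0" if "{a<..<b} \<inter> {-N..N} = {}" for a b
    proof -
      have "AE y in lebesgue. y \<noteq> a" "AE y in lebesgue. y \<noteq> b" by (simp_all add: AE_completion AE_lborel_singleton)
      then have "AE y in lebesgue. indicator {a..b} y * h' y = 0"
      proof eventually_elim
        case (elim y)
        show ?case
        proof (cases "y \<in> {a..b}")
          case True
          then have "y \<in> {a<..<b}" using elim by auto
          then have "y \<notin> {-N..N}" using that by blast
          then have "N < \<bar>y\<bar>" by auto
          then show ?thesis by (simp add: h')
        qed simp
      qed
      then show ?thesis unfolding set_integral_complex by (rule integral_eq_zero_AE)
    qed
    show ?thesis
    proof (cases "x \<ge> 0")
      case True
      then have "N \<le> x" using x by simp
      moreover have "{N<..<x} \<inter> {-N..N} = {}" by auto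
      ultimately show ?thesis using loc_acD(2)[OF l, of N x] z[of N x] e by simp
    next
      case False
      then have "x \<le> - N" using x by simp
      moreover have "{x<..<-N} \<inter> {-N..N} = {}" by auto
      ultimately show ?thesis using loc_acD(2)[OF l, of x "- N"] z[of x "- N"] e by simp
    qed
  qed
  have "h1 N = 0" using loc_acD(2)[OF h1(1), of "- N" N] m0 N h1(2) by simp
  with zero[OF h1(1)] h1(2) k(2) have h1z: "h1 x = 0" if "N \<le> \<bar>x\<bar>" for x using that by blast
  have "loc_ac_deriv (\<lambda>x. of_real x) (\<lambda>x. 1)"
    by (rule loc_ac_of_C1) (auto intro!: derivative_eq_intros simp: has_vector_derivative_def scaleR_conv_of_real)
  note loc_acD[OF loc_ac_mult[OF this h1(1)], of "- N" N]
  then have "set_integrable lebesgue {-N..N} (\<lambda>x. h1 x + of_real x * k x)" "(LINT x:{-N..N}|lebesgue. h1 x + of_real x * k x) = 0"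
    using N h1z[of N] h1z[of "- N"] by simp_all
  moreover have "(LINT x:{-N..N}|lebesgue. h1 x + of_real x * k x) = (LINT x:{-N..N}|lebesgue. h1 x) + (LINT x:{-N..N}|lebesgue. of_real x * k x)"
    by (intro set_integral_add(2) loc_ac_set_integrable[OF h0(1)] set_integrable_mult_continuous L2_set_integrable k continuous_intros)
  ultimately have "(LINT x:{-N..N}|lebesgue. h1 x) = 0" using m1 by simp
  then have "h0 N = 0" using loc_acD(2)[OF h0(1), of "- N" N] N h0(2) by simp
  with zero[OF h0(1)] h0(2) h1z have h0z: "h0 x = 0" if "N \<le> \<bar>x\<bar>" for x using that by force
  show ?thesis
    using h0(1) h1(1) h0z h1z H_fun_L2[OF loc_ac_continuous[OF h0(1)] h0z k(1)] unfolding H_dom_def by blast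
qed

lemma interval_moments:
  fixes \<alpha> \<beta> :: complex
  assumes "N > 0"
  shows "(LINT x:{-N..N}|lebesgue. \<alpha> + \<beta> * of_real x) = 2 * of_real N * \<alpha>"
    and "(LINT x:{-N..N}|lebesgue. of_real x * (\<alpha> + \<beta> * of_real x)) = 2 * of_real N ^ 3 / 3 * \<beta>"
proof -
  have "loc_ac_deriv (\<lambda>x. \<alpha> * of_real x + \<beta> * (of_real x)\<^sup>2 / 2) (\<lambda>x. \<alpha> + \<beta> * of_real x)"
    by (rule loc_ac_of_C1) (auto intro!: continuous_intros derivative_eq_intros has_vector_derivative_real_field simp: field_simps)
  from loc_acD(2)[OF this, of "- N" N] assms
  show "(LINT x:{-N..N}|lebesgue. \<alpha> + \<beta> * of_real x) = 2 * of_real N * \<alpha>" by (simp add: mult_ac)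
  have "loc_ac_deriv (\<lambda>x. \<alpha> * (of_real x)\<^sup>2 / 2 + \<beta> * (of_real x) ^ 3 / 3) (\<lambda>x. of_real x * (\<alpha> + \<beta> * of_real x))"
    by (rule loc_ac_of_C1) (auto intro!: continuous_intros derivative_eq_intros has_vector_derivative_real_field
        simp: field_simps power2_eq_square power3_eq_cube)
  from loc_acD(2)[OF this, of "- N" N] assms
  show "(LINT x:{-N..N}|lebesgue. of_real x * (\<alpha> + \<beta> * of_real x)) = 2 * of_real N ^ 3 / 3 * \<beta>" by (simp add: mult_ac)
qed

lemma L2_ae_eq:
  assumes "f \<in> L2" "ae_eq f h" "h \<in> borel_measurable lebesgue"
  shows "h \<in> L2"
proof -
  have "integrable lebesgue (\<lambda>x. (cmod (h x))\<^sup>2)"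
    using L2_sq_integrable[OF assms(1)] assms(2,3)
    by (subst integrable_cong_AE[where g = "\<lambda>x. (cmod (f x))\<^sup>2"])
      (auto simp: ae_eq_def L2_measurable[OF assms(1)] elim: eventually_mono)
  then show ?thesis using assms by (simp add: L2_def)
qed

lemma H_fun_measurable:
  assumes "loc_ac_deriv f0 f1" "loc_ac_deriv f1 f2"
  shows "H_fun f0 f2 \<in> borel_measurable lebesgue"
  unfolding H_fun_def
  by (intro borel_measurable_add borel_measurable_times borel_measurable_uminus
      loc_ac_measurable[OF assms(1)] loc_ac_deriv_measurable[OF assms(2)]
      cont_measurable_lebesgue[of "\<lambda>x. of_real \<bar>x\<bar>"] continuous_intros)

text \<open>If \<open>W\<close> is a second primitive of \<open>\<bar>x\<bar> u - g\<close>, then \<open>u - W\<close> is orthogonal to all \<open>k\<close> on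
  \<open>[-N,N]\<close> whose moments of order 0 and 1 vanish, since these are the second derivatives of test
  functions.  Subtracting from \<open>u - W\<close> its best affine approximation gives such a \<open>k\<close>.\<close>

theorem weak_imp_strong:
  assumes u: "u \<in> L2" and g: "g \<in> L2"
    and weak: "\<And>h0 h1 h2 N. H_dom h0 h1 h2 \<Longrightarrow> (\<And>x. N \<le> \<bar>x\<bar> \<Longrightarrow> h0 x = 0) \<Longrightarrow>
        Re (LINT x|lebesgue. u x * cnj (H_fun h0 h2 x)) = Re (LINT x|lebesgue. g x * cnj (h0 x))"
  shows "\<exists>f0 f1 f2. H_dom f0 f1 f2 \<and> ae_eq u f0 \<and> ae_eq g (H_fun f0 f2)"
proof -
  define w where "w x = of_real \<bar>x\<bar> * u x - g x" for x
  have w_int: "set_integrable lebesgue {a..b} w" for a b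
    unfolding w_def by (intro set_integral_diff(1) set_integrable_mult_continuous L2_set_integrable u g continuous_intros)
  then obtain W1 where W1: "loc_ac_deriv W1 w" using ex_loc_ac_primitive by blast
  have "set_integrable lebesgue {a..b} W1" for a b
    by (rule set_integrable_continuous[OF loc_ac_continuous[OF W1]])
  then obtain W where W: "loc_ac_deriv W W1" using ex_loc_ac_primitive by blast
  define v where "v x = u x - W x" for x
  have W_int: "set_integrable lebesgue {a..b} W" for a b
    by (rule set_integrable_continuous[OF loc_ac_continuous[OF W]])
  have v_int: "set_integrable lebesgue {a..b} v" for a b
    unfolding v_def by (intro set_integral_diff(1) L2_set_integrable u W_int)
  have v_L2: "(\<lambda>x. indicator {a..b} x * v x) \<in> L2" for a b
    using L2_diff[OF L2_indicator_mult[OF u, of "{a..b}"] L2_indicator_continuous[OF loc_ac_continuous[OF W], of a b]]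
    by (simp add: v_def algebra_simps)
  have orth: "Re (LINT x:{-N..N}|lebesgue. v x * cnj (k x)) = 0"
    if N: "N > 0" and k: "k \<in> L2" "\<And>x. N < \<bar>x\<bar> \<Longrightarrow> k x = 0"
      and m: "(LINT x:{-N..N}|lebesgue. k x) = 0" "(LINT x:{-N..N}|lebesgue. of_real x * k x) = 0" for N k
  proof -
    obtain h0 h1 where h: "H_dom h0 h1 k" "\<And>x. N \<le> \<bar>x\<bar> \<Longrightarrow> h0 x = 0" "\<And>x. N \<le> \<bar>x\<bar> \<Longrightarrow> h1 x = 0"
      using ex_test_function[OF k N m] by blast
    have l: "loc_ac_deriv h0 h1" "loc_ac_deriv h1 k" and hL2: "h0 \<in> L2" "H_fun h0 k \<in> L2"
      using h(1) by (auto simp: H_dom_def)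
    \<comment> \<open>Green's identity for W and h0 on [-N,N]; the boundary terms vanish together
      with h0 and h1.\<close>
    have e: "(w x * cnj (h0 x) + W1 x * cnj (h1 x)) - (W1 x * cnj (h1 x) + W x * cnj (k x))
        = w x * cnj (h0 x) - W x * cnj (k x)" for x by simp
    have "loc_ac_deriv (\<lambda>x. W1 x * cnj (h0 x) - W x * cnj (h1 x))
        (\<lambda>x. (w x * cnj (h0 x) + W1 x * cnj (h1 x)) - (W1 x * cnj (h1 x) + W x * cnj (k x)))"
      by (intro loc_ac_diff loc_ac_mult loc_ac_cnj W W1 l)
    from loc_acD[OF this[unfolded e], of "- N" N] N h(2,3)[of N] h(2,3)[of "- N"]
    have i1: "integrable lebesgue (\<lambda>x. indicator {-N..N} x * (w x * cnj (h0 x) - W x * cnj (k x)))"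
      and z1: "(LINT x|lebesgue. indicator {-N..N} x * (w x * cnj (h0 x) - W x * cnj (k x))) = 0"
      by (simp_all add: set_integrable_complex set_integral_complex)
    have eq: "u x * cnj (H_fun h0 k x) - g x * cnj (h0 x)
        = indicator {-N..N} x * (w x * cnj (h0 x) - W x * cnj (k x)) - indicator {-N..N} x * (v x * cnj (k x))" for x
    proof (cases "x \<in> {-N..N}")
      case True then show ?thesis by (simp add: H_fun_def w_def v_def algebra_simps)
    next
      case False
      then have "N < \<bar>x\<bar>" by auto
      then show ?thesis using False by (simp add: H_fun_def h k)
    qed
    have i2: "integrable lebesgue (\<lambda>x. u x * cnj (H_fun h0 k x) - g x * cnj (h0 x))"
      by (intro Bochner_Integration.integrable_diff L2_mult_cnj_integrable u g hL2)
    have "(LINT x:{-N..N}|lebesgue. v x * cnj (k x))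
        = (LINT x|lebesgue. indicator {-N..N} x * (w x * cnj (h0 x) - W x * cnj (k x)) - (u x * cnj (H_fun h0 k x) - g x * cnj (h0 x)))"
      unfolding set_integral_complex by (intro Bochner_Integration.integral_cong) (simp_all add: eq)
    also have "\<dots> = - ((LINT x|lebesgue. u x * cnj (H_fun h0 k x)) - (LINT x|lebesgue. g x * cnj (h0 x)))"
      using Bochner_Integration.integral_diff[OF i1 i2] z1
      by (simp add: L2_mult_cnj_integrable u g hL2)
    finally show ?thesis using weak[OF h(1,2)] by simp
  qed
  \<comment> \<open>Normalised according to \<open>interval_moments\<close>, so that A N + B N x has
    the same moments of order 0 and 1 on [-N,N] as v.\<close>
  define A where "A N = (LINT x:{-N..N}|lebesgue. v x) / (2 * of_real N)" for N
  define B where "B N = (LINT x:{-N..N}|lebesgue. of_real x * v x) / (2 * of_real N ^ 3 / 3)" for N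
  have affine: "AE x in lebesgue. indicator {-N..N} x * (v x - (A N + B N * of_real x)) = 0" if N: "N > 0" for N
  proof -
    define p where "p x = A N + B N * of_real x" for x
    have pc: "continuous_on UNIV p" unfolding p_def by (intro continuous_intros)
    have p_int: "set_integrable lebesgue {-N..N} p" "set_integrable lebesgue {-N..N} (\<lambda>x. of_real x * p x)"
      by (intro set_integrable_continuous continuous_intros pc)+
    define k where "k x = indicator {-N..N} x * (v x - p x)" for x
    have kL2: "k \<in> L2"
      using L2_diff[OF v_L2[of "- N" N] L2_indicator_continuous[OF pc, of "- N" N]]
      by (simp add: k_def[abs_def] algebra_simps)
    have m0: "(LINT x:{-N..N}|lebesgue. k x) = 0"
    proof -
      have "(LINT x:{-N..N}|lebesgue. k x) = (LINT x:{-N..N}|lebesgue. v x - p x)"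
        unfolding set_integral_complex by (intro Bochner_Integration.integral_cong) (auto simp: k_def indicator_def)
      also have "\<dots> = (LINT x:{-N..N}|lebesgue. v x) - (LINT x:{-N..N}|lebesgue. p x)"
        by (rule set_integral_diff(2)[OF v_int p_int(1)])
      finally show ?thesis using N unfolding p_def interval_moments[OF N] A_def by simp
    qed
    have m1: "(LINT x:{-N..N}|lebesgue. of_real x * k x) = 0"
    proof -
      have "(LINT x:{-N..N}|lebesgue. of_real x * k x) = (LINT x:{-N..N}|lebesgue. of_real x * v x - of_real x * p x)"
        unfolding set_integral_complex by (intro Bochner_Integration.integral_cong) (auto simp: k_def indicator_def algebra_simps)
      also have "\<dots> = (LINT x:{-N..N}|lebesgue. of_real x * v x) - (LINT x:{-N..N}|lebesgue. of_real x * p x)"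
        by (rule set_integral_diff(2)[OF set_integrable_mult_continuous[OF _ v_int] p_int(2)]) (intro continuous_intros)
      finally show ?thesis using N unfolding p_def interval_moments[OF N] B_def by simp
    qed
    \<comment> \<open>Write |k|^2 as (v - p) cnj k: the v-part vanishes by \<open>orth\<close>, for
      which k is admissible, and the p-part by the two moments of k.\<close>
    have "(LINT x|lebesgue. (cmod (k x))\<^sup>2) = Re (LINT x|lebesgue. k x * cnj (k x))"
      unfolding mult_cnj_self using L2_sq_integrable[OF kL2] by (simp del: of_real_power)
    also have "(LINT x|lebesgue. k x * cnj (k x))
        = (LINT x|lebesgue. indicator {-N..N} x * (v x * cnj (k x)) - (A N * cnj (indicator {-N..N} x * k x) + B N * cnj (indicator {-N..N} x * (of_real x * k x))))"
      by (intro Bochner_Integration.integral_cong) (auto simp: k_def p_def indicator_def algebra_simps)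
    also have "\<dots> = (LINT x:{-N..N}|lebesgue. v x * cnj (k x))
        - (A N * cnj (LINT x:{-N..N}|lebesgue. k x) + B N * cnj (LINT x:{-N..N}|lebesgue. of_real x * k x))"
    proof -
      have j1: "integrable lebesgue (\<lambda>x. indicator {-N..N} x * (v x * cnj (k x)))"
        using L2_mult_cnj_integrable[OF v_L2[of "- N" N] kL2] by (simp add: mult.assoc)
      have j2: "integrable lebesgue (\<lambda>x. cnj (indicator {-N..N} x * k x))"
        using L2_set_integrable[OF kL2, of "- N" N] unfolding set_integrable_complex complex_integrable_cnj .
      have j3: "integrable lebesgue (\<lambda>x. cnj (indicator {-N..N} x * (of_real x * k x)))"
        using set_integrable_mult_continuous[OF _ L2_set_integrable[OF kL2], of "\<lambda>x. of_real x" "- N" N]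
        unfolding set_integrable_complex complex_integrable_cnj by (simp add: continuous_intros)
      show ?thesis
        unfolding set_integral_complex Bochner_Integration.integral_cnj[symmetric]
        using j1 j2 j3 by (simp del: Bochner_Integration.integral_cnj complex_cnj_mult)
    qed
    also have "Re \<dots> = 0"
    proof -
      have "k x = 0" if "N < \<bar>x\<bar>" for x
      proof -
        have "x \<notin> {-N..N}" using that by auto
        then show ?thesis by (simp add: k_def)
      qed
      from orth[OF N kL2 this m0 m1] show ?thesis unfolding m0 m1 by simp
    qed
    finally have "AE x in lebesgue. (cmod (k x))\<^sup>2 = 0"
      using integral_nonneg_eq_0_iff_AE[OF L2_sq_integrable[OF kL2]] by simp
    then show ?thesis by (simp add: k_def p_def)
  qed
  \<comment> \<open>On [-1,1] the affine function for N agrees with v almost everywhere, so its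
    coefficients are read off from the moments of v there, and these define A 1 and B 1. One affine
    function thus serves the whole line.\<close>
  have A_B: "A N = A 1 \<and> B N = B 1" if N: "N \<ge> 1" for N
  proof -
    have ae: "AE x in lebesgue. indicator {-1..1} x * v x = indicator {-1..1} x * (A N + B N * of_real x)"
      using affine[of N] N by (auto simp: indicator_def elim!: eventually_mono split: if_splits)
    have vm: "(\<lambda>x. indicator {-1..1} x * v x) \<in> borel_measurable lebesgue"
      using v_L2 by (rule L2_measurable)
    have pm: "(\<lambda>x. indicator {-1..1} x * (A N + B N * of_real x)) \<in> borel_measurable lebesgue"
      by (rule L2_measurable[OF L2_indicator_continuous]) (intro continuous_intros)
    have xm: "(\<lambda>x. complex_of_real x) \<in> borel_measurable lebesgue"
      by (intro cont_measurable_lebesgue continuous_intros)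
    have "(LINT x:{-1..1}|lebesgue. v x) = (LINT x:{-1..1}|lebesgue. A N + B N * of_real x)"
      unfolding set_integral_complex by (rule integral_cong_AE[OF vm pm ae])
    moreover have "(LINT x:{-1..1}|lebesgue. of_real x * v x) = (LINT x:{-1..1}|lebesgue. of_real x * (A N + B N * of_real x))"
      unfolding set_integral_complex mult.left_commute[of "indicator _ _"]
      by (rule integral_cong_AE[OF borel_measurable_times[OF xm vm] borel_measurable_times[OF xm pm]]) (use ae in \<open>auto elim: eventually_mono\<close>)
    ultimately show ?thesis
      using interval_moments[of 1 "A N" "B N"] by (simp add: A_def B_def)
  qed
  define f0 where "f0 x = W x + (A 1 + B 1 * of_real x)" for x
  define f1 where "f1 x = W1 x + B 1" for x
  have "AE x in lebesgue. \<forall>n::nat. indicator {- real (Suc n)..real (Suc n)} x * (v x - (A (real (Suc n)) + B (real (Suc n)) * of_real x)) = 0"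
    unfolding AE_all_countable by (intro allI affine) simp
  then have "AE x in lebesgue. u x = f0 x"
  proof eventually_elim
    case (elim x)
    obtain n :: nat where "\<bar>x\<bar> \<le> real n" using real_arch_simple by blast
    then have "x \<in> {- real (Suc n)..real (Suc n)}" by auto
    then have "v x = A (real (Suc n)) + B (real (Suc n)) * of_real x" using elim[rule_format, of n] by simp
    then show ?case using A_B[of "real (Suc n)"] by (simp add: f0_def v_def algebra_simps)
  qed
  then have uf: "ae_eq u f0" by (simp add: ae_eq_def)
  have l0: "loc_ac_deriv f0 f1" and l1: "loc_ac_deriv f1 w"
  proof -
    have "loc_ac_deriv (\<lambda>x. A 1 + B 1 * of_real x) (\<lambda>x. B 1)" "loc_ac_deriv (\<lambda>x. B 1) (\<lambda>x. 0)"
      by (rule loc_ac_of_C1; auto intro!: continuous_intros derivative_eq_intros has_vector_derivative_real_field)+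
    from loc_ac_add[OF W this(1)] loc_ac_add[OF W1 this(2)]
    show "loc_ac_deriv f0 f1" "loc_ac_deriv f1 w" by (simp_all add: f0_def[abs_def] f1_def[abs_def])
  qed
  have gH: "ae_eq g (H_fun f0 w)"
    using uf unfolding ae_eq_def by eventually_elim (simp add: H_fun_def w_def)
  have "H_fun f0 w \<in> borel_measurable lebesgue" by (rule H_fun_measurable[OF l0 l1])
  then have "H_dom f0 f1 w"
    unfolding H_dom_def using l0 l1 L2_ae_eq[OF u uf loc_ac_measurable[OF l0]] L2_ae_eq[OF g gH] by blast
  then show ?thesis using uf gH by blast
qed

subsection \<open>The operator on the Hilbert space and its unitary group\<close>

definition l2_i :: "l2 \<Rightarrow> l2" where "l2_i u = l2_class (\<lambda>x. \<i> * l2_rep u x)"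

lemma l2_class_eqI: "f \<in> L2 \<Longrightarrow> g \<in> L2 \<Longrightarrow> ae_eq f g \<Longrightarrow> l2_class f = l2_class g"
  by (simp add: l2_class_eq_iff)

lemma l2_i_class: "f \<in> L2 \<Longrightarrow> l2_i (l2_class f) = l2_class (\<lambda>x. \<i> * f x)"
  unfolding l2_i_def using l2_rep_class[of f]
  by (intro l2_class_eqI L2_cmult) (auto simp: ae_eq_def elim: eventually_mono)

text \<open>Complex scalars act on the real space through \<open>l2_i\<close>; together with the
  commutation of the group and \<open>l2_i\<close> this gives the complex linearity of the
  evolution.\<close>

lemma l2_class_lincomb:
  assumes "f \<in> L2" "g \<in> L2"
  shows "l2_class (\<lambda>x. a * f x + b * g x)
    = (Re a *\<^sub>R l2_class f + Im a *\<^sub>R l2_i (l2_class f)) + (Re b *\<^sub>R l2_class g + Im b *\<^sub>R l2_i (l2_class g))"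
proof -
  have e: "a * f x + b * g x
      = (Re a *\<^sub>R f x + Im a *\<^sub>R (\<i> * f x)) + (Re b *\<^sub>R g x + Im b *\<^sub>R (\<i> * g x))" for x
    by (simp add: complex_eq_iff)
  show ?thesis
    unfolding e using assms by (simp add: l2_i_class l2_class_scaleR l2_class_add L2_cmult L2_scaleR L2_add)
qed

lemma l2_i_linear: "linear l2_i"
proof
  fix u v :: l2 and r :: real
  obtain f where f: "f \<in> L2" "u = l2_class f" by (rule l2_cases)
  obtain g where g: "g \<in> L2" "v = l2_class g" by (rule l2_cases)
  show "l2_i (u + v) = l2_i u + l2_i v" "l2_i (r *\<^sub>R u) = r *\<^sub>R l2_i u"
    using f g by (simp_all add: l2_i_class l2_class_add l2_class_scaleR L2_add L2_scaleR L2_cmult algebra_simps)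
qed

lemma l2_i_l2_i: "l2_i (l2_i u) = - u"
  by (rule l2_cases[of u]) (simp add: l2_i_class l2_class_uminus L2_cmult mult.assoc[symmetric])

lemma inner_l2_i: "inner (l2_i u) (l2_i v) = inner u v"
proof -
  obtain f where f: "f \<in> L2" "u = l2_class f" by (rule l2_cases)
  obtain g where g: "g \<in> L2" "v = l2_class g" by (rule l2_cases)
  have "\<i> * f x * cnj (\<i> * g x) = f x * cnj (g x)" for x by (simp add: algebra_simps)
  then show ?thesis using f g by (simp add: l2_i_class inner_l2_class L2_cmult)
qed

lemma l2_i_bounded_linear: "bounded_linear l2_i"
  using l2_i_linear
  by (intro bounded_linear_intro[where K = 1]) (auto simp: linear_add linear_scale norm_eq_sqrt_inner inner_l2_i)

definition H_rel :: "l2 \<Rightarrow> l2 \<Rightarrow> bool" where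
  "H_rel u v \<longleftrightarrow> (\<exists>f0 f1 f2. H_dom f0 f1 f2 \<and> u = l2_class f0 \<and> v = l2_class (H_fun f0 f2))"

definition H_core :: "l2 \<Rightarrow> l2 \<Rightarrow> bool" where
  "H_core u v \<longleftrightarrow> (\<exists>f0 f1 f2 N. H_dom f0 f1 f2 \<and> (\<forall>x. N \<le> \<bar>x\<bar> \<longrightarrow> f0 x = 0)
     \<and> u = l2_class f0 \<and> v = l2_class (H_fun f0 f2))"

lemma H_dom_cmult: "H_dom f0 f1 f2 \<Longrightarrow> H_dom (\<lambda>x. c * f0 x) (\<lambda>x. c * f1 x) (\<lambda>x. c * f2 x)"
  and H_fun_cmult: "H_fun (\<lambda>x. c * f0 x) (\<lambda>x. c * f2 x) = (\<lambda>x. c * H_fun f0 f2 x)"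
proof -
  show *: "H_fun (\<lambda>x. c * f0 x) (\<lambda>x. c * f2 x) = (\<lambda>x. c * H_fun f0 f2 x)" for f0 f2
    by (simp add: H_fun_def fun_eq_iff algebra_simps)
  show "H_dom f0 f1 f2 \<Longrightarrow> H_dom (\<lambda>x. c * f0 x) (\<lambda>x. c * f1 x) (\<lambda>x. c * f2 x)"
    unfolding H_dom_def * by (auto intro: loc_ac_cmult L2_cmult)
qed

text \<open>From left to right this is the symmetry of H; conversely, an element of the adjoint
  solves the equation weakly against compactly supported functions, and
  \<open>weak_imp_strong\<close> upgrades it. It is the form of self-adjointness that
  \<open>skew_adjoint_of_adjoint\<close> takes as input.\<close>

lemma H_rel_iff_adjoint: "H_rel u v \<longleftrightarrow> (\<forall>h k. H_core h k \<longrightarrow> inner u k = inner v h)"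
proof
  assume "H_rel u v"
  then obtain f0 f1 f2 where f: "H_dom f0 f1 f2" "u = l2_class f0" "v = l2_class (H_fun f0 f2)"
    by (auto simp: H_rel_def)
  show "\<forall>h k. H_core h k \<longrightarrow> inner u k = inner v h"
  proof (intro allI impI)
    fix h k assume "H_core h k"
    then obtain h0 h1 h2 where h: "H_dom h0 h1 h2" "h = l2_class h0" "k = l2_class (H_fun h0 h2)"
      by (auto simp: H_core_def)
    have "f0 \<in> L2" "H_fun f0 f2 \<in> L2" "h0 \<in> L2" "H_fun h0 h2 \<in> L2" using f(1) h(1) by (auto simp: H_dom_def)
    then show "inner u k = inner v h"
      using H_dom_symmetric[OF f(1) h(1)] f h by (simp add: inner_l2_class)
  qed
next
  assume weak: "\<forall>h k. H_core h k \<longrightarrow> inner u k = inner v h"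
  obtain f where f: "f \<in> L2" "u = l2_class f" by (rule l2_cases)
  obtain g where g: "g \<in> L2" "v = l2_class g" by (rule l2_cases)
  have "\<exists>f0 f1 f2. H_dom f0 f1 f2 \<and> ae_eq f f0 \<and> ae_eq g (H_fun f0 f2)"
  proof (rule weak_imp_strong[OF f(1) g(1)])
    fix h0 h1 h2 N assume h: "H_dom h0 h1 h2" "\<And>x. N \<le> \<bar>x\<bar> \<Longrightarrow> h0 x = 0"
    then have "H_core (l2_class h0) (l2_class (H_fun h0 h2))" unfolding H_core_def by blast
    then have "inner u (l2_class (H_fun h0 h2)) = inner v (l2_class h0)" using weak by blast
    moreover have "h0 \<in> L2" "H_fun h0 h2 \<in> L2" using h(1) by (auto simp: H_dom_def)
    ultimately show "Re (LINT x|lebesgue. f x * cnj (H_fun h0 h2 x)) = Re (LINT x|lebesgue. g x * cnj (h0 x))"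
      using f g by (simp add: inner_l2_class)
  qed
  then show "H_rel u v"
    unfolding H_rel_def using f g by (metis l2_class_eq_iff H_dom_def)
qed

text \<open>The representative f0 is continuous and vanishes almost everywhere, hence everywhere.
  Its derivatives then vanish by \<open>loc_ac_zero_deriv\<close>, the second only almost
  everywhere, which is enough for a class.\<close>

lemma H_rel_zero:
  assumes "H_rel 0 v"
  shows "v = 0"
proof -
  obtain f0 f1 f2 where f: "H_dom f0 f1 f2" "0 = l2_class f0" "v = l2_class (H_fun f0 f2)"
    using assms by (auto simp: H_rel_def)
  have l: "loc_ac_deriv f0 f1" "loc_ac_deriv f1 f2" and L2: "f0 \<in> L2" "H_fun f0 f2 \<in> L2"
    using f(1) by (auto simp: H_dom_def)
  have "ae_eq (\<lambda>x. 0) f0" using f(2) L2 L2_zero by (simp add: zero_l2_def l2_class_eq_iff)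
  then have "AE x in lebesgue. f0 x = 0" by (auto simp: ae_eq_def elim: eventually_mono)
  then have f0: "f0 = (\<lambda>x. 0)" using continuous_AE_zero[OF loc_ac_continuous[OF l(1)]] by blast
  then have f1: "f1 = (\<lambda>x. 0)"
    using continuous_AE_zero[OF loc_ac_continuous[OF l(2)]] loc_ac_zero_deriv[of f1] l(1) by blast
  have "AE x in lebesgue. f2 x = 0" using loc_ac_zero_deriv[of f2] l(2) unfolding f1 .
  then have "ae_eq (H_fun f0 f2) (\<lambda>x. 0)" unfolding ae_eq_def by eventually_elim (simp add: H_fun_def f0)
  then show ?thesis using f(3) L2 L2_zero by (simp add: zero_l2_def l2_class_eq_iff)
qed

interpretation H: skew_adjoint "\<lambda>u v. H_rel u (l2_i v)"
proof (rule skew_adjoint_of_adjoint[OF l2_i_linear l2_i_l2_i inner_l2_i H_rel_iff_adjoint])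
  show "H_core h k \<Longrightarrow> H_rel h k" for h k unfolding H_core_def H_rel_def by blast
  show "H_core (l2_i h) (l2_i k)" if hk: "H_core h k" for h k
  proof -
    obtain f0 f1 f2 N where f: "H_dom f0 f1 f2" "\<forall>x. N \<le> \<bar>x\<bar> \<longrightarrow> f0 x = 0"
      "h = l2_class f0" "k = l2_class (H_fun f0 f2)"
      using hk unfolding H_core_def by blast
    then have "f0 \<in> L2" "H_fun f0 f2 \<in> L2" by (auto simp: H_dom_def)
    then have "l2_i h = l2_class (\<lambda>x. \<i> * f0 x)" "l2_i k = l2_class (H_fun (\<lambda>x. \<i> * f0 x) (\<lambda>x. \<i> * f2 x))"
      using f by (simp_all add: l2_i_class H_fun_cmult)
    then show ?thesis
      unfolding H_core_def using H_dom_cmult[OF f(1), of "\<i>"] f(2) by (metis mult_zero_right)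
  qed
  show "inner f g' = inner g f'" if fg: "H_rel f g" "H_rel f' g'" for f g f' g'
  proof -
    obtain f0 f1 f2 where f: "H_dom f0 f1 f2" "f = l2_class f0" "g = l2_class (H_fun f0 f2)"
      using fg(1) by (auto simp: H_rel_def)
    obtain h0 h1 h2 where h: "H_dom h0 h1 h2" "f' = l2_class h0" "g' = l2_class (H_fun h0 h2)"
      using fg(2) by (auto simp: H_rel_def)
    have "f0 \<in> L2" "H_fun f0 f2 \<in> L2" "h0 \<in> L2" "H_fun h0 h2 \<in> L2" using f(1) h(1) by (auto simp: H_dom_def)
    then show ?thesis using H_dom_symmetric[OF f(1) h(1)] f h by (simp add: inner_l2_class)
  qed
qed (rule H_rel_zero)

lemma H_rel_minus_l2_i: "H_rel u (l2_i (- l2_i v)) \<longleftrightarrow> H_rel u v"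
  by (simp add: linear_neg[OF l2_i_linear] l2_i_l2_i)

lemma H_graph_iff: "f \<in> L2 \<Longrightarrow> g \<in> L2 \<Longrightarrow> H_graph f g \<longleftrightarrow> H_rel (l2_class f) (l2_class g)"
proof
  assume fg: "f \<in> L2" "g \<in> L2" "H_graph f g"
  then obtain f0 f1 f2 where f: "ae_eq f f0" "loc_ac_deriv f0 f1" "loc_ac_deriv f1 f2" "ae_eq g (H_fun f0 f2)"
    unfolding H_graph_def H_fun_def[abs_def] by blast
  have "f0 \<in> L2" "H_fun f0 f2 \<in> L2"
    using L2_ae_eq[OF fg(1) f(1) loc_ac_measurable[OF f(2)]] L2_ae_eq[OF fg(2) f(4) H_fun_measurable[OF f(2,3)]] .
  then show "H_rel (l2_class f) (l2_class g)"
    unfolding H_rel_def H_dom_def using f fg by (metis l2_class_eq_iff)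
next
  assume fg: "f \<in> L2" "g \<in> L2" "H_rel (l2_class f) (l2_class g)"
  then obtain f0 f1 f2 where f: "H_dom f0 f1 f2" "l2_class f = l2_class f0" "l2_class g = l2_class (H_fun f0 f2)"
    unfolding H_rel_def by blast
  then have "f0 \<in> L2" "H_fun f0 f2 \<in> L2" by (auto simp: H_dom_def)
  then have "ae_eq f f0" "ae_eq g (H_fun f0 f2)" using f fg by (simp_all add: l2_class_eq_iff)
  then show "H_graph f g"
    using fg f(1) unfolding H_graph_def H_fun_def[abs_def] H_dom_def by blast
qed

text \<open>A representative of the evolved class: its values are meaningful only up to null sets,
  and even \<open>evol 0 f\<close> need not equal f pointwise.\<close>

definition evol :: "real \<Rightarrow> (real \<Rightarrow> complex) \<Rightarrow> real \<Rightarrow> complex" where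
  "evol t f = l2_rep (H.group t (l2_class f))"

lemma evol_L2 [simp]: "evol t f \<in> L2" by (simp add: evol_def)

lemma l2_class_evol: "l2_class (evol t f) = H.group t (l2_class f)" by (simp add: evol_def)

lemma group_l2_i: "H.group t (l2_i u) = l2_i (H.group t u)"
proof (rule H.group_commute[OF l2_i_bounded_linear])
  fix x x' assume "H_rel x (l2_i x')"
  then obtain f0 f1 f2 where f: "H_dom f0 f1 f2" "x = l2_class f0" "l2_i x' = l2_class (H_fun f0 f2)"
    by (auto simp: H_rel_def)
  then have "f0 \<in> L2" "H_fun f0 f2 \<in> L2" by (auto simp: H_dom_def)
  then have "l2_i x = l2_class (\<lambda>x. \<i> * f0 x)" "l2_i (l2_i x') = l2_class (H_fun (\<lambda>x. \<i> * f0 x) (\<lambda>x. \<i> * f2 x))"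
    using f by (simp_all add: l2_i_class H_fun_cmult)
  then show "H_rel (l2_i x) (l2_i (l2_i x'))"
    unfolding H_rel_def using H_dom_cmult[OF f(1), of "\<i>"] by blast
qed

lemma ae_eq_evol_iff: "g \<in> L2 \<Longrightarrow> ae_eq (evol t f) g \<longleftrightarrow> H.group t (l2_class f) = l2_class g"
  by (metis l2_class_eq_iff l2_class_evol evol_L2)

lemma unitary_group_evol: "unitary_group evol"
  unfolding unitary_group_def
proof (intro conjI allI ballI impI)
  note lin = linear_add[OF H.group_linear] linear_scale[OF H.group_linear]
  fix t s :: real and a b :: complex and f g assume f: "f \<in> L2"
  show "evol t f \<in> L2" by simp
  show "L2_norm (evol t f) = L2_norm f"
    using f by (metis H.norm_group l2_class_evol norm_l2_class evol_L2)
  show "ae_eq (evol 0 f) f" using f by (simp add: ae_eq_evol_iff)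
  show "ae_eq (evol (s + t) f) (evol s (evol t f))"
    by (simp add: ae_eq_evol_iff l2_class_evol H.group_add)
  assume g: "g \<in> L2"
  show "ae_eq (evol t f) (evol t g)" if "ae_eq f g"
    using that f g by (simp add: ae_eq_evol_iff l2_class_evol) (metis l2_class_eq_iff)
  show "ae_eq (evol t (\<lambda>x. a * f x + b * g x)) (\<lambda>x. a * evol t f x + b * evol t g x)"
    using f g by (subst ae_eq_evol_iff) (simp_all add: L2_add L2_cmult l2_class_lincomb l2_class_evol lin group_l2_i)
next
  fix f assume f: "f \<in> L2"
  have "L2_norm (\<lambda>x. evol t f x - f x) = norm (H.group t (l2_class f) - l2_class f)" for t
    using f by (simp add: l2_class_evol[symmetric] l2_class_diff norm_l2_class L2_diff)
  then show "((\<lambda>t. L2_norm (\<lambda>x. evol t f x - f x)) \<longlongrightarrow> 0) (at 0)"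
    using tendsto_norm_zero[OF LIM_zero[OF H.group_continuous[of "l2_class f"]]] by simp
qed

text \<open>This is \<open>generator_iff\<close> for B = -iH, transported to representatives:
  convergence of the \<open>L2_norm\<close> of the difference quotients is norm convergence in
  \<open>l2\<close>.\<close>

theorem exp_minus_i_evol: "exp_minus_i H_graph evol"
  unfolding exp_minus_i_def
proof (intro conjI ballI unitary_group_evol)
  fix f g assume f: "f \<in> L2" and g: "g \<in> L2"
  have "L2_norm (\<lambda>x. (evol h f x - f x) / complex_of_real h - (- \<i> * g x))
      = norm ((1/h) *\<^sub>R (H.group h (l2_class f) - l2_class f) - (- l2_i (l2_class g)))" for h
  proof -
    have "(1/h) *\<^sub>R (H.group h (l2_class f) - l2_class f) - (- l2_i (l2_class g))
        = l2_class (\<lambda>x. (1/h) *\<^sub>R (evol h f x - f x) - (- (\<i> * g x)))"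
      using f g by (simp add: l2_class_evol[symmetric] l2_i_class l2_class_diff l2_class_uminus l2_class_scaleR l2_class_add
        L2_diff L2_scaleR L2_cmult L2_minus L2_add)
    also have "norm \<dots> = L2_norm (\<lambda>x. (1/h) *\<^sub>R (evol h f x - f x) - (- (\<i> * g x)))"
      using f g by (intro norm_l2_class L2_diff L2_scaleR L2_cmult L2_minus evol_L2)
    also have "(\<lambda>x. (1/h) *\<^sub>R (evol h f x - f x) - (- (\<i> * g x))) = (\<lambda>x. (evol h f x - f x) / complex_of_real h - (- \<i> * g x))"
      by (simp add: fun_eq_iff scaleR_conv_of_real divide_inverse mult.commute)
    finally show ?thesis by simp
  qed
  then have "((\<lambda>h. L2_norm (\<lambda>x. (evol h f x - f x) / complex_of_real h - (- \<i> * g x))) \<longlongrightarrow> 0) (at 0)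
      \<longleftrightarrow> ((\<lambda>h. (1/h) *\<^sub>R (H.group h (l2_class f) - l2_class f) - (- l2_i (l2_class g))) \<longlongrightarrow> 0) (at 0)"
    by (simp only: tendsto_norm_zero_iff)
  also have "\<dots> \<longleftrightarrow> ((\<lambda>h. (1/h) *\<^sub>R (H.group h (l2_class f) - l2_class f)) \<longlongrightarrow> - l2_i (l2_class g)) (at 0)"
    by (rule LIM_zero_iff)
  also have "\<dots> \<longleftrightarrow> H_graph f g"
    unfolding H.generator_iff H_rel_minus_l2_i H_graph_iff[OF f g] ..
  finally show "H_graph f g \<longleftrightarrow> ((\<lambda>h. L2_norm (\<lambda>x. (evol h f x - f x) / complex_of_real h - (- \<i> * g x))) \<longlongrightarrow> 0) (at 0)" ..
qed

subsection \<open>Weighted norms along the flow\<close>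

text \<open>For a bounded measurable weight this is a bounded self-adjoint operator, so the
  quadratic form (w u, u) can be differentiated along the flow by the product rule.\<close>

definition l2_mult :: "(real \<Rightarrow> real) \<Rightarrow> l2 \<Rightarrow> l2" where
  "l2_mult w u = l2_class (\<lambda>x. complex_of_real (w x) * l2_rep u x)"

context
  fixes w :: "real \<Rightarrow> real" and M :: real
  assumes w_meas: "(\<lambda>x. complex_of_real (w x)) \<in> borel_measurable lebesgue" and w_bd: "\<And>x. \<bar>w x\<bar> \<le> M"
begin

lemma L2_weight: "f \<in> L2 \<Longrightarrow> (\<lambda>x. complex_of_real (w x) * f x) \<in> L2"
  by (rule L2_bounded_mult[where M = M]) (use w_meas w_bd in auto)

lemma l2_mult_class: "f \<in> L2 \<Longrightarrow> l2_mult w (l2_class f) = l2_class (\<lambda>x. complex_of_real (w x) * f x)"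
  unfolding l2_mult_def using l2_rep_class[of f]
  by (intro l2_class_eqI L2_weight) (auto simp: ae_eq_def elim: eventually_mono)

lemma l2_mult_bounded_linear: "bounded_linear (l2_mult w)"
proof (rule bounded_linear_intro[where K = M])
  fix u v :: l2 and r :: real
  obtain f where f: "f \<in> L2" "u = l2_class f" by (rule l2_cases)
  obtain g where g: "g \<in> L2" "v = l2_class g" by (rule l2_cases)
  show "l2_mult w (u + v) = l2_mult w u + l2_mult w v" "l2_mult w (r *\<^sub>R u) = r *\<^sub>R l2_mult w u"
    using f g by (simp_all add: l2_mult_class l2_class_add l2_class_scaleR L2_add L2_scaleR L2_weight distrib_left)
  have M: "0 \<le> M" using w_bd[of 0] by linarith
  have "(norm (l2_mult w u))\<^sup>2 \<le> M\<^sup>2 * (norm u)\<^sup>2"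
  proof -
    have "(LINT x|lebesgue. (cmod (complex_of_real (w x) * f x))\<^sup>2) \<le> (LINT x|lebesgue. M\<^sup>2 * (cmod (f x))\<^sup>2)"
    proof (rule integral_mono)
      show "(cmod (complex_of_real (w x) * f x))\<^sup>2 \<le> M\<^sup>2 * (cmod (f x))\<^sup>2" for x
        using power_mono[OF w_bd[of x], of 2] by (simp add: norm_mult power_mult_distrib mult_right_mono)
    qed (use f L2_weight in \<open>auto intro: L2_sq_integrable\<close>)
    then show ?thesis using f by (simp add: l2_mult_class norm_l2_class_sq L2_weight)
  qed
  then have "(norm (l2_mult w u))\<^sup>2 \<le> (M * norm u)\<^sup>2" by (simp add: power_mult_distrib)
  then have "norm (l2_mult w u) \<le> M * norm u" by (rule power2_le_imp_le) (simp add: M)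
  then show "norm (l2_mult w u) \<le> norm u * M" by (simp add: mult.commute)
qed

lemma inner_l2_mult: "f \<in> L2 \<Longrightarrow> g \<in> L2 \<Longrightarrow>
    inner (l2_mult w (l2_class f)) (l2_class g) = Re (LINT x|lebesgue. complex_of_real (w x) * (f x * cnj (g x)))"
  by (simp add: l2_mult_class inner_l2_class L2_weight mult.assoc)

lemma inner_l2_mult_commute: "inner (l2_mult w u) v = inner u (l2_mult w v)"
proof -
  obtain f where f: "f \<in> L2" "u = l2_class f" by (rule l2_cases)
  obtain g where g: "g \<in> L2" "v = l2_class g" by (rule l2_cases)
  have eq: "complex_of_real (w x) * f x * cnj (g x) = f x * cnj (complex_of_real (w x) * g x)" for x by simp
  show ?thesis using f g by (simp only: l2_mult_class inner_l2_class L2_weight eq)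
qed

lemma inner_l2_mult_self: "f \<in> L2 \<Longrightarrow> inner (l2_mult w (l2_class f)) (l2_class f) = (LINT x|lebesgue. w x * (cmod (f x))\<^sup>2)"
proof -
  assume f: "f \<in> L2"
  have "(LINT x|lebesgue. complex_of_real (w x) * (f x * cnj (f x))) = (LINT x|lebesgue. complex_of_real (w x * (cmod (f x))\<^sup>2))"
    unfolding mult_cnj_self by simp
  then show ?thesis using f by (simp add: inner_l2_mult del: of_real_mult of_real_power)
qed

text \<open>With g = H f the left side pairs w f with the velocity -i H f, so it is half the rate of
  change of the weighted mass. Only the imaginary part of the integral of w (H f) cnj f
  counts.\<close>

lemma inner_l2_mult_deriv:
  assumes "f \<in> L2" "g \<in> L2"
  shows "inner (l2_mult w (l2_class f)) (- l2_i (l2_class g)) = Im (LINT x|lebesgue. complex_of_real (w x) * (g x * cnj (f x)))"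
proof -
  have "complex_of_real (w x) * (f x * cnj (\<i> * g x)) = cnj (\<i> * (complex_of_real (w x) * (g x * cnj (f x))))" for x
    by simp
  then have "(LINT x|lebesgue. complex_of_real (w x) * (f x * cnj (\<i> * g x)))
      = cnj (\<i> * (LINT x|lebesgue. complex_of_real (w x) * (g x * cnj (f x))))"
    by (simp only: Bochner_Integration.integral_cnj integral_mult_right_zero)
  then show ?thesis using assms by (simp add: l2_i_class inner_l2_mult L2_cmult del: complex_cnj_mult)
qed

end

text \<open>Polarisation of norm conservation. Applied to H u and u it is the conservation of
  energy.\<close>

lemma inner_group: "inner (H.group t u) (H.group t v) = inner u v"
proof -
  have "(norm (H.group t (u + v)))\<^sup>2 = (norm (u + v))\<^sup>2" by simp
  then have "inner (H.group t u + H.group t v) (H.group t u + H.group t v) = inner (u + v) (u + v)"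
    unfolding power2_norm_eq_inner linear_add[OF H.group_linear] .
  moreover have "inner (H.group t x) (H.group t x) = inner x x" for x
    using H.norm_group[of t x] by (simp flip: power2_norm_eq_inner)
  ultimately show ?thesis by (simp add: inner_add inner_commute)
qed

section \<open>Domain data along the flow: spreading and kinetic energy\<close>

lemma H_rel_deriv:
  assumes h: "H_dom h0 h1 h2"
  shows "H_rel (l2_class h0) (l2_i (- l2_i (l2_class (H_fun h0 h2))))"
  unfolding H_rel_minus_l2_i unfolding H_rel_def using h by blast

text \<open>The domain is invariant and H commutes with the group, so at every time there is a
  continuous representative with derivatives, and H of it is the evolved H of the datum.\<close>

lemma flow_H_dom:
  assumes h: "H_dom h0 h1 h2"
  shows "\<exists>f0 f1 f2. H_dom f0 f1 f2 \<and> H.group t (l2_class h0) = l2_class f0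
    \<and> H.group t (l2_class (H_fun h0 h2)) = l2_class (H_fun f0 f2)"
proof -
  have "H_rel (H.group t (l2_class h0)) (l2_i (H.group t (- l2_i (l2_class (H_fun h0 h2)))))"
    by (rule H.group_invariant[OF H_rel_deriv[OF h]])
  then have "H_rel (H.group t (l2_class h0)) (H.group t (l2_class (H_fun h0 h2)))"
    by (simp add: linear_neg[OF H.group_linear] group_l2_i H_rel_minus_l2_i)
  then show ?thesis unfolding H_rel_def by metis
qed

text \<open>Lipschitz constant 1 controls the flux, and the value L outside [c - L, c + L] measures
  the escaped mass. With c = 0 it also serves as a truncated potential.\<close>

definition weight :: "real \<Rightarrow> real \<Rightarrow> real \<Rightarrow> real" where
  "weight c L x = min \<bar>x - c\<bar> L"

definition weight' :: "real \<Rightarrow> real \<Rightarrow> real \<Rightarrow> real" where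
  "weight' c L x = (if \<bar>x - c\<bar> < L then sgn (x - c) else 0)"

lemma loc_ac_weight:
  assumes L: "L > 0"
  shows "loc_ac_deriv (\<lambda>x. of_real (weight c L x)) (\<lambda>x. of_real (weight' c L x))"
proof (rule loc_ac_of_derivative[where S = "{c - L, c, c + L}"])
  show "continuous_on UNIV (\<lambda>x. complex_of_real (weight c L x))"
    unfolding weight_def by (intro continuous_intros)
  show "(\<lambda>x. complex_of_real (weight' c L x)) \<in> borel_measurable borel"
    unfolding weight'_def by measurable
  show "\<exists>M. \<forall>x\<in>{a..b}. cmod (complex_of_real (weight' c L x)) \<le> M" for a b
    by (rule exI[of _ 1]) (auto simp: weight'_def sgn_if)
  fix x assume x: "x \<notin> {c - L, c, c + L}"
  have "(weight c L has_real_derivative weight' c L x) (at x)"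
  proof -
    consider "x < c - L" | "c - L < x" "x < c" | "c < x" "x < c + L" | "c + L < x"
      using x by atomize_elim (simp, arith)
    then show ?thesis
    proof cases
      case 1
      then have *: "weight' c L x = 0" by (simp add: weight'_def)
      have "((\<lambda>x. L) has_real_derivative 0) (at x)" by (auto intro!: derivative_eq_intros)
      then show ?thesis
        unfolding * by (rule has_field_derivative_transform_within_open[where S = "{..<c - L}"])
          (use 1 L in \<open>auto simp: weight_def\<close>)
    next
      case 2
      then have *: "weight' c L x = - 1" by (simp add: weight'_def)
      have "((\<lambda>x. c - x) has_real_derivative - 1) (at x)" by (auto intro!: derivative_eq_intros)
      then show ?thesis
        unfolding * by (rule has_field_derivative_transform_within_open[where S = "{c - L<..<c}"])
          (use 2 L in \<open>auto simp: weight_def\<close>)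
    next
      case 3
      then have *: "weight' c L x = 1" by (simp add: weight'_def)
      have "((\<lambda>x. x - c) has_real_derivative 1) (at x)" by (auto intro!: derivative_eq_intros)
      then show ?thesis
        unfolding * by (rule has_field_derivative_transform_within_open[where S = "{c<..<c + L}"])
          (use 3 L in \<open>auto simp: weight_def\<close>)
    next
      case 4
      then have *: "weight' c L x = 0" by (simp add: weight'_def)
      have "((\<lambda>x. L) has_real_derivative 0) (at x)" by (auto intro!: derivative_eq_intros)
      then show ?thesis
        unfolding * by (rule has_field_derivative_transform_within_open[where S = "{c + L<..}"])
          (use 4 L in \<open>auto simp: weight_def\<close>)
    qed
  qed
  then show "((\<lambda>x. complex_of_real (weight c L x)) has_vector_derivative complex_of_real (weight' c L x)) (at x)"
    by (intro has_vector_derivative_of_real) (simp add: has_real_derivative_iff_has_vector_derivative)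
qed simp

lemma weight_bound: "L > 0 \<Longrightarrow> \<bar>weight c L x\<bar> \<le> L" and weight_nonneg: "L > 0 \<Longrightarrow> 0 \<le> weight c L x"
  and weight'_bound: "\<bar>weight' c L x\<bar> \<le> 1"
  by (auto simp: weight_def weight'_def sgn_if)

lemma weight_measurable: "(\<lambda>x. complex_of_real (weight c L x)) \<in> borel_measurable lebesgue"
  unfolding weight_def by (intro cont_measurable_lebesgue continuous_intros)

lemma weight_integrable: "L > 0 \<Longrightarrow> f \<in> L2 \<Longrightarrow> integrable lebesgue (\<lambda>x. weight c L x * (cmod (f x))\<^sup>2)"
proof -
  assume L: "L > 0" and f: "f \<in> L2"
  have "integrable lebesgue (\<lambda>x. complex_of_real (weight c L x) * (f x * cnj (f x)))"
    by (rule integrable_bounded_mult[where M = L])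
      (use f L in \<open>auto simp: L2_mult_cnj_integrable weight_measurable weight_bound\<close>)
  from integrable_Re[OF this] show ?thesis unfolding mult_cnj_self by (simp del: of_real_power)
qed

text \<open>The weighted mass has derivative 2 (w u, -i H u), which \<open>H_dom_weight_flux\<close>
  bounds by kinetic energy and mass; the mean value inequality on [0,T] does the rest. The resulting
  rate contains neither c nor L.\<close>

lemma weight_flow_bound:
  assumes h: "H_dom h0 h1 h2" and L: "L > 0" and s: "s > 0" and T: "0 \<le> T"
    and f: "\<And>t. H_dom (f0 t) (f1 t) (f2 t)" "\<And>t. H.group t (l2_class h0) = l2_class (f0 t)"
      "\<And>t. H.group t (l2_class (H_fun h0 h2)) = l2_class (H_fun (f0 t) (f2 t))"
    and K: "\<And>t. 0 \<le> t \<Longrightarrow> t \<le> T \<Longrightarrow> (LINT x|lebesgue. (cmod (f1 t x))\<^sup>2) \<le> K"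
  shows "\<bar>(LINT x|lebesgue. weight c L x * (cmod (f0 T x))\<^sup>2) - (LINT x|lebesgue. weight c L x * (cmod (h0 x))\<^sup>2)\<bar>
    \<le> T * (K / s + s * (norm (l2_class h0))\<^sup>2)"
proof -
  define W where "W = l2_mult (weight c L)"
  note w = weight_measurable[of c L] weight_bound[OF L, of c]
  define u where "u t = H.group t (l2_class h0)" for t
  define v where "v t = - l2_i (l2_class (H_fun (f0 t) (f2 t)))" for t
  have L2: "f0 t \<in> L2" "H_fun (f0 t) (f2 t) \<in> L2" for t using f(1)[of t] by (auto simp: H_dom_def)
  have hL2: "h0 \<in> L2" using h by (auto simp: H_dom_def)
  have u: "(u has_vector_derivative v t) (at t)" for t
  proof -
    have "H.group t (- l2_i (l2_class (H_fun h0 h2))) = v t"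
      by (simp add: v_def linear_neg[OF H.group_linear] group_l2_i f(3))
    then show ?thesis
      unfolding u_def using H.group_has_vector_derivative[OF H_rel_deriv[OF h], of t] by simp
  qed
  define Q where "Q t = inner (W (u t)) (u t)" for t
  have Q: "(Q has_vector_derivative 2 * inner (W (u t)) (v t)) (at t)" for t
  proof -
    have "((\<lambda>t. W (u t)) has_vector_derivative W (v t)) (at t)"
      unfolding W_def by (rule bounded_linear.has_vector_derivative[OF l2_mult_bounded_linear[OF w] u])
    from bounded_bilinear.has_vector_derivative[OF bounded_bilinear_inner this u]
    show ?thesis
      unfolding Q_def using inner_l2_mult_commute[OF w, of "v t" "u t"] by (simp add: W_def inner_commute)
  qed
  have bound: "\<bar>2 * inner (W (u t)) (v t)\<bar> \<le> K / s + s * (norm (l2_class h0))\<^sup>2" if t: "0 \<le> t" "t \<le> T" for t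
  proof -
    have N: "(LINT x|lebesgue. (cmod (f0 t x))\<^sup>2) = (norm (l2_class h0))\<^sup>2"
      using H.norm_group[of t "l2_class h0"] f(2)[of t] L2 by (simp flip: norm_l2_class_sq)
    have "\<bar>2 * inner (W (u t)) (v t)\<bar>
        = 2 * \<bar>Im (LINT x|lebesgue. of_real (weight c L x) * (H_fun (f0 t) (f2 t) x * cnj (f0 t x)))\<bar>"
      unfolding W_def u_def v_def f(2) inner_l2_mult_deriv[OF w L2] by simp
    also have "\<dots> \<le> (LINT x|lebesgue. (cmod (f1 t x))\<^sup>2) / s + s * (LINT x|lebesgue. (cmod (f0 t x))\<^sup>2)"
      by (rule H_dom_weight_flux[OF f(1) loc_ac_weight[OF L] weight_bound[OF L] weight'_bound s])
    also have "\<dots> \<le> K / s + s * (norm (l2_class h0))\<^sup>2"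
      unfolding N using K[OF t] s by (intro add_mono divide_right_mono) auto
    finally show ?thesis .
  qed
  have "norm (Q T - Q 0) \<le> (K / s + s * (norm (l2_class h0))\<^sup>2) * norm (T - 0)"
  proof (rule differentiable_bound[where S = "{0..T}" and f' = "\<lambda>t d. d * (2 * inner (W (u t)) (v t))"])
    fix t assume t: "t \<in> {0..T}"
    show "(Q has_derivative (\<lambda>d. d * (2 * inner (W (u t)) (v t)))) (at t within {0..T})"
      using Q[of t] by (simp add: has_vector_derivative_def has_derivative_at_withinI)
    have "\<bar>2 * inner (W (u t)) (v t)\<bar> \<le> K / s + s * (norm (l2_class h0))\<^sup>2" using bound t by simp
    then show "onorm (\<lambda>d. d * (2 * inner (W (u t)) (v t))) \<le> K / s + s * (norm (l2_class h0))\<^sup>2"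
      by (intro onorm_le) (auto simp: abs_mult mult.commute[of _ "\<bar>_\<bar>"] intro!: mult_left_mono)
  qed (use T in auto)
  moreover have "Q T = (LINT x|lebesgue. weight c L x * (cmod (f0 T x))\<^sup>2)"
    unfolding Q_def W_def u_def f(2) by (rule inner_l2_mult_self[OF w L2(1)])
  moreover have "Q 0 = (LINT x|lebesgue. weight c L x * (cmod (h0 x))\<^sup>2)"
    unfolding Q_def W_def u_def using inner_l2_mult_self[OF w hL2] by simp
  ultimately show ?thesis using T by (simp add: mult.commute)
qed

lemma H_dom_kinetic_integrable: "H_dom f0 f1 f2 \<Longrightarrow> integrable lebesgue (\<lambda>x. (cmod (f1 x))\<^sup>2)"
  by (rule L2_sq_integrable[OF H_dom_deriv_L2])

lemma H_dom_potential_integrable: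
  assumes "H_dom f0 f1 f2"
  shows "integrable lebesgue (\<lambda>x. \<bar>x\<bar> * (cmod (f0 x))\<^sup>2)"
  using Bochner_Integration.integrable_diff[OF H_dom_energy_integrable[OF assms] H_dom_kinetic_integrable[OF assms]]
  by (simp add: energy_density_def)

lemma H_dom_energy_split:
  assumes "H_dom f0 f1 f2"
  shows "inner (l2_class (H_fun f0 f2)) (l2_class f0)
    = (LINT x|lebesgue. (cmod (f1 x))\<^sup>2) + (LINT x|lebesgue. \<bar>x\<bar> * (cmod (f0 x))\<^sup>2)"
proof -
  have "f0 \<in> L2" "H_fun f0 f2 \<in> L2" using assms by (auto simp: H_dom_def)
  then show ?thesis
    using H_dom_energy[OF assms] H_dom_kinetic_integrable[OF assms] H_dom_potential_integrable[OF assms]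
    by (simp add: inner_l2_class energy_density_def)
qed

text \<open>The kinetic energy grows by at most the loss of potential energy, whose rate of change is
  bounded by the force 1; in particular the bound does not depend on the location of the initial datum.\<close>

lemma kinetic_bound:
  assumes h: "H_dom h0 h1 h2" and M: "M > 0" "\<And>x. M \<le> \<bar>x\<bar> \<Longrightarrow> h0 x = 0" and T: "0 < T"
    and f: "\<And>t. H_dom (f0 t) (f1 t) (f2 t)" "\<And>t. H.group t (l2_class h0) = l2_class (f0 t)"
      "\<And>t. H.group t (l2_class (H_fun h0 h2)) = l2_class (H_fun (f0 t) (f2 t))"
    and t: "0 \<le> t" "t \<le> T"
  shows "(LINT x|lebesgue. (cmod (f1 t x))\<^sup>2) \<le> 2 * (LINT x|lebesgue. (cmod (h1 x))\<^sup>2) + 4 * T\<^sup>2 * (norm (l2_class h0))\<^sup>2"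
proof -
  define K where "K t = (LINT x|lebesgue. (cmod (f1 t x))\<^sup>2)" for t
  define P where "P t = (LINT x|lebesgue. \<bar>x\<bar> * (cmod (f0 t x))\<^sup>2)" for t
  define K0 where "K0 = (LINT x|lebesgue. (cmod (h1 x))\<^sup>2)"
  define P0 where "P0 = (LINT x|lebesgue. \<bar>x\<bar> * (cmod (h0 x))\<^sup>2)"
  define N where "N = (norm (l2_class h0))\<^sup>2"
  have energy: "K t + P t = K0 + P0" for t
    using H_dom_energy_split[OF f(1)[of t]] H_dom_energy_split[OF h] inner_group[of t "l2_class (H_fun h0 h2)" "l2_class h0"]
    unfolding K_def P_def K0_def P0_def f(2,3) by simp
  have P_nonneg: "P t \<ge> 0" for t unfolding P_def by (rule Bochner_Integration.integral_nonneg) simp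
  have K_le: "K t \<le> K0 + P0" for t using energy[of t] P_nonneg[of t] by simp
  \<comment> \<open>The total energy bounds the kinetic energy, though by a quantity that grows with
    the distance of the datum from 0. It only serves to make the supremum finite, so that half of it
    can be absorbed below.\<close>
  have bdd: "bdd_above (K ` {0..T})" using K_le by (intro bdd_aboveI[of _ "K0 + P0"]) auto
  define \<kappa> where "\<kappa> = (SUP t\<in>{0..T}. K t)"
  have K_\<kappa>: "K t \<le> \<kappa>" if "0 \<le> t" "t \<le> T" for t
    unfolding \<kappa>_def using that by (intro cSUP_upper bdd) auto
  have "0 \<le> K 0" unfolding K_def by (rule Bochner_Integration.integral_nonneg) simp
  then have \<kappa>_nonneg: "0 \<le> \<kappa>" using K_\<kappa>[of 0] T by linarith
  have step: "K t \<le> K0 + \<kappa> / 2 + 2 * T\<^sup>2 * N" if t: "0 \<le> t" "t \<le> T" for t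
  proof -
    have hL2: "h0 \<in> L2" and fL2: "f0 t \<in> L2" using h f(1)[of t] by (auto simp: H_dom_def)
    \<comment> \<open>The truncated potential lies below |x| and equals it wherever h0 is nonzero.
      The loss P0 - P t is therefore at most the change of the weighted mass.\<close>
    have "(LINT x|lebesgue. weight 0 M x * (cmod (f0 t x))\<^sup>2) \<le> P t"
      unfolding P_def
      by (intro integral_mono weight_integrable M fL2 H_dom_potential_integrable[OF f(1)[of t]] mult_right_mono)
        (auto simp: weight_def)
    moreover have "P0 = (LINT x|lebesgue. weight 0 M x * (cmod (h0 x))\<^sup>2)"
      unfolding P0_def
    proof (rule Bochner_Integration.integral_cong)
      fix x show "\<bar>x\<bar> * (cmod (h0 x))\<^sup>2 = weight 0 M x * (cmod (h0 x))\<^sup>2"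
        using M(2)[of x] by (cases "M \<le> \<bar>x\<bar>") (auto simp: weight_def)
    qed simp
    \<comment> \<open>The flux bound with s = 2 T: over a time of at most T the kinetic part
      contributes at most \<kappa> / 2, which the left side can absorb.\<close>
    moreover have "\<bar>(LINT x|lebesgue. weight 0 M x * (cmod (f0 t x))\<^sup>2) - (LINT x|lebesgue. weight 0 M x * (cmod (h0 x))\<^sup>2)\<bar>
        \<le> t * (\<kappa> / (2 * T) + 2 * T * N)"
      unfolding N_def
      by (rule weight_flow_bound[OF h M(1) _ t(1) f]) (use T t K_\<kappa> in \<open>auto simp: K_def\<close>)
    moreover have "t * (\<kappa> / (2 * T) + 2 * T * N) \<le> T * (\<kappa> / (2 * T) + 2 * T * N)"
      using t T \<kappa>_nonneg by (intro mult_right_mono add_nonneg_nonneg) (auto simp: N_def)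
    moreover have "T * (\<kappa> / (2 * T) + 2 * T * N) = \<kappa> / 2 + 2 * T\<^sup>2 * N"
      using T by (simp add: field_simps power2_eq_square)
    ultimately show ?thesis using energy[of t] by linarith
  qed
  have "\<kappa> \<le> K0 + \<kappa> / 2 + 2 * T\<^sup>2 * N"
    unfolding \<kappa>_def by (rule cSUP_least) (use T step[unfolded \<kappa>_def] in auto)
  then have "\<kappa> \<le> 2 * K0 + 4 * T\<^sup>2 * N" by simp
  then show ?thesis using K_\<kappa>[OF t] by (simp add: K_def K0_def N_def)
qed

text \<open>Outside [c - L, c + L] the weight is L, so the mass there is at most the weighted mass
  divided by L (Chebyshev). Inside, |f0|^2 is bounded by \<open>H_dom_sup_bound\<close> and only the
  measure of E counts.\<close>

lemma localized_mass_bound: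
  assumes f: "H_dom f0 f1 f2" and L: "L > 0" and E: "E \<in> sets lebesgue"
  shows "(LINT x:E|lebesgue. (cmod (f0 x))\<^sup>2)
    \<le> (LINT x|lebesgue. weight c L x * (cmod (f0 x))\<^sup>2) / L
      + (2 * (LINT x|lebesgue. (cmod (f0 x))\<^sup>2) + (LINT x|lebesgue. (cmod (f1 x))\<^sup>2)) * measure lebesgue (E \<inter> {c - L..c + L})"
proof -
  define S where "S = 2 * (LINT x|lebesgue. (cmod (f0 x))\<^sup>2) + (LINT x|lebesgue. (cmod (f1 x))\<^sup>2)"
  have S: "(cmod (f0 x))\<^sup>2 \<le> S" for x unfolding S_def by (rule H_dom_sup_bound[OF f])
  have S0: "0 \<le> S" using S[of 0] by (rule order_trans[rotated]) simp
  have fL2: "f0 \<in> L2" using f by (simp add: H_dom_def)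
  have fin: "emeasure lebesgue (E \<inter> {c - L..c + L}) < \<infinity>"
  proof -
    have "emeasure lebesgue (E \<inter> {c - L..c + L}) \<le> emeasure lebesgue {c - L..c + L}"
      by (rule emeasure_mono) auto
    also have "\<dots> < \<infinity>" by (simp add: emeasure_lborel_Icc_eq)
    finally show ?thesis .
  qed
  have meas: "E \<inter> {c - L..c + L} \<in> sets lebesgue" using E by (intro sets.Int) auto
  have iw: "integrable lebesgue (\<lambda>x. weight c L x * (cmod (f0 x))\<^sup>2 / L)"
    by (intro integrable_divide weight_integrable L fL2)
  have ii: "integrable lebesgue (\<lambda>x. S * indicator (E \<inter> {c - L..c + L}) x)"
    by (intro integrable_mult_right integrable_real_indicator meas fin)
  have "(LINT x:E|lebesgue. (cmod (f0 x))\<^sup>2)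
      \<le> (LINT x|lebesgue. weight c L x * (cmod (f0 x))\<^sup>2 / L + S * indicator (E \<inter> {c - L..c + L}) x)"
    unfolding set_lebesgue_integral_def
  proof (rule integral_mono)
    show "integrable lebesgue (\<lambda>x. indicator E x *\<^sub>R (cmod (f0 x))\<^sup>2)"
      by (intro integrable_mult_indicator E L2_sq_integrable fL2)
    show "integrable lebesgue (\<lambda>x. weight c L x * (cmod (f0 x))\<^sup>2 / L + S * indicator (E \<inter> {c - L..c + L}) x)"
      by (intro Bochner_Integration.integrable_add iw ii)
    fix x
    show "indicator E x *\<^sub>R (cmod (f0 x))\<^sup>2 \<le> weight c L x * (cmod (f0 x))\<^sup>2 / L + S * indicator (E \<inter> {c - L..c + L}) x"
    proof (cases "x \<in> E")
      case True
      show ?thesis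
      proof (cases "x \<in> {c - L..c + L}")
        case x: True
        have "0 \<le> weight c L x * (cmod (f0 x))\<^sup>2 / L" using weight_nonneg[OF L] L by simp
        then show ?thesis using True x S[of x] by simp
      next
        case x: False
        then have "weight c L x = L" by (auto simp: weight_def)
        then show ?thesis using True x L by simp
      qed
    next
      case False
      then show ?thesis using weight_nonneg[OF L, of c x] L by simp
    qed
  qed
  also have "\<dots> = (LINT x|lebesgue. weight c L x * (cmod (f0 x))\<^sup>2) / L + S * measure lebesgue (E \<inter> {c - L..c + L})"
    using Bochner_Integration.integral_add[OF iw ii] meas by simp
  finally show ?thesis unfolding S_def .
qed

section \<open>Bump data and solutions localized uniformly in their centre\<close>

lemma loc_ac_restrict:
  assumes P: "loc_ac_deriv P p" and lr: "l \<le> r" "P l = 0" "P r = 0"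
  shows "loc_ac_deriv (\<lambda>x. indicator {l..r} x * P x) (\<lambda>x. indicator {l..r} x * p x)"
  unfolding loc_ac_deriv_def set_integrable_complex set_integral_complex
proof (intro allI impI)
  fix a b :: real assume ab: "a \<le> b"
  define a' b' where "a' = max a l" and "b' = min b r"
  have e: "indicator {a..b} x * (indicator {l..r} x * p x) = indicator {a'..b'} x * p x" for x
    by (auto simp: indicator_def a'_def b'_def)
  have i: "integrable lebesgue (\<lambda>x. indicator {a'..b'} x * p x)"
    using loc_ac_set_integrable[OF P] by (simp add: set_integrable_complex)
  have "indicator {l..r} b * P b - indicator {l..r} a * P a = (LINT x|lebesgue. indicator {a'..b'} x * p x)"
  proof (cases "a' \<le> b'")
    case True
    then have "P b' - P a' = (LINT x|lebesgue. indicator {a'..b'} x * p x)"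
      using loc_acD(2)[OF P True] by (simp add: set_integral_complex)
    moreover have "indicator {l..r} b * P b = P b'" "indicator {l..r} a * P a = P a'"
      using True ab lr by (auto simp: indicator_def a'_def b'_def min_def max_def)
    ultimately show ?thesis by simp
  next
    case False
    then have "indicator {l..r} b = (0::complex)" "indicator {l..r} a = (0::complex)"
      using ab lr by (auto simp: indicator_def a'_def b'_def min_def max_def split: if_splits)
    then show ?thesis using False by simp
  qed
  then show "integrable lebesgue (\<lambda>x. indicator {a..b} x * (indicator {l..r} x * p x)) \<and>
      indicator {l..r} b * P b - indicator {l..r} a * P a = (LINT x|lebesgue. indicator {a..b} x * (indicator {l..r} x * p x))"
    unfolding e using i by blast
qed

lemma integral_indicator_bounds:
  fixes g :: "real \<Rightarrow> complex"
  assumes "\<And>x. x \<in> {a..b} \<Longrightarrow> cmod (g x) \<le> M" and g: "(\<lambda>x. indicator {a..b} x * g x) \<in> L2" and ab: "a \<le> b"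
  shows "(LINT x|lebesgue. (cmod (indicator {a..b} x * g x))\<^sup>2) \<le> M\<^sup>2 * (b - a)"
proof -
  have "(LINT x|lebesgue. (cmod (indicator {a..b} x * g x))\<^sup>2) \<le> (LINT x|lebesgue. M\<^sup>2 * indicator {a..b} x)"
  proof (intro integral_mono L2_sq_integrable g integrable_mult_right integrable_real_indicator)
    show "(cmod (indicator {a..b} x * g x))\<^sup>2 \<le> M\<^sup>2 * indicator {a..b} x" for x
      using assms(1)[of x] by (auto simp: indicator_def power_mono)
  qed (auto simp: emeasure_lborel_Icc_eq)
  also have "\<dots> = M\<^sup>2 * (b - a)" using ab by simp
  finally show ?thesis .
qed

text \<open>The bump is (1 - (x - c)^2)^2 on [c - 1, c + 1]. Its double zeros at the ends keep the
  extension by 0 and its derivative locally absolutely continuous; only the second derivative jumps.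
  The bound 2 is the length of the interval, 32 is 4^2 times that length, and 1/4 comes from the
  middle half, where the bump is at least 1/2.\<close>

lemma ex_bump:
  "\<exists>h0 h1 h2. H_dom h0 h1 h2 \<and> (\<forall>x. 1 < \<bar>x - c\<bar> \<longrightarrow> h0 x = 0)
    \<and> 1 / 4 \<le> (norm (l2_class h0))\<^sup>2 \<and> (norm (l2_class h0))\<^sup>2 \<le> 2 \<and> (LINT x|lebesgue. (cmod (h1 x))\<^sup>2) \<le> 32"
proof -
  define I where "I = {c - 1..c + 1}"
  define P where "P x = (1 - (x - c)\<^sup>2)\<^sup>2" for x
  define P' where "P' x = - (4 * ((x - c) * (1 - (x - c)\<^sup>2)))" for x
  define P'' where "P'' x = 12 * (x - c)\<^sup>2 - 4" for x
  have "(P has_real_derivative P' x) (at x)" "(P' has_real_derivative P'' x) (at x)" for x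
    unfolding P_def P'_def P''_def by (auto intro!: derivative_eq_intros simp: algebra_simps power2_eq_square)
  moreover have cont: "continuous_on UNIV P" "continuous_on UNIV P'" "continuous_on UNIV P''"
    unfolding P_def P'_def P''_def by (intro continuous_intros)+
  ultimately have l: "loc_ac_deriv (\<lambda>x. of_real (P x)) (\<lambda>x. of_real (P' x))"
      "loc_ac_deriv (\<lambda>x. of_real (P' x)) (\<lambda>x. of_real (P'' x))"
    by (auto intro!: loc_ac_of_C1 continuous_on_of_real has_vector_derivative_of_real
        simp: has_real_derivative_iff_has_vector_derivative)
  define h0 where "h0 x = indicator I x * complex_of_real (P x)" for x
  define h1 where "h1 x = indicator I x * complex_of_real (P' x)" for x
  define h2 where "h2 x = indicator I x * complex_of_real (P'' x)" for x
  have lh: "loc_ac_deriv h0 h1" "loc_ac_deriv h1 h2"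
    unfolding h0_def h1_def h2_def I_def
    by (rule loc_ac_restrict[OF l(1)], simp_all add: P_def) (rule loc_ac_restrict[OF l(2)], simp_all add: P'_def)
  have hL2: "h0 \<in> L2" "h1 \<in> L2" "h2 \<in> L2"
    unfolding h0_def h1_def h2_def I_def by (intro L2_indicator_continuous continuous_on_of_real cont)+
  have "h0 x = 0" if "\<bar>c\<bar> + 2 \<le> \<bar>x\<bar>" for x
    using that by (auto simp: h0_def I_def indicator_def)
  from H_fun_L2(2)[OF loc_ac_continuous[OF lh(1)] this hL2(3)]
  have "H_dom h0 h1 h2" using lh hL2 by (simp add: H_dom_def)
  moreover have "h0 x = 0" if "1 < \<bar>x - c\<bar>" for x
    using that by (auto simp: h0_def I_def indicator_def)
  moreover have q: "(x - c)\<^sup>2 \<le> 1" if "x \<in> I" for x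
    using that by (auto simp: I_def abs_square_le_1 abs_le_iff)
  have "(LINT x|lebesgue. (cmod (h0 x))\<^sup>2) \<le> 1\<^sup>2 * ((c + 1) - (c - 1))"
    unfolding h0_def I_def
  proof (rule integral_indicator_bounds)
    fix x assume "x \<in> {c - 1..c + 1}"
    then have "\<bar>1 - (x - c)\<^sup>2\<bar> \<le> 1" using q[of x] by (simp add: I_def abs_le_iff)
    then have "\<bar>1 - (x - c)\<^sup>2\<bar>\<^sup>2 \<le> 1\<^sup>2" by (intro power_mono) auto
    then show "cmod (complex_of_real (P x)) \<le> 1" unfolding norm_of_real by (simp add: P_def)
  qed (use hL2(1) in \<open>simp_all add: h0_def[abs_def] I_def\<close>)
  then have "(norm (l2_class h0))\<^sup>2 \<le> 2" using hL2 by (simp add: norm_l2_class_sq)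
  moreover have "(LINT x|lebesgue. (cmod (h1 x))\<^sup>2) \<le> 4\<^sup>2 * ((c + 1) - (c - 1))"
    unfolding h1_def I_def
  proof (rule integral_indicator_bounds)
    fix x assume x: "x \<in> {c - 1..c + 1}"
    then have "\<bar>1 - (x - c)\<^sup>2\<bar> \<le> 1" using q[of x] by (simp add: I_def abs_le_iff)
    moreover have "\<bar>x - c\<bar> \<le> 1" using x by auto
    ultimately have "4 * (\<bar>x - c\<bar> * \<bar>1 - (x - c)\<^sup>2\<bar>) \<le> 4 * (1 * 1)"
      by (intro mult_left_mono mult_mono) auto
    then show "cmod (complex_of_real (P' x)) \<le> 4" unfolding norm_of_real by (simp add: P'_def abs_mult)
  qed (use hL2(2) in \<open>simp_all add: h1_def[abs_def] I_def\<close>)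
  moreover have "1 / 4 \<le> (norm (l2_class h0))\<^sup>2"
  proof -
    have "1 / 4 = (LINT x|lebesgue. (1/4 :: real) * indicator {c - 1/2..c + 1/2} x)" by simp
    also have "\<dots> \<le> (LINT x|lebesgue. (cmod (h0 x))\<^sup>2)"
    proof (intro integral_mono L2_sq_integrable hL2 integrable_mult_right integrable_real_indicator)
      show "(1/4) * indicator {c - 1/2..c + 1/2} x \<le> (cmod (h0 x))\<^sup>2" for x
      proof (cases "x \<in> {c - 1/2..c + 1/2}")
        case True
        then have "c - 1/2 \<le> x" "x \<le> c + 1/2" by auto
        then have "\<bar>x - c\<bar> \<le> 1/2" by linarith
        then have "\<bar>x - c\<bar>\<^sup>2 \<le> (1/2)\<^sup>2" by (intro power_mono) auto
        then have "3/4 \<le> 1 - (x - c)\<^sup>2" by (simp add: power2_eq_square)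
        then have "(3/4)\<^sup>2 \<le> P x" unfolding P_def by (intro power_mono) auto
        then have "1/2 \<le> P x" by (simp add: power2_eq_square)
        then have "(1/2)\<^sup>2 \<le> (P x)\<^sup>2" by (intro power_mono) auto
        moreover have "x \<in> I" using True by (auto simp: I_def)
        ultimately show ?thesis using True by (simp add: h0_def power2_eq_square)
      qed simp
    qed (auto simp: emeasure_lborel_Icc_eq)
    finally show ?thesis using hL2 by (simp add: norm_l2_class_sq)
  qed
  ultimately show ?thesis by (intro exI[of _ h0] exI[of _ h1] exI[of _ h2]) auto
qed

text \<open>The constant C is chosen before the centre c; this uniformity allows the bump to be
  moved to wherever E is thin.\<close>

theorem localized_solutions:
  assumes T: "0 < T"
  shows "\<exists>C>0. \<forall>c. \<exists>u. schroedinger_solution u \<and> 1 / 4 \<le> (LINT x|lebesgue. (cmod (u 0 x))\<^sup>2) \<and>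
    (\<forall>t\<in>{0..T}. \<forall>L>0. \<forall>E\<in>sets lebesgue.
      (LINT x:E|lebesgue. (cmod (u t x))\<^sup>2) \<le> C / L + C * measure lebesgue (E \<inter> {c - L..c + L}))"
proof -
  \<comment> \<open>The value of \<open>kinetic_bound\<close> for the bump: 2 * 32 + 4 T^2 *
    2.\<close>
  define \<kappa> where "\<kappa> = 64 + 8 * T\<^sup>2"
  \<comment> \<open>Large enough for two uses: the weighted mass up to time T is at most 2 + T
    (\<kappa> + 2), and the sup bound is at most 2 * 2 + \<kappa>.\<close>
  define C where "C = 4 + \<kappa> + T * (\<kappa> + 2)"
  have \<kappa>: "\<kappa> \<ge> 0" by (simp add: \<kappa>_def)
  have "C > 0" using T \<kappa> unfolding C_def by (intro add_pos_nonneg mult_nonneg_nonneg) auto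
  moreover have "\<exists>u. schroedinger_solution u \<and> 1 / 4 \<le> (LINT x|lebesgue. (cmod (u 0 x))\<^sup>2) \<and>
    (\<forall>t\<in>{0..T}. \<forall>L>0. \<forall>E\<in>sets lebesgue.
      (LINT x:E|lebesgue. (cmod (u t x))\<^sup>2) \<le> C / L + C * measure lebesgue (E \<inter> {c - L..c + L}))" for c
  proof -
    obtain h0 h1 h2 where h: "H_dom h0 h1 h2" "\<And>x. 1 < \<bar>x - c\<bar> \<Longrightarrow> h0 x = 0"
      "1 / 4 \<le> (norm (l2_class h0))\<^sup>2" "(norm (l2_class h0))\<^sup>2 \<le> 2" "(LINT x|lebesgue. (cmod (h1 x))\<^sup>2) \<le> 32"
      using ex_bump[of c] by blast
    have hL2: "h0 \<in> L2" using h(1) by (simp add: H_dom_def)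
    \<comment> \<open>The group reproduces h0 at time 0 only almost everywhere; with this choice the
      initial datum is h0 itself.\<close>
    define u where "u t = (if t = 0 then h0 else evol t h0)" for t
    have u_L2: "u t \<in> L2" for t using hL2 by (simp add: u_def)
    have u_class: "l2_class (u t) = H.group t (l2_class h0)" for t by (simp add: u_def l2_class_evol)
    have "\<forall>t. \<exists>f0 f1 f2. H_dom f0 f1 f2 \<and> H.group t (l2_class h0) = l2_class f0
        \<and> H.group t (l2_class (H_fun h0 h2)) = l2_class (H_fun f0 f2)"
      using flow_H_dom[OF h(1)] by blast
    then obtain f0 f1 f2 where f: "\<And>t. H_dom (f0 t) (f1 t) (f2 t)" "\<And>t. H.group t (l2_class h0) = l2_class (f0 t)"
      "\<And>t. H.group t (l2_class (H_fun h0 h2)) = l2_class (H_fun (f0 t) (f2 t))"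
      unfolding choice_iff by blast
    have sol: "schroedinger_solution u"
      unfolding schroedinger_solution_def
    proof (intro conjI exI[of _ evol] exp_minus_i_evol allI impI)
      show "u 0 \<in> L2" by (rule u_L2)
      fix t :: real
      have "l2_class (u t) = l2_class (evol t (u 0))" by (simp add: u_class l2_class_evol)
      then show "ae_eq (u t) (evol t (u 0))" using u_L2 by (simp add: l2_class_eq_iff)
    qed
    have K: "(LINT x|lebesgue. (cmod (f1 t x))\<^sup>2) \<le> \<kappa>" if "0 \<le> t" "t \<le> T" for t
    proof -
      have M: "0 < \<bar>c\<bar> + 2" by linarith
      have z: "h0 x = 0" if "\<bar>c\<bar> + 2 \<le> \<bar>x\<bar>" for x
      proof -
        have "1 < \<bar>x - c\<bar>" using that by linarith
        then show ?thesis by (rule h(2))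
      qed
      have "(LINT x|lebesgue. (cmod (f1 t x))\<^sup>2) \<le> 2 * (LINT x|lebesgue. (cmod (h1 x))\<^sup>2) + 4 * T\<^sup>2 * (norm (l2_class h0))\<^sup>2"
        by (rule kinetic_bound[OF h(1) M z T f that])
      moreover have "4 * T\<^sup>2 * (norm (l2_class h0))\<^sup>2 \<le> 4 * T\<^sup>2 * 2" using h(4) by (intro mult_left_mono) auto
      ultimately show ?thesis using h(5) by (simp add: \<kappa>_def)
    qed
    have "(LINT x:E|lebesgue. (cmod (u t x))\<^sup>2) \<le> C / L + C * measure lebesgue (E \<inter> {c - L..c + L})"
      if t: "t \<in> {0..T}" and L: "L > 0" and E: "E \<in> sets lebesgue" for t L E
    proof -
      have fL2: "f0 t \<in> L2" using f(1)[of t] by (simp add: H_dom_def)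
      have ae: "AE x in lebesgue. u t x = f0 t x"
        using u_class[of t] f(2)[of t] u_L2[of t] fL2 by (simp add: l2_class_eq_iff ae_eq_def)
      have N: "(LINT x|lebesgue. (cmod (f0 t x))\<^sup>2) \<le> 2"
        using h(4) H.norm_group[of t "l2_class h0"] f(2)[of t] fL2 by (simp flip: norm_l2_class_sq)
      \<comment> \<open>With the kinetic energy already bounded by \<kappa>, nothing has to be
        absorbed and s = 1 will do.\<close>
      have "\<bar>(LINT x|lebesgue. weight c L x * (cmod (f0 t x))\<^sup>2) - (LINT x|lebesgue. weight c L x * (cmod (h0 x))\<^sup>2)\<bar>
          \<le> t * (\<kappa> / 1 + 1 * (norm (l2_class h0))\<^sup>2)"
        by (rule weight_flow_bound[OF h(1) L _ _ f]) (use t K in auto)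
      moreover have "t * (\<kappa> / 1 + 1 * (norm (l2_class h0))\<^sup>2) \<le> T * (\<kappa> + 2)"
        using t h(4) \<kappa> by (intro mult_mono) auto
      \<comment> \<open>The datum lives within distance 1 of c, where the weight is at most 1 for
        every L.\<close>
      moreover have "(LINT x|lebesgue. weight c L x * (cmod (h0 x))\<^sup>2) \<le> (LINT x|lebesgue. (cmod (h0 x))\<^sup>2)"
      proof (intro integral_mono weight_integrable L hL2 L2_sq_integrable)
        show "weight c L x * (cmod (h0 x))\<^sup>2 \<le> (cmod (h0 x))\<^sup>2" for x
          using h(2)[of x] mult_right_mono[of "weight c L x" 1 "(cmod (h0 x))\<^sup>2"]
          by (cases "1 < \<bar>x - c\<bar>") (auto simp: weight_def)
      qed
      ultimately have Q: "(LINT x|lebesgue. weight c L x * (cmod (f0 t x))\<^sup>2) \<le> C"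
        using h(4) hL2 \<kappa> by (simp add: norm_l2_class_sq C_def)
      have "(LINT x:E|lebesgue. (cmod (u t x))\<^sup>2) = (LINT x:E|lebesgue. (cmod (f0 t x))\<^sup>2)"
        unfolding set_lebesgue_integral_def
      proof (rule integral_cong_AE)
        show "AE x in lebesgue. indicator E x *\<^sub>R (cmod (u t x))\<^sup>2 = indicator E x *\<^sub>R (cmod (f0 t x))\<^sup>2"
          using ae by eventually_elim simp
        show "(\<lambda>x. indicator E x *\<^sub>R (cmod (u t x))\<^sup>2) \<in> borel_measurable lebesgue"
          "(\<lambda>x. indicator E x *\<^sub>R (cmod (f0 t x))\<^sup>2) \<in> borel_measurable lebesgue"
          by (intro borel_measurable_integrable integrable_mult_indicator E L2_sq_integrable u_L2 fL2)+
      qed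
      also have "\<dots> \<le> (LINT x|lebesgue. weight c L x * (cmod (f0 t x))\<^sup>2) / L
          + (2 * (LINT x|lebesgue. (cmod (f0 t x))\<^sup>2) + (LINT x|lebesgue. (cmod (f1 t x))\<^sup>2)) * measure lebesgue (E \<inter> {c - L..c + L})"
        by (rule localized_mass_bound[OF f(1) L E])
      also have "\<dots> \<le> C / L + C * measure lebesgue (E \<inter> {c - L..c + L})"
      proof (intro add_mono divide_right_mono mult_right_mono Q)
        have "0 \<le> T * (\<kappa> + 2)" using T \<kappa> by simp
        then show "2 * (LINT x|lebesgue. (cmod (f0 t x))\<^sup>2) + (LINT x|lebesgue. (cmod (f1 t x))\<^sup>2) \<le> C"
          using N K[of t] t by (simp add: C_def)
      qed (use L in auto)
      finally show ?thesis .
    qed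
    moreover have "1 / 4 \<le> (LINT x|lebesgue. (cmod (u 0 x))\<^sup>2)" using h(3) hL2 by (simp add: u_def norm_l2_class_sq)
    ultimately show ?thesis using sol by blast
  qed
  ultimately show ?thesis by blast
qed

subsection \<open>Observability\<close>

text \<open>A function that is not integrable has integral 0 by convention, and the signs of M and T
  cover that case. The mass of a solution in E is thus estimated time by time, without discussing
  its measurability in time.\<close>

lemma set_integral_le_const:
  fixes g :: "real \<Rightarrow> real"
  assumes "\<And>t. t \<in> {0..T} \<Longrightarrow> g t \<le> M" and "0 \<le> M" "0 \<le> T"
  shows "(LINT t:{0..T}|lebesgue. g t) \<le> T * M"
proof (cases "set_integrable lebesgue {0..T} g")
  case True
  then have "(LINT t:{0..T}|lebesgue. g t) \<le> (LINT t|lebesgue. M * indicator {0..T} t)"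
    unfolding set_lebesgue_integral_def set_integrable_def
    by (intro integral_mono integrable_mult_right integrable_real_indicator)
      (use assms in \<open>auto simp: indicator_def emeasure_lborel_Icc_eq\<close>)
  then show ?thesis using assms by (simp add: mult.commute)
next
  case False
  then have "(LINT t:{0..T}|lebesgue. g t) = 0"
    unfolding set_lebesgue_integral_def set_integrable_def by (rule not_integrable_integral_eq)
  then show ?thesis using assms by simp
qed

text \<open>The window size L is fixed from the constants first, and only then is the centre chosen
  where E is thin in a window of that size. The observed mass is then O(1/L), against an initial
  mass of at least 1/4.\<close>

theorem not_observable:
  assumes T: "T > 0" and E: "E \<in> sets lebesgue"
    and small: "\<And>L \<delta>. L > 0 \<Longrightarrow> \<delta> > 0 \<Longrightarrow> \<exists>c. measure lebesgue (E \<inter> {c - L..c + L}) < \<delta>"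
  shows "\<not> observable_set_at T E"
proof
  assume "observable_set_at T E"
  then obtain B where B: "B > 0" and obs: "\<And>u. schroedinger_solution u \<Longrightarrow> (LINT x|lebesgue. (cmod (u 0 x))\<^sup>2)
      \<le> B * (LINT t:{0..T}|lebesgue. (LINT x:E|lebesgue. (cmod (u t x))\<^sup>2))"
    unfolding observable_set_at_def by blast
  obtain C where C: "C > 0" and sol: "\<And>c. \<exists>u. schroedinger_solution u \<and> 1 / 4 \<le> (LINT x|lebesgue. (cmod (u 0 x))\<^sup>2) \<and>
    (\<forall>t\<in>{0..T}. \<forall>L>0. \<forall>E\<in>sets lebesgue.
      (LINT x:E|lebesgue. (cmod (u t x))\<^sup>2) \<le> C / L + C * measure lebesgue (E \<inter> {c - L..c + L}))"
    using localized_solutions[OF T] by blast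
  \<comment> \<open>Chosen so that B T (2 C / L) = 1/8, below the initial mass 1/4.\<close>
  define L where "L = 16 * B * T * C"
  have L: "L > 0" using B T C by (simp add: L_def)
  obtain c where c: "measure lebesgue (E \<inter> {c - L..c + L}) < 1 / L" using small[OF L, of "1 / L"] L by auto
  obtain u where u: "schroedinger_solution u" "1 / 4 \<le> (LINT x|lebesgue. (cmod (u 0 x))\<^sup>2)"
    "\<And>t. t \<in> {0..T} \<Longrightarrow> (LINT x:E|lebesgue. (cmod (u t x))\<^sup>2) \<le> C / L + C * measure lebesgue (E \<inter> {c - L..c + L})"
    using sol[of c] L E by blast
  have "C * measure lebesgue (E \<inter> {c - L..c + L}) < C * (1 / L)" using c C by (intro mult_strict_left_mono) auto
  then have lt: "C / L + C * measure lebesgue (E \<inter> {c - L..c + L}) < 2 * C / L" by simp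
  have "(LINT t:{0..T}|lebesgue. (LINT x:E|lebesgue. (cmod (u t x))\<^sup>2))
      \<le> T * (C / L + C * measure lebesgue (E \<inter> {c - L..c + L}))"
    by (rule set_integral_le_const) (use u(3) C L T in auto)
  also have "\<dots> < T * (2 * C / L)" using lt T by (intro mult_strict_left_mono) auto
  finally have "B * (LINT t:{0..T}|lebesgue. (LINT x:E|lebesgue. (cmod (u t x))\<^sup>2)) < B * (T * (2 * C / L))"
    using B by (intro mult_strict_left_mono) auto
  also have "\<dots> = 1 / 8" using B T C by (simp add: L_def)
  finally show False using obs[OF u(1)] u(2) by linarith
qed

text \<open>The part [0, x] alone contains about x / (2 L) adjacent windows of length 2 L, each
  meeting E in measure at least \<delta>; for large x this gives density at least \<delta> / (4
  L).\<close>

lemma weakly_thick_of_uniform: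
  assumes E: "E \<in> sets lebesgue" and L: "L > 0" and \<delta>: "\<delta> > 0"
    and large: "\<And>c. \<delta> \<le> measure lebesgue (E \<inter> {c - L..c + L})"
  shows "weakly_thick E"
proof -
  have fm: "E \<inter> {a..b} \<in> fmeasurable lebesgue" for a b
  proof -
    have "{a..b} \<inter> E \<in> fmeasurable lebesgue" by (rule fmeasurable_Int_fmeasurable) (use E in auto)
    then show ?thesis by (simp add: Int_commute)
  qed
  have grow: "real n * \<delta> \<le> measure lebesgue (E \<inter> {0..2 * L * real n})" for n
  proof (induction n)
    case (Suc n)
    let ?a = "2 * L * real n" and ?b = "2 * L * real (Suc n)"
    have b: "(?a + L) - L = ?a" "(?a + L) + L = ?b" "0 \<le> ?a" "?a \<le> ?b" using L by (simp_all add: algebra_simps)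
    have "measure lebesgue (E \<inter> {0..?a} \<union> E \<inter> {?a..?b}) = measure lebesgue (E \<inter> {0..?a}) + measure lebesgue (E \<inter> {?a..?b})"
    proof (rule measure_Un_AE)
      \<comment> \<open>Consecutive closed windows share one endpoint, a null set, so their measures
        still add.\<close>
      have "AE x in lebesgue. x \<noteq> ?a" by (simp add: AE_completion AE_lborel_singleton)
      then show "AE x in lebesgue. x \<notin> E \<inter> {0..?a} \<or> x \<notin> E \<inter> {?a..?b}" by eventually_elim auto
    qed (rule fm)+
    moreover have "E \<inter> {0..?a} \<union> E \<inter> {?a..?b} = E \<inter> {0..?b}"
      using ivl_disj_un_two_touch(4)[OF b(3,4)] by (simp flip: Int_Un_distrib)
    moreover have "\<delta> \<le> measure lebesgue (E \<inter> {?a..?b})" using large[of "?a + L"] unfolding b(1,2) .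
    ultimately show ?case using Suc by (simp add: algebra_simps)
  qed simp
  have "\<forall>\<^sub>F x in at_top. ereal (\<delta> / (4 * L)) \<le> ereal (measure lebesgue (E \<inter> {-x..x}) / x)"
    using eventually_ge_at_top[of "4 * L"]
  proof eventually_elim
    case (elim x)
    then have x: "x > 0" using L by linarith
    define n where "n = nat \<lfloor>x / (2 * L)\<rfloor>"
    have n: "real n \<le> x / (2 * L)" "x / (2 * L) < real n + 1"
      using x L by (simp_all add: n_def)
    have "2 * L * real n \<le> x" using n(1) L by (simp add: field_simps)
    then have "measure lebesgue (E \<inter> {0..2 * L * real n}) \<le> measure lebesgue (E \<inter> {-x..x})"
      using x by (intro measure_mono_fmeasurable fm) (use fm in \<open>auto simp: fmeasurable_def\<close>)
    with grow[of n] have "real n * \<delta> \<le> measure lebesgue (E \<inter> {-x..x})" by linarith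
    \<comment> \<open>For x >= 4 L, rounding x / (2 L) down loses at most half of it.\<close>
    moreover have "x / (4 * L) \<le> real n"
    proof -
      have "1 \<le> x / (4 * L)" using elim L by (simp add: field_simps)
      moreover have "x / (2 * L) = x / (4 * L) + x / (4 * L)" by (simp add: field_simps)
      ultimately show ?thesis using n(2) by linarith
    qed
    then have "x / (4 * L) * \<delta> \<le> real n * \<delta>" using \<delta> by (intro mult_right_mono) auto
    ultimately have "x / (4 * L) * \<delta> \<le> measure lebesgue (E \<inter> {-x..x})" by linarith
    then show ?case using x by (simp add: field_simps)
  qed
  from Liminf_bounded[OF this]
  show ?thesis unfolding weakly_thick_def using \<delta> L by (intro less_le_trans[OF _ \<open>_ \<le> Liminf _ _\<close>]) simp
qed

theorem theorem1p4:
  shows "(\<forall>E::real set. E \<in> sets lebesgue \<longrightarrow> observable_set_at_some_time E \<longrightarrow> weakly_thick E) \<and>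
         (\<forall>T::real. T > 0 \<longrightarrow> \<not> observable_set_at T {0<..} \<and> \<not> observable_set_at T {..<0})"
proof (intro conjI allI impI)
  fix E :: "real set" assume E: "E \<in> sets lebesgue" and "observable_set_at_some_time E"
  then obtain T where T: "T > 0" "observable_set_at T E" unfolding observable_set_at_some_time_def by blast
  \<comment> \<open>Contraposition of \<open>not_observable\<close>: for some size L the windows are
    not arbitrarily thin, that is, all windows of that size meet E in measure at least
    \<delta>.\<close>
  then obtain L \<delta> where "L > 0" "\<delta> > 0" "\<not> (\<exists>c. measure lebesgue (E \<inter> {c - L..c + L}) < \<delta>)"
    using not_observable[OF T(1) E] by blast
  then show "weakly_thick E" by (intro weakly_thick_of_uniform[OF E, of L \<delta>]) (auto simp: not_less)
next
  fix T :: real assume T: "T > 0"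
  show "\<not> observable_set_at T {0<..}"
  proof (rule not_observable[OF T])
    fix L \<delta> :: real assume "L > 0" "\<delta> > 0"
    \<comment> \<open>A half-line is weakly thick, so part (i) does not decide this case; but a
      window of any size fits on the other side, here [-2 L, 0].\<close>
    have "{0<..} \<inter> {- L - L..- L + L} = {}" by auto
    then show "\<exists>c. measure lebesgue ({0<..} \<inter> {c - L..c + L}) < \<delta>" using \<open>\<delta> > 0\<close> by (intro exI[of _ "- L"]) simp
  qed simp
  show "\<not> observable_set_at T {..<0}"
  proof (rule not_observable[OF T])
    fix L \<delta> :: real assume "L > 0" "\<delta> > 0"
    have "{..<0} \<inter> {L - L..L + L} = {}" by auto
    then show "\<exists>c. measure lebesgue ({..<0} \<inter> {c - L..c + L}) < \<delta>" using \<open>\<delta> > 0\<close> by (intro exI[of _ L]) simp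
  qed simp
qed

end
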